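(* A polytope $P$ is an inscribed belt polytope if and only if all $2$-dimensional faces of $P$ are inscribed belt polygons. A polytope $P$ is an inscribed zonotope if and only if all $2$-dimensional faces of $P$ are inscribed and centrally-symmetric.
   Context: A polytope is inscribed if its vertices lie on a common sphere. The normal fan of a polytope $P\subset\mathbb{R}^d$ is the collection of normal cones $\{c:\langle c,x\rangle=\max_{y\in P}\langle c,y\rangle\ \forall x\in F\}$ of nonempty faces $F$. A belt polytope is a polytope whose normal fan is the fan of an arrangement of linear hyperplanes (the fan formed by the closures of the connected components of the complement of the hyperplanes and their faces). A belt polygon is a polygon with an even number of edges whose (combinatorially) opposite edges are parallel. A zonotope is a translate of a Minkowski sum of segments $[-z_1,z_1]+\cdots+[-z_n,z_n]$. *)

theory Defs
  imports "HOL-Analysis.Analysis"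
begin

definition inscribed :: "'a::euclidean_space set \<Rightarrow> bool" where
  "inscribed P \<longleftrightarrow> (\<exists>c r. r > 0 \<and> {v. v extreme_point_of P} \<subseteq> sphere c r)"

definition normal_cone :: "'a::euclidean_space set \<Rightarrow> 'a set \<Rightarrow> 'a set" where
  "normal_cone P F = {c. \<forall>x\<in>F. \<forall>y\<in>P. c \<bullet> y \<le> c \<bullet> x}"

definition normal_fan :: "'a::euclidean_space set \<Rightarrow> 'a set set" where
  "normal_fan P = {normal_cone P F | F. F face_of P \<and> F \<noteq> {}}"

definition linear_hyperplane :: "'a::euclidean_space set \<Rightarrow> bool" where
  "linear_hyperplane h \<longleftrightarrow> (\<exists>a. a \<noteq> 0 \<and> h = {x. a \<bullet> x = 0})"

text \<open>The empty set is a face in the sense of \<^const>\<open>face_of\<close>, but it is not a cone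
  of the fan.\<close>

definition arrangement_fan :: "'a::euclidean_space set set \<Rightarrow> 'a set set" where
  "arrangement_fan \<H> =
    {F. F \<noteq> {} \<and> (\<exists>C \<in> components (UNIV - \<Union>\<H>). F face_of closure C)}"

text \<open>The arrangement may be empty; its fan is then \<^term>\<open>{UNIV}\<close>, the normal fan of a point.\<close>

definition belt_polytope :: "'a::euclidean_space set \<Rightarrow> bool" where
  "belt_polytope P \<longleftrightarrow> polytope P \<and>
    (\<exists>\<H>. finite \<H> \<and> (\<forall>h\<in>\<H>. linear_hyperplane h) \<and> normal_fan P = arrangement_fan \<H>)"

text \<open>The function \<open>E\<close> lists the edges in cyclic order, consecutive edges sharing a vertex.
  Such a listing of the edges of a polygon is unique up to rotation and reflection, and the
  edge opposite to \<open>E i\<close> is \<open>E (i + k)\<close>.\<close>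

definition belt_polygon :: "'a::euclidean_space set \<Rightarrow> bool" where
  "belt_polygon Q \<longleftrightarrow> polytope Q \<and> aff_dim Q = 2 \<and>
    (\<exists>k E. bij_betw E {..<2 * k} {e. e edge_of Q} \<and>
           (\<forall>i<2 * k. E i \<inter> E (Suc i mod (2 * k)) \<noteq> {}) \<and>
           (\<forall>i<k. affine_parallel (affine hull E i) (affine hull E (i + k))))"

text \<open>The sum is the Minkowski sum of sets; the empty sum is \<^term>\<open>{0}\<close>.\<close>

definition zonotope :: "'a::euclidean_space set \<Rightarrow> bool" where
  "zonotope P \<longleftrightarrow>
    (\<exists>t (n::nat) z. P = (+) t ` (\<Sum>i<n. closed_segment (- z i) (z i)))"

definition centrally_symmetric :: "'a::euclidean_space set \<Rightarrow> bool" where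
  "centrally_symmetric Q \<longleftrightarrow> (\<exists>c. (\<lambda>x. 2 *\<^sub>R c - x) ` Q = Q)"

end

theory Submission imports Defs begin

text \<open>
  For a functional \<open>c\<close> let \<open>P\<^sup>c\<close> be the face of \<open>P\<close> on which \<open>c\<close> is maximal. In a belt polygon, and in a
  centrally symmetric polygon, \<open>c \<bottom> u\<close> for an edge direction \<open>u\<close> forces \<open>P\<^sup>c\<close> to have an edge parallel
  to \<open>u\<close>. By induction on the dimension a polytope inherits this from its 2-faces. So \<open>P\<^sup>c\<close> is a vertex
  exactly if \<open>c\<close> lies off the hyperplanes \<open>u\<^sup>\<bottom>\<close>, which means that the normal fan is the fan of these
  hyperplanes; conversely, if the fan is that of an arrangement, then the arrangement contains all
  \<open>u\<^sup>\<bottom>\<close>, and a 2-face has with every edge also a parallel one opposite to it.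

  If moreover the 2-faces are inscribed, then edges at a common vertex enclose angles of at least
  \<open>\<pi>/2\<close>, hence they are linearly independent. So for each vertex there is a point equidistant from it
  and all its neighbours, and any two edges at a vertex span a 2-face. The circle through the vertices
  of such a 2-face shows that this point stays the same along edges.

  If the 2-faces are centrally symmetric, then parallel edges have equal length, and passing from a
  vertex to a neighbour reverses the sign of exactly one edge direction, as in a zonotope.
\<close>

section \<open>Faces exposed by functionals\<close>

text \<open>The obstacle is that parallel edges of \<open>P\<close> may lie in 2-faces far apart, so
  that no single 2-face compares them. Functionals can be moved where faces cannot: sweeping them
  through the hyperplane orthogonal to an edge links up all edges parallel to it. Therefore fans,
  cyclic edge lists and sums of segments are all expressed through \<open>max_face\<close>. Two
  facts do the work: near \<open>c\<close> only subsets of the face exposed by \<open>c\<close> are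
  exposed, and a functional orthogonal to no edge exposes a vertex. The same sweep runs with a whole
  line of edge vectors, which preserves directions, and with a single vector, which also preserves
  lengths, as a zonotope requires. Since \<open>P\<close> need not be full-dimensional, functionals
  are projected to the direction space of \<open>P\<close> where necessary.\<close>

definition max_face :: "'a::euclidean_space set \<Rightarrow> 'a \<Rightarrow> 'a set" where
  "max_face P c = {x \<in> P. \<forall>y\<in>P. c \<bullet> y \<le> c \<bullet> x}"

lemma max_face_subset: "max_face P c \<subseteq> P"
  by (auto simp: max_face_def)

lemma max_faceD: "x \<in> max_face P c \<Longrightarrow> y \<in> P \<Longrightarrow> c \<bullet> y \<le> c \<bullet> x"
  by (auto simp: max_face_def)

lemma max_face_inner_eq: "x \<in> max_face P c \<Longrightarrow> y \<in> max_face P c \<Longrightarrow> c \<bullet> x = c \<bullet> y"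
  by (meson antisym max_faceD max_face_subset subsetD)

lemma max_face_eq_hyperplane:
  "x \<in> max_face P c \<Longrightarrow> max_face P c = P \<inter> {y. c \<bullet> y = c \<bullet> x}"
  by (auto simp: max_face_def intro: antisym)

lemma max_face_ne:
  assumes "polytope P" "P \<noteq> {}"
  shows "max_face P c \<noteq> {}"
proof -
  have "continuous_on P (\<lambda>x. c \<bullet> x)"
    by (intro continuous_intros)
  from continuous_attains_sup[OF polytope_imp_compact[OF assms(1)] assms(2) this]
  show ?thesis
    by (auto simp: max_face_def)
qed

lemma max_face_face:
  assumes "convex P"
  shows "max_face P c face_of P"
proof (cases "max_face P c = {}")
  case False
  then obtain x where x: "x \<in> max_face P c"
    by auto
  show ?thesis
    unfolding max_face_eq_hyperplane[OF x]
    by (rule face_of_Int_supporting_hyperplane_le[OF assms]) (use x in \<open>auto dest: max_faceD\<close>)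
qed simp

lemma max_face_polytope: "polytope P \<Longrightarrow> polytope (max_face P c)"
  by (meson face_of_polytope_polytope max_face_face polytope_imp_convex)

lemma max_face_const:
  assumes "\<And>x y. x \<in> P \<Longrightarrow> y \<in> P \<Longrightarrow> c \<bullet> x = c \<bullet> y"
  shows "max_face P c = P"
  using assms max_face_def by (smt (verit, best) Collect_cong Collect_mem_eq)

lemma max_face_cong:
  assumes "\<And>x y. x \<in> P \<Longrightarrow> y \<in> P \<Longrightarrow> c \<bullet> (x - y) = d \<bullet> (x - y)"
  shows "max_face P c = max_face P d"
proof -
  have "c \<bullet> y \<le> c \<bullet> x \<longleftrightarrow> d \<bullet> y \<le> d \<bullet> x" if "x \<in> P" "y \<in> P" for x y
    using assms[OF that] by (metis diff_ge_0_iff_ge inner_diff_right)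
  then show ?thesis
    by (auto simp: max_face_def)
qed

lemma max_face_scale:
  assumes "r > 0"
  shows "max_face P (r *\<^sub>R c) = max_face P c"
  using assms by (simp add: max_face_def)

text \<open>With semicontinuity this lets a functional close to \<open>c\<close> be evaluated inside
  the face exposed by \<open>c\<close> instead of on all of \<open>P\<close>.\<close>

lemma max_face_sub:
  assumes "polytope P" "P \<noteq> {}" "max_face P c \<subseteq> F" "F \<subseteq> P"
  shows "max_face F c = max_face P c"
proof -
  obtain x where x: "x \<in> max_face P c"
    using max_face_ne[OF assms(1,2)] by blast
  have xF: "x \<in> max_face F c"
    using x assms(3,4) by (auto simp: max_face_def)
  show ?thesis
    unfolding max_face_eq_hyperplane[OF x] max_face_eq_hyperplane[OF xF]
    using assms(3,4) max_face_eq_hyperplane[OF x] by blast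
qed

lemma face_eq_max_face:
  assumes "polytope P" "F face_of P" "F \<noteq> {}"
  shows "\<exists>c. F = max_face P c"
proof -
  have "F exposed_face_of P"
    using assms exposed_face_of_polyhedron polytope_imp_polyhedron by blast
  then obtain a b where ab: "P \<subseteq> {x. a \<bullet> x \<le> b}" "F = P \<inter> {x. a \<bullet> x = b}"
    unfolding exposed_face_of_def by auto
  then have "F = max_face P a"
    using assms(3) by (fastforce simp: max_face_def)
  then show ?thesis ..
qed

lemma polytope_eq_hull_extreme:
  fixes P :: "'a::euclidean_space set"
  assumes "polytope P"
  shows "P = convex hull {v. v extreme_point_of P}"
  by (intro Krein_Milman_Minkowski polytope_imp_compact polytope_imp_convex assms)

lemma polytope_finite_extreme:
  fixes P :: "'a::euclidean_space set"
  shows "polytope P \<Longrightarrow> finite {v. v extreme_point_of P}"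
  using finite_polyhedron_extreme_points polytope_imp_polyhedron by blast

lemma polytope_extreme_ne:
  fixes P :: "'a::euclidean_space set"
  assumes "polytope P" "P \<noteq> {}"
  shows "\<exists>v. v extreme_point_of P"
  using polytope_eq_hull_extreme[OF assms(1)] assms(2) by force

text \<open>Only finitely many vertices lie off the face exposed by \<open>c\<close>. At
  \<open>c\<close>, and hence at all functionals nearby, each of them is strictly below a fixed
  point \<open>v0\<close> of that face, so none can be optimal.\<close>

lemma max_face_usc:
  assumes "polytope P"
  shows "\<exists>e>0. \<forall>d. dist d c < e \<longrightarrow> max_face P d \<subseteq> max_face P c"
proof (cases "P = {}")
  case True
  then show ?thesis
    by (auto simp: max_face_def intro: exI[of _ 1])
next
  case False
  then obtain v0 where v0: "v0 \<in> max_face P c"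
    using max_face_ne assms by blast
  define V where "V = {v. v extreme_point_of P} - max_face P c"
  have fin: "finite V"
    unfolding V_def using polytope_finite_extreme[OF assms] by simp
  define U where "U = (\<Inter>v\<in>V. {d. d \<bullet> v < d \<bullet> v0})"
  have "open U"
    unfolding U_def using fin
    by (intro open_INT ballI open_Collect_less continuous_intros)
  moreover have "c \<in> U"
    using v0 by (fastforce simp: U_def V_def max_face_def extreme_point_of_def)
  ultimately obtain e where e: "e > 0" "ball c e \<subseteq> U"
    using open_contains_ball by blast
  have "max_face P d \<subseteq> max_face P c" if "dist d c < e" for d
  proof -
    have dU: "d \<in> U"
      using e that by (auto simp: dist_commute)
    have ext: "{v. v extreme_point_of max_face P d} \<subseteq> max_face P c"
    proof safe
      fix v assume v: "v extreme_point_of max_face P d"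
      then have "v extreme_point_of P" "v \<in> max_face P d"
        using extreme_point_of_face[OF max_face_face] assms polytope_imp_convex by blast+
      moreover from this have "d \<bullet> v0 \<le> d \<bullet> v"
        using v0 by (auto simp: max_face_def)
      ultimately have "\<not> d \<bullet> v < d \<bullet> v0" "v \<notin> V \<Longrightarrow> v \<in> max_face P c"
        by (auto simp: V_def)
      then show "v \<in> max_face P c"
        using dU unfolding U_def by blast
    qed
    have "convex hull {v. v extreme_point_of max_face P d} \<subseteq> max_face P c"
      by (rule hull_minimal[OF ext])
        (use assms max_face_polytope polytope_imp_convex in blast)
    then show ?thesis
      using polytope_eq_hull_extreme[OF max_face_polytope[OF assms]] by blast
  qed
  then show ?thesis
    using e by blast
qed

text \<open>A small multiple of \<open>d\<close> cannot leave the face exposed by \<open>c\<close>,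
  and on that face \<open>c\<close> is constant, so \<open>d\<close> alone decides. This lifts a
  functional chosen for a face to one for \<open>P\<close>.\<close>

lemma max_face_perturb:
  assumes "polytope P" "P \<noteq> {}"
  shows "\<exists>e0>0. \<forall>e. 0 < e \<and> e < e0 \<longrightarrow> max_face P (c + e *\<^sub>R d) = max_face (max_face P c) d"
proof -
  obtain r where r: "r > 0" "\<And>d. dist d c < r \<Longrightarrow> max_face P d \<subseteq> max_face P c"
    using max_face_usc[OF assms(1)] by blast
  have "max_face P (c + e *\<^sub>R d) = max_face (max_face P c) d"
    if e: "0 < e" "e < r / (norm d + 1)" for e
  proof -
    have "e * norm d \<le> e * (norm d + 1)"
      using e by simp
    also have "\<dots> < r"
      using e(2) by (simp add: pos_less_divide_eq add_nonneg_pos)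
    finally have "dist (c + e *\<^sub>R d) c < r"
      using e by (simp add: dist_norm)
    then have sub: "max_face P (c + e *\<^sub>R d) \<subseteq> max_face P c"
      by (rule r)
    have "max_face P (c + e *\<^sub>R d) = max_face (max_face P c) (c + e *\<^sub>R d)"
      using max_face_sub[OF assms sub max_face_subset] by simp
    also have "\<dots> = max_face (max_face P c) (e *\<^sub>R d)"
    proof (rule max_face_cong)
      fix x y assume "x \<in> max_face P c" "y \<in> max_face P c"
      then have "c \<bullet> (x - y) = 0"
        using max_face_inner_eq[of x P c y] by (simp add: inner_diff_right)
      then show "(c + e *\<^sub>R d) \<bullet> (x - y) = (e *\<^sub>R d) \<bullet> (x - y)"
        by (simp add: inner_add_left)
    qed
    finally show ?thesis
      using e by (simp add: max_face_scale)
  qed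
  moreover have "r / (norm d + 1) > 0"
    using r by (simp add: add_nonneg_pos)
  ultimately show ?thesis
    by blast
qed

lemma max_face_singleton_extreme:
  assumes "polytope P" "max_face P c = {v}"
  shows "v extreme_point_of P"
  using assms face_of_singleton max_face_face polytope_imp_convex by metis

lemma extreme_max_face:
  assumes "polytope P" "v extreme_point_of P"
  shows "\<exists>c. max_face P c = {v}"
  using assms face_eq_max_face face_of_singleton by (metis insert_not_empty)

text \<open>The functionals maximised at \<open>v\<close> form a closed set and, by semicontinuity, an open one.\<close>

lemma max_face_const_on_connected:
  assumes P: "polytope P" "P \<noteq> {}"
    and C: "connected C" "d \<in> C" "max_face P d = {v}"
    and sing: "\<And>c. c \<in> C \<Longrightarrow> \<exists>x. max_face P c = {x}"
    and c: "c \<in> C"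
  shows "max_face P c = {v}"
proof -
  define T where "T = {c \<in> C. v \<in> max_face P c}"
  have T: "T = {c \<in> C. max_face P c = {v}}"
    using sing unfolding T_def by fastforce
  have vP: "v \<in> P"
    using C max_face_subset by blast
  have "T = C \<inter> (\<Inter>y\<in>P. {c. c \<bullet> y \<le> c \<bullet> v})"
    using vP by (auto simp: T_def max_face_def)
  moreover have "closed (\<Inter>y\<in>P. {c. c \<bullet> y \<le> c \<bullet> v})"
    by (intro closed_INT ballI closed_Collect_le continuous_intros)
  ultimately have 1: "closedin (top_of_set C) T"
    by (metis closedin_closed_Int)
  have 2: "openin (top_of_set C) T"
    unfolding openin_euclidean_subtopology_iff
  proof (intro conjI ballI)
    show "T \<subseteq> C"
      by (auto simp: T_def)
    fix c assume "c \<in> T"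
    then have c: "c \<in> C" "max_face P c = {v}"
      by (auto simp: T)
    obtain e where "e > 0" and e: "\<And>d. dist d c < e \<Longrightarrow> max_face P d \<subseteq> max_face P c"
      using max_face_usc[OF P(1)] by blast
    have "max_face P d = {v}" if "dist d c < e" for d
      using e[OF that] max_face_ne[OF P, of d] c by auto
    then show "\<exists>e>0. \<forall>x'\<in>C. dist x' c < e \<longrightarrow> x' \<in> T"
      using \<open>e > 0\<close> by (auto simp: T)
  qed
  have "T = {} \<or> T = C"
    using C(1) 1 2 connected_clopen by blast
  moreover have "d \<in> T"
    using C by (auto simp: T)
  ultimately show ?thesis
    using c by (auto simp: T)
qed

lemma max_face_segment_end:
  assumes v: "\<And>s. 0 < s \<Longrightarrow> s < 1 \<Longrightarrow> v \<in> max_face P ((1 - s) *\<^sub>R c + s *\<^sub>R d)"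
  shows "v \<in> max_face P c \<and> v \<in> max_face P d"
proof -
  have vP: "v \<in> P"
    using v[of "1/2"] max_face_subset by fastforce
  have *: "((1 - s) *\<^sub>R c + s *\<^sub>R d) \<bullet> y \<le> ((1 - s) *\<^sub>R c + s *\<^sub>R d) \<bullet> v"
    if "s \<in> {0..1}" "y \<in> P" for s y
  proof -
    have "closure {0<..<1} \<subseteq> {s. ((1 - s) *\<^sub>R c + s *\<^sub>R d) \<bullet> y \<le> ((1 - s) *\<^sub>R c + s *\<^sub>R d) \<bullet> v}"
    proof (rule closure_minimal)
      show "{0<..<1} \<subseteq> {s. ((1 - s) *\<^sub>R c + s *\<^sub>R d) \<bullet> y \<le> ((1 - s) *\<^sub>R c + s *\<^sub>R d) \<bullet> v}"
        using v that(2) max_faceD by fastforce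
      show "closed {s. ((1 - s) *\<^sub>R c + s *\<^sub>R d) \<bullet> y \<le> ((1 - s) *\<^sub>R c + s *\<^sub>R d) \<bullet> v}"
        by (intro closed_Collect_le continuous_intros)
    qed
    then show ?thesis
      using that by auto
  qed
  from *[of 0] *[of 1] show ?thesis
    using vP by (auto simp: max_face_def)
qed

text \<open>If only vertices are exposed strictly between two functionals, it is always the same
  vertex, and it survives on both end faces. This is how two faces are shown to meet.\<close>

lemma max_face_segment_const:
  assumes P: "polytope P" "P \<noteq> {}"
    and sing: "\<And>s. 0 < s \<Longrightarrow> s < 1 \<Longrightarrow> \<exists>x. max_face P ((1 - s) *\<^sub>R c + s *\<^sub>R d) = {x}"
  shows "\<exists>v. v \<in> max_face P c \<and> v \<in> max_face P d"
proof -
  obtain v where v: "max_face P ((1 - 1/2) *\<^sub>R c + (1/2) *\<^sub>R d) = {v}"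
    using sing[of "1/2"] by fastforce
  define C where "C = (\<lambda>s. (1 - s) *\<^sub>R c + s *\<^sub>R d) ` {0<..<1}"
  have "connected C"
    unfolding C_def by (intro connected_continuous_image continuous_intros) auto
  moreover have "(1 - 1/2) *\<^sub>R c + (1/2) *\<^sub>R d \<in> C"
    unfolding C_def by (rule image_eqI[of _ _ "1/2"]) auto
  moreover have "\<exists>x. max_face P b = {x}" if "b \<in> C" for b
    using that sing by (auto simp: C_def)
  ultimately have "max_face P b = {v}" if "b \<in> C" for b
    using max_face_const_on_connected[OF P _ _ v, of C b] that by blast
  then have "v \<in> max_face P ((1 - s) *\<^sub>R c + s *\<^sub>R d)" if "0 < s" "s < 1" for s
    using that by (auto simp: C_def)
  then show ?thesis
    using max_face_segment_end by blast
qed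

section \<open>Edges as oriented vectors\<close>

definition edge_vec :: "'a::euclidean_space set \<Rightarrow> 'a \<Rightarrow> 'a \<Rightarrow> bool" where
  "edge_vec P v w \<longleftrightarrow> w \<noteq> 0 \<and> closed_segment v (v + w) face_of P"

text \<open>Two choices of \<open>U\<close> matter: the line through \<open>u\<close> records
  directions, and \<open>{u}\<close> records lengths as well.\<close>

definition has_edge_in :: "'a::euclidean_space set \<Rightarrow> 'a set \<Rightarrow> bool" where
  "has_edge_in P U \<longleftrightarrow> (\<exists>v. \<exists>w\<in>U. edge_vec P v w)"

lemma edge_vec_ne: "edge_vec P v w \<Longrightarrow> w \<noteq> 0"
  by (simp add: edge_vec_def)

lemma edge_vec_rev: "edge_vec P v w \<Longrightarrow> edge_vec P (v + w) (- w)"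
  by (simp add: edge_vec_def closed_segment_commute)

lemma edge_vec_mem: "edge_vec P v w \<Longrightarrow> v \<in> P \<and> v + w \<in> P"
  unfolding edge_vec_def using face_of_imp_subset by fastforce

lemma edge_vec_extreme:
  assumes "edge_vec P v w"
  shows "v extreme_point_of P \<and> v + w extreme_point_of P"
proof -
  have "closed_segment v (v + w) face_of P"
    using assms by (simp add: edge_vec_def)
  moreover have "v extreme_point_of closed_segment v (v + w)"
      "v + w extreme_point_of closed_segment v (v + w)"
    by (auto simp: extreme_point_of_segment)
  ultimately show ?thesis
    using extreme_point_of_face by blast
qed

lemma edge_vec_face: "F face_of P \<Longrightarrow> edge_vec F v w \<Longrightarrow> edge_vec P v w"
  using face_of_trans by (auto simp: edge_vec_def)

lemma edge_vec_face_iff: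
  assumes "F face_of P"
  shows "edge_vec F v w \<longleftrightarrow> edge_vec P v w \<and> v \<in> F \<and> v + w \<in> F"
proof
  assume r: "edge_vec P v w \<and> v \<in> F \<and> v + w \<in> F"
  then have "closed_segment v (v + w) \<subseteq> F"
    using face_of_imp_convex[OF assms] closed_segment_subset by blast
  then show "edge_vec F v w"
    using r face_of_subset[OF _ _ face_of_imp_subset[OF assms]] by (auto simp: edge_vec_def)
qed (use assms edge_vec_face edge_vec_mem in blast)

lemma has_edge_in_face: "F face_of P \<Longrightarrow> has_edge_in F U \<Longrightarrow> has_edge_in P U"
  unfolding has_edge_in_def using edge_vec_face by blast

lemma edge_of_imp_edge_vec:
  assumes "polytope P" "e edge_of P"
  shows "\<exists>v w. edge_vec P v w \<and> e = closed_segment v (v + w)"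
proof -
  have e: "e face_of P" "aff_dim e = 1"
    using assms by (auto simp: edge_of_def)
  then have "polytope e"
    using assms face_of_polytope_polytope by blast
  moreover have "e \<noteq> {}"
    using e by auto
  moreover have "collinear e"
    using e by (simp add: collinear_aff_dim)
  ultimately obtain a b where ab: "e = closed_segment a b"
    using compact_convex_collinear_segment polytope_imp_compact polytope_imp_convex by metis
  have "a \<noteq> b"
  proof
    assume "a = b"
    then have "aff_dim e = 0"
      by (simp add: ab)
    with e(2) show False
      by simp
  qed
  moreover have "a + (b - a) = b"
    by simp
  ultimately have "edge_vec P a (b - a) \<and> e = closed_segment a (a + (b - a))"
    using e ab unfolding edge_vec_def by simp
  then show ?thesis
    by blast
qed

lemma edge_vec_imp_edge_of:
  assumes "edge_vec P v w"
  shows "closed_segment v (v + w) edge_of P"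
proof -
  have "v \<noteq> v + w"
    using assms by (simp add: edge_vec_def)
  then have "1 simplex closed_segment v (v + w)"
    by (rule one_simplex_segment)
  then have "aff_dim (closed_segment v (v + w)) = 1"
    using aff_dim_simplex by blast
  then show ?thesis
    using assms by (simp add: edge_vec_def edge_of_def)
qed

section \<open>Edges and directions\<close>

lemma max_face_strict:
  assumes "max_face P c = {v}" "y \<in> P" "y \<noteq> v"
  shows "c \<bullet> y < c \<bullet> v"
proof -
  have v: "v \<in> max_face P c" and "y \<notin> max_face P c"
    using assms by auto
  then show ?thesis
    using max_faceD[OF v assms(2)] assms(2) max_face_eq_hyperplane[OF v] by fastforce
qed

lemma max_face_edge_less:
  assumes "max_face P c = {v}" "edge_vec P v w"
  shows "c \<bullet> w < 0"
  using max_face_strict[OF assms(1), of "v + w"] edge_vec_mem[OF assms(2)] edge_vec_ne[OF assms(2)]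
  by (simp add: inner_add_right)

lemma edge_vec_max_face:
  assumes "edge_vec (max_face P c) v w"
  shows "c \<bullet> w = 0"
proof -
  have "c \<bullet> v = c \<bullet> (v + w)"
    using edge_vec_mem[OF assms] max_face_inner_eq by blast
  then show ?thesis
    by (simp add: inner_add_right)
qed

text \<open>Descent through facets: in dimension at least 2 some facet contains \<open>v\<close>,
  and having positive dimension it is not \<open>{v}\<close>. In dimension 1 the polytope is itself
  the edge.\<close>

lemma polytope_edge_at_vertex:
  fixes P :: "'a::euclidean_space set"
  assumes "polytope P" "v extreme_point_of P" "P \<noteq> {v}"
  shows "\<exists>w. edge_vec P v w"
  using assms
proof (induction "nat (aff_dim P)" arbitrary: P rule: less_induct)
  case less
  have vP: "v \<in> P"
    using less.prems by (simp add: extreme_point_of_def)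
  then have "\<not> aff_dim P < 0" "aff_dim P \<noteq> 0"
    using aff_dim_negative_iff[of P] aff_dim_eq_0[of P] less.prems(3) by auto
  then consider "aff_dim P = 1" | "aff_dim P \<ge> 2"
    by linarith
  then show ?case
  proof cases
    case 1
    then have "P edge_of P"
      using less.prems by (simp add: edge_of_def face_of_refl polytope_imp_convex)
    then obtain a w where aw: "edge_vec P a w" "P = closed_segment a (a + w)"
      using edge_of_imp_edge_vec less.prems(1) by blast
    then have "v extreme_point_of closed_segment a (a + w)"
      using less.prems(2) by simp
    then have "v = a \<or> v = a + w"
      by (simp add: extreme_point_of_segment)
    then show ?thesis
      using aw(1) edge_vec_rev by blast
  next
    case 2
    have "{v} face_of P"
      using less.prems(2) by (simp add: face_of_singleton)
    then obtain F where F: "F facet_of P" "{v} \<subseteq> F"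
      using face_of_polyhedron_subset_facet[OF polytope_imp_polyhedron[OF less.prems(1)]] less.prems(3)
      by blast
    then have F': "F face_of P" "aff_dim F = aff_dim P - 1"
      by (auto simp: facet_of_def)
    have "\<exists>w. edge_vec F v w"
    proof (rule less.hyps)
      show "nat (aff_dim F) < nat (aff_dim P)" "F \<noteq> {v}"
        using F' 2 by auto
      show "polytope F"
        using F' less.prems(1) face_of_polytope_polytope by blast
      show "v extreme_point_of F"
        using F F' less.prems(2) extreme_point_of_face by blast
    qed
    then show ?thesis
      using F' edge_vec_face by blast
  qed
qed

lemma polytope_has_edge:
  fixes P :: "'a::euclidean_space set"
  assumes "polytope P" "P \<noteq> {}" "\<And>x. P \<noteq> {x}"
  shows "\<exists>v w. edge_vec P v w"
proof -
  obtain v where "v extreme_point_of P"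
    using polytope_extreme_ne assms(1,2) by blast
  then show ?thesis
    using polytope_edge_at_vertex[OF assms(1)] assms(3) by blast
qed

lemma no_edge_imp_singleton:
  assumes P: "polytope P" "P \<noteq> {}" and "\<And>v w. edge_vec P v w \<Longrightarrow> c \<bullet> w \<noteq> 0"
  shows "\<exists>x. max_face P c = {x}"
proof (rule ccontr)
  assume "\<nexists>x. max_face P c = {x}"
  then obtain v w where "edge_vec (max_face P c) v w"
    using polytope_has_edge[OF max_face_polytope max_face_ne] P by metis
  then show False
    using edge_vec_max_face edge_vec_face[OF max_face_face] assms(3) polytope_imp_convex P(1) by blast
qed

text \<open>The simplex method: pushing \<open>c\<close>, which exposes \<open>v\<close>, in direction \<open>h\<close> as far as \<open>v\<close>
  stays optimal, one reaches a face with an edge at \<open>v\<close> along which \<open>h\<close> increases.\<close>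

lemma local_max_imp_max:
  assumes P: "polytope P" and v: "v extreme_point_of P"
    and h: "\<And>w. edge_vec P v w \<Longrightarrow> h \<bullet> w \<le> 0"
    and x: "x \<in> P"
  shows "h \<bullet> x \<le> h \<bullet> v"
proof (rule ccontr)
  assume "\<not> h \<bullet> x \<le> h \<bullet> v"
  then have hx: "h \<bullet> x - h \<bullet> v > 0"
    by simp
  have P': "P \<noteq> {}" and vP: "v \<in> P"
    using x v by (auto simp: extreme_point_of_def)
  obtain c where c: "max_face P c = {v}"
    using extreme_max_face[OF P v] by blast
  define A where "A = {t. 0 \<le> t \<and> v \<in> max_face P (c + t *\<^sub>R h)}"
  have A: "A = {0..} \<inter> (\<Inter>y\<in>P. {t. (c + t *\<^sub>R h) \<bullet> y \<le> (c + t *\<^sub>R h) \<bullet> v})"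
    using vP by (auto simp: A_def max_face_def)
  have "closed A"
    unfolding A by (intro closed_Int closed_INT ballI closed_Collect_le continuous_intros closed_atLeast)
  moreover have "A \<subseteq> {0 .. (c \<bullet> v - c \<bullet> x) / (h \<bullet> x - h \<bullet> v)}"
  proof
    fix t assume t: "t \<in> A"
    then have "(c + t *\<^sub>R h) \<bullet> x \<le> (c + t *\<^sub>R h) \<bullet> v"
      using x by (auto simp: A)
    then have "t * (h \<bullet> x - h \<bullet> v) \<le> c \<bullet> v - c \<bullet> x"
      by (simp add: inner_add_left algebra_simps)
    then show "t \<in> {0 .. (c \<bullet> v - c \<bullet> x) / (h \<bullet> x - h \<bullet> v)}"
      using t hx by (simp add: A_def pos_le_divide_eq)
  qed
  ultimately have "compact A"
    by (metis bounded_closed_interval bounded_subset compact_eq_bounded_closed)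
  moreover have "A \<noteq> {}"
    using c by (auto simp: A_def intro!: exI[of _ 0])
  ultimately obtain t where t: "t \<in> A" "\<And>s. s \<in> A \<Longrightarrow> s \<le> t"
    using compact_attains_sup[of A] by auto
  define G where "G = max_face P (c + t *\<^sub>R h)"
  have G: "G face_of P" "v \<in> G"
    using t P by (auto simp: G_def A_def max_face_face polytope_imp_convex)
  \<comment> \<open>Otherwise, by semicontinuity, \<open>v\<close> would stay optimal a little
    beyond \<open>t\<close>, the maximum of \<open>A\<close>.\<close>
  have "G \<noteq> {v}"
  proof
    assume "G = {v}"
    then obtain e where e: "e > 0" "\<And>d. dist d (c + t *\<^sub>R h) < e \<Longrightarrow> max_face P d \<subseteq> {v}"
      using max_face_usc[OF P, of "c + t *\<^sub>R h"] unfolding G_def by auto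
    have hne: "h \<noteq> 0"
      using hx by auto
    define s where "s = e / (2 * norm h)"
    have s: "s > 0"
      using e hne by (simp add: s_def)
    have "dist (c + (t + s) *\<^sub>R h) (c + t *\<^sub>R h) = s * norm h"
      using s by (simp add: dist_norm algebra_simps)
    also have "\<dots> < e"
      using e hne by (simp add: s_def)
    finally have "max_face P (c + (t + s) *\<^sub>R h) \<subseteq> {v}"
      by (rule e)
    then have "v \<in> max_face P (c + (t + s) *\<^sub>R h)"
      using max_face_ne[OF P P'] by blast
    then have "t + s \<in> A"
      using t s by (simp add: A_def)
    then show False
      using t(2) s by fastforce
  qed
  moreover have "polytope G" "v extreme_point_of G"
    using G P v face_of_polytope_polytope extreme_point_of_face by blast+
  ultimately obtain w where w: "edge_vec G v w"
    using polytope_edge_at_vertex by blast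
  have wP: "edge_vec P v w"
    using G w edge_vec_face by blast
  \<comment> \<open>Along \<open>w\<close> the functional \<open>c\<close> strictly decreases while
    the combination is constant, so \<open>h\<close> would have to increase.\<close>
  have "(c + t *\<^sub>R h) \<bullet> w = 0"
    using w unfolding G_def by (rule edge_vec_max_face)
  moreover have "c \<bullet> w < 0"
    using c wP by (rule max_face_edge_less)
  moreover have "t * (h \<bullet> w) \<le> 0"
    using h[OF wP] t(1) by (simp add: A_def mult_nonneg_nonpos)
  ultimately show False
    by (simp add: inner_add_left)
qed

text \<open>Connectedness of the edge graph. Let \<open>c\<close> expose \<open>v1\<close>. Among
  the vertices satisfying \<open>Q\<close>, one with maximal \<open>c\<close> must be
  \<open>v1\<close>: otherwise an edge leads to a better vertex, which satisfies \<open>Q\<close> as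
  well.\<close>

lemma vertex_induct:
  assumes P: "polytope P" and "v0 extreme_point_of P" "Q v0"
    and step: "\<And>v w. v extreme_point_of P \<Longrightarrow> Q v \<Longrightarrow> edge_vec P v w \<Longrightarrow> Q (v + w)"
    and v1: "v1 extreme_point_of P"
  shows "Q v1"
proof -
  obtain c where c: "max_face P c = {v1}"
    using extreme_max_face[OF P v1] by blast
  define S where "S = {v. v extreme_point_of P \<and> Q v}"
  have "finite ((\<lambda>v. c \<bullet> v) ` S)" "S \<noteq> {}"
    using polytope_finite_extreme[OF P] assms(2,3) by (auto simp: S_def)
  then have "Max ((\<lambda>v. c \<bullet> v) ` S) \<in> (\<lambda>v. c \<bullet> v) ` S"
    by (intro Max_in) auto
  then obtain v where "v \<in> S" and veq: "Max ((\<lambda>v. c \<bullet> v) ` S) = c \<bullet> v"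
    by blast
  moreover have "c \<bullet> y \<le> c \<bullet> v" if "y \<in> S" for y
    using Max_ge[OF \<open>finite _\<close>, of "c \<bullet> y"] that veq by simp
  ultimately have v: "v \<in> S" "\<And>y. y \<in> S \<Longrightarrow> c \<bullet> y \<le> c \<bullet> v"
    by blast+
  show ?thesis
  proof (cases "v = v1")
    case False
    have "v1 \<in> P" "v \<in> P"
      using v1 v(1) by (auto simp: S_def extreme_point_of_def)
    then have "c \<bullet> v < c \<bullet> v1"
      using max_face_strict[OF c] False by blast
    then obtain w where w: "edge_vec P v w" "c \<bullet> w > 0"
      using local_max_imp_max[OF P, of v c v1] v(1) \<open>v1 \<in> P\<close> unfolding S_def
      by (metis linorder_not_less mem_Collect_eq)
    then have "v + w \<in> S"
      using step v(1) edge_vec_extreme[OF w(1)] by (auto simp: S_def)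
    then have "c \<bullet> (v + w) \<le> c \<bullet> v"
      by (rule v(2))
    then show ?thesis
      using w by (simp add: inner_add_right)
  qed (use v in \<open>auto simp: S_def\<close>)
qed

text \<open>The linear space parallel to the affine hull of a nonempty \<open>P\<close>. A
  functional taken from it is nonzero exactly if it is not constant on \<open>P\<close>.\<close>

definition dirs :: "'a::euclidean_space set \<Rightarrow> 'a set" where
  "dirs P = span {x - y | x y. x \<in> P \<and> y \<in> P}"

lemma subspace_dirs: "subspace (dirs P)"
  by (simp add: dirs_def)

lemma diff_in_dirs: "x \<in> P \<Longrightarrow> y \<in> P \<Longrightarrow> x - y \<in> dirs P"
  unfolding dirs_def by (rule span_base) auto

lemma edge_vec_dirs: "edge_vec P v w \<Longrightarrow> w \<in> dirs P"
  using diff_in_dirs[of "v + w" P v] edge_vec_mem[of P v w] by simp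

lemma dirs_orthogonal:
  assumes "\<And>x y. x \<in> P \<Longrightarrow> y \<in> P \<Longrightarrow> c \<bullet> (x - y) = 0" "w \<in> dirs P"
  shows "c \<bullet> w = 0"
  using assms(2) unfolding dirs_def
  by (rule span_induct) (use assms(1) in \<open>auto simp: subspace_def inner_add_right\<close>)

lemma const_on_dirs_zero:
  assumes "c \<in> dirs P" "\<And>x y. x \<in> P \<Longrightarrow> y \<in> P \<Longrightarrow> c \<bullet> (x - y) = 0"
  shows "c = 0"
  using dirs_orthogonal[OF assms(2) assms(1)] by simp

lemma dirs_eq_span:
  assumes "p \<in> P"
  shows "dirs P = span ((\<lambda>x. x - p) ` P)"
proof
  show "dirs P \<subseteq> span ((\<lambda>x. x - p) ` P)"
    unfolding dirs_def
  proof (rule span_minimal)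
    show "{x - y |x y. x \<in> P \<and> y \<in> P} \<subseteq> span ((\<lambda>x. x - p) ` P)"
    proof clarify
      fix x y assume "x \<in> P" "y \<in> P"
      then have "(x - p) - (y - p) \<in> span ((\<lambda>x. x - p) ` P)"
        by (intro span_diff span_base) auto
      then show "x - y \<in> span ((\<lambda>x. x - p) ` P)"
        by simp
    qed
  qed simp
  show "span ((\<lambda>x. x - p) ` P) \<subseteq> dirs P"
    by (rule span_minimal) (use assms diff_in_dirs subspace_dirs in auto)
qed

lemma aff_dim_dirs:
  assumes "P \<noteq> {}"
  shows "aff_dim P = int (dim (dirs P))"
proof -
  obtain p where p: "p \<in> P"
    using assms by blast
  then show ?thesis
    unfolding dirs_eq_span[OF p] by (simp add: aff_dim_eq_dim_subtract hull_inc)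
qed

text \<open>The orthogonal projection onto \<open>dirs P\<close> agrees with \<open>c\<close> on all
  differences of points of \<open>P\<close>, and these determine \<open>max_face\<close>.\<close>

lemma max_face_project:
  obtains c' where "c' \<in> dirs P" "\<And>w. w \<in> dirs P \<Longrightarrow> c \<bullet> w = c' \<bullet> w" "max_face P c = max_face P c'"
proof -
  obtain y z where yz: "y \<in> span (dirs P)" "\<And>w. w \<in> span (dirs P) \<Longrightarrow> orthogonal z w" "c = y + z"
    using orthogonal_subspace_decomp_exists by blast
  have sp: "span (dirs P) = dirs P"
    by (simp add: dirs_def)
  have 1: "c \<bullet> w = y \<bullet> w" if "w \<in> dirs P" for w
    using yz that by (simp add: sp orthogonal_def inner_add_left)
  moreover have "max_face P c = max_face P y"
    by (rule max_face_cong) (use 1 diff_in_dirs in blast)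
  ultimately show ?thesis
    using that yz(1) sp by metis
qed

lemma max_face_aff_dim_less:
  assumes P: "polytope P" and c: "c \<in> dirs P" "c \<noteq> 0"
  shows "aff_dim (max_face P c) < aff_dim P"
proof (rule face_of_aff_dim_lt)
  show "convex P" "max_face P c face_of P"
    using P by (auto intro: polytope_imp_convex max_face_face)
  show "max_face P c \<noteq> P"
  proof
    assume "max_face P c = P"
    then have "c \<bullet> (x - y) = 0" if "x \<in> P" "y \<in> P" for x y
      using max_face_inner_eq[of x P c y] that by (simp add: inner_diff_right)
    then show False
      using const_on_dirs_zero c by blast
  qed
qed

text \<open>The set of functionals \<open>c \<noteq> 0\<close> in the direction space of \<open>P\<close> and orthogonal to \<open>u\<close> is
  connected when \<open>P\<close> has dimension at least 3. By semicontinuity and induction on the dimension,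
  those whose face has an edge in \<open>U\<close> form a clopen subset.\<close>

lemma has_edge_in_max_face:
  fixes P :: "'a::euclidean_space set"
  assumes "polytope P"
    and U: "U \<subseteq> range (\<lambda>s. s *\<^sub>R u)"
    and two: "\<And>F c. F face_of P \<Longrightarrow> aff_dim F = 2 \<Longrightarrow> c \<bullet> u = 0 \<Longrightarrow> has_edge_in F U \<Longrightarrow>
      has_edge_in (max_face F c) U"
    and "c \<bullet> u = 0" "has_edge_in P U"
  shows "has_edge_in (max_face P c) U"
  using assms(1,3,4,5)
proof (induction "nat (aff_dim P)" arbitrary: P c rule: less_induct)
  case less
  note P = \<open>polytope P\<close>
  have cP: "convex P"
    using P polytope_imp_convex by blast
  obtain v w where vw: "edge_vec P v w" "w \<in> U"
    using less.prems(4) by (auto simp: has_edge_in_def)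
  then obtain s where ws: "w = s *\<^sub>R u"
    using U by blast
  then have s: "w = s *\<^sub>R u" "s \<noteq> 0"
    using edge_vec_ne[OF vw(1)] by auto
  have P': "P \<noteq> {}"
    using vw edge_vec_mem by blast
  have wd: "w \<in> dirs P"
    using vw edge_vec_dirs by blast
  then have ud: "u \<in> dirs P"
    using s subspace_scale[OF subspace_dirs wd, of "1/s"] by simp
  have une: "u \<noteq> 0"
    using s edge_vec_ne[OF vw(1)] by auto
  have IH: "has_edge_in (max_face G d) U"
    if "G face_of P" "G \<noteq> P" "d \<bullet> u = 0" "has_edge_in G U" for G d
  proof (rule less.hyps)
    show "polytope G"
      using that P face_of_polytope_polytope by blast
    have "aff_dim G < aff_dim P"
      using that cP face_of_aff_dim_lt by blast
    moreover have "G \<noteq> {}"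
      using that(4) edge_vec_mem unfolding has_edge_in_def by blast
    then have "aff_dim G \<ge> 0"
      using aff_dim_negative_iff[of G] by linarith
    ultimately show "nat (aff_dim G) < nat (aff_dim P)"
      by simp
    show "d \<bullet> u = 0" "has_edge_in G U"
      using that by auto
    show "has_edge_in (max_face F c) U"
      if "F face_of G" "aff_dim F = 2" "c \<bullet> u = 0" "has_edge_in F U" for F c
      using less.prems(2) face_of_trans[OF that(1) \<open>G face_of P\<close>] that by blast
  qed
  obtain c' where c': "c' \<in> dirs P" "\<And>w. w \<in> dirs P \<Longrightarrow> c \<bullet> w = c' \<bullet> w"
      "max_face P c = max_face P c'"
    using max_face_project[of P c] by metis
  consider "c' = 0" | "aff_dim P = 2" | "c' \<noteq> 0" "aff_dim P \<le> 1" | "c' \<noteq> 0" "aff_dim P \<ge> 3"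
    by linarith
  then show ?case
  proof cases
    case 1
    then have "max_face P c = P"
      using c' by (auto simp: max_face_def)
    then show ?thesis
      using less.prems by simp
  next
    case 2
    then show ?thesis
      using less.prems face_of_refl[OF cP] by blast
  next
    case 3
    have "c' \<bullet> u = 0"
      using c'(2)[OF ud] less.prems(3) by simp
    then have "{c', u} \<subseteq> dirs P \<and> c' \<noteq> u \<and> independent {c', u}"
      using c'(1) ud 3 une pairwise_orthogonal_independent[of "{c', u}"]
      by (auto simp: pairwise_def orthogonal_def inner_commute)
    then have "2 \<le> dim (dirs P)"
      using independent_card_le_dim[of "{c', u}" "dirs P"] by simp
    then show ?thesis
      using 3 aff_dim_dirs[OF P'] by simp
  next
    case 4
    \<comment> \<open>This space has dimension one less than \<open>P\<close>, hence at least 2, so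
      it stays connected without the origin.\<close>
    define S0 where "S0 = {x \<in> dirs P. \<forall>y\<in>span {u}. orthogonal y x}"
    have S0: "S0 = {x \<in> dirs P. x \<bullet> u = 0}"
      by (auto simp: S0_def span_singleton orthogonal_def inner_commute)
    have "dim S0 + dim (span {u}) = dim (dirs P)"
      unfolding S0_def
      by (rule dim_subspace_orthogonal_to_vectors)
        (use span_minimal[of "{u}" "dirs P"] subspace_dirs ud in auto)
    moreover have "dim (span {u}) = 1"
      using une dim_singleton[of u] by simp
    ultimately have "dim S0 \<ge> 2"
      using 4 aff_dim_dirs[OF P'] by simp
    moreover have sub: "subspace S0"
      unfolding S0 using subspace_dirs[of P] by (simp add: subspace_def inner_add_left)
    ultimately have "aff_dim S0 \<noteq> 1"
      by (simp add: aff_dim_subspace)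
    then have conn: "connected (S0 - {0})"
      using connected_punctured_convex[OF subspace_imp_convex[OF sub]] by blast
    define T where "T = {d \<in> S0 - {0}. has_edge_in (max_face P d) U}"
    \<comment> \<open>Membership in \<open>T\<close> is locally constant: near \<open>b\<close> only
      faces of \<open>max_face P b\<close> are exposed. If that proper face has an edge in
      \<open>U\<close>, the induction hypothesis hands one on to the face exposed by
      \<open>d\<close>; conversely, edges of a face of \<open>max_face P b\<close> are edges of
      it.\<close>
    have usc: "\<exists>e>0. \<forall>d\<in>S0 - {0}. dist d b < e \<longrightarrow> (d \<in> T \<longleftrightarrow> b \<in> T)" if b: "b \<in> S0 - {0}" for b
    proof -
      obtain e where "e > 0" and e: "\<And>d. dist d b < e \<Longrightarrow> max_face P d \<subseteq> max_face P b"
        using max_face_usc[OF P] by blast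
      have "d \<in> T \<longleftrightarrow> b \<in> T" if d: "d \<in> S0 - {0}" "dist d b < e" for d
      proof -
        let ?G = "max_face P b"
        have G: "?G face_of P"
          using cP max_face_face by blast
        have eq: "max_face P d = max_face ?G d"
          using max_face_sub[OF P P' e[OF d(2)] max_face_subset] by simp
        have "has_edge_in (max_face ?G d) U" if "has_edge_in ?G U"
        proof (rule IH[OF G _ _ that])
          show "?G \<noteq> P"
            using max_face_aff_dim_less[OF P, of b] b by (auto simp: S0)
          show "d \<bullet> u = 0"
            using d by (auto simp: S0)
        qed
        moreover have "has_edge_in ?G U" if "has_edge_in (max_face ?G d) U"
          using has_edge_in_face[OF max_face_face that] G face_of_imp_convex by blast
        ultimately show ?thesis
          using d b eq by (auto simp: T_def)
      qed
      then show ?thesis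
        using \<open>e > 0\<close> by blast
    qed
    have TS: "T \<subseteq> S0 - {0}"
      unfolding T_def by blast
    have "openin (top_of_set (S0 - {0})) T"
      unfolding openin_euclidean_subtopology_iff
    proof (intro conjI ballI)
      show "T \<subseteq> S0 - {0}"
        by (rule TS)
      show "\<exists>e>0. \<forall>x'\<in>S0 - {0}. dist x' x < e \<longrightarrow> x' \<in> T" if "x \<in> T" for x
        using usc[of x] that TS by blast
    qed
    moreover have "openin (top_of_set (S0 - {0})) (S0 - {0} - T)"
      unfolding openin_euclidean_subtopology_iff
    proof (intro conjI ballI)
      show "\<exists>e>0. \<forall>x'\<in>S0 - {0}. dist x' x < e \<longrightarrow> x' \<in> S0 - {0} - T" if "x \<in> S0 - {0} - T" for x
        using usc[of x] that by blast
    qed auto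
    then have "closedin (top_of_set (S0 - {0})) T"
      using TS by (simp add: closedin_def)
    ultimately have "T = {} \<or> T = S0 - {0}"
      using conn connected_clopen by blast
    \<comment> \<open>A functional exposing the given edge belongs to \<open>T\<close>; it is
      nonzero because \<open>P\<close> is not a segment.\<close>
    moreover have "T \<noteq> {}"
    proof -
      define E where "E = closed_segment v (v + w)"
      have E: "E face_of P" "E \<noteq> {}"
        using vw by (auto simp: edge_vec_def E_def)
      obtain b0 where b0: "E = max_face P b0"
        using face_eq_max_face[OF P E] by blast
      obtain b where b: "b \<in> dirs P" "max_face P b0 = max_face P b"
        using max_face_project by metis
      have edge_E: "edge_vec E v w"
        using edge_vec_face_iff[OF E(1)] vw by (simp add: E_def)
      then have "has_edge_in E U"
        using vw(2) by (auto simp: has_edge_in_def)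
      moreover have "b \<bullet> w = 0"
        using edge_vec_max_face[of P b v w] edge_E b0 b(2) by simp
      then have "b \<bullet> u = 0"
        using s by simp
      moreover have "b \<noteq> 0"
      proof
        assume "b = 0"
        then have "E = P"
          using b b0 by (simp add: max_face_def)
        then have "aff_dim P \<le> 1"
          unfolding E_def by (metis collinear_aff_dim collinear_closed_segment)
        then show False
          using 4 by simp
      qed
      ultimately show ?thesis
        using b b0 by (auto simp: T_def S0)
    qed
    moreover have "c' \<in> S0 - {0}"
      using 4 c'(1) c'(2)[OF ud] less.prems(3) by (simp add: S0)
    ultimately show ?thesis
      using c'(3) by (auto simp: T_def)
  qed
qed

section \<open>Belt polytopes with inscribed 2-faces\<close>

definition edge_dir :: "'a::euclidean_space set \<Rightarrow> 'a \<Rightarrow> bool" where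
  "edge_dir P u \<longleftrightarrow> has_edge_in P (range (\<lambda>s. s *\<^sub>R u))"

definition beltlike :: "'a::euclidean_space set \<Rightarrow> bool" where
  "beltlike P \<longleftrightarrow> (\<forall>u c. c \<bullet> u = 0 \<and> edge_dir P u \<longrightarrow> edge_dir (max_face P c) u)"

definition belt_faces :: "'a::euclidean_space set \<Rightarrow> bool" where
  "belt_faces P \<longleftrightarrow> polytope P \<and> (\<forall>F. F face_of P \<and> aff_dim F = 2 \<longrightarrow> beltlike F)"

lemma edge_dirI:
  assumes "edge_vec P v w"
  shows "edge_dir P w"
proof -
  have "w \<in> range (\<lambda>s. s *\<^sub>R w)"
    by (rule range_eqI[of _ _ 1]) simp
  then show ?thesis
    unfolding edge_dir_def has_edge_in_def using assms by blast
qed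

lemma edge_dirE:
  assumes "edge_dir P u"
  obtains v s where "edge_vec P v (s *\<^sub>R u)" "s \<noteq> 0" "u \<noteq> 0"
proof -
  obtain v s where "edge_vec P v (s *\<^sub>R u)"
    using assms by (auto simp: edge_dir_def has_edge_in_def)
  then show ?thesis
    using that[of v s] edge_vec_ne[of P v "s *\<^sub>R u"] by simp
qed

lemma edge_dir_dirs:
  assumes "edge_dir P u"
  shows "u \<in> dirs P"
proof -
  obtain v s where vs: "edge_vec P v (s *\<^sub>R u)" "s \<noteq> 0"
    using assms by (rule edge_dirE)
  then have "(1/s) *\<^sub>R (s *\<^sub>R u) \<in> dirs P"
    using edge_vec_dirs subspace_dirs subspace_scale by blast
  then show ?thesis
    using vs by simp
qed

lemma belt_faces_polytope: "belt_faces P \<Longrightarrow> polytope P"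
  by (simp add: belt_faces_def)

lemma belt_faces_face: "belt_faces P \<Longrightarrow> F face_of P \<Longrightarrow> belt_faces F"
  unfolding belt_faces_def using face_of_polytope_polytope face_of_trans by blast

lemma belt_faces_beltlike:
  assumes "belt_faces P"
  shows "beltlike P"
  unfolding beltlike_def edge_dir_def
proof (intro allI impI, elim conjE)
  fix u c assume "c \<bullet> u = 0" "has_edge_in P (range (\<lambda>s. s *\<^sub>R u))"
  then show "has_edge_in (max_face P c) (range (\<lambda>s. s *\<^sub>R u))"
    using has_edge_in_max_face[OF belt_faces_polytope[OF assms] order_refl] assms
    unfolding belt_faces_def beltlike_def edge_dir_def by blast
qed

lemma beltlikeD: "beltlike P \<Longrightarrow> c \<bullet> u = 0 \<Longrightarrow> edge_dir P u \<Longrightarrow> edge_dir (max_face P c) u"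
  by (simp add: beltlike_def)

text \<open>A point has no edge parallel to \<open>w\<close>. With
  \<open>no_edge_imp_singleton\<close> this identifies the functionals exposing a vertex of a
  nonempty polytope: those off all hyperplanes orthogonal to edges.\<close>

lemma beltlike_generic:
  assumes "beltlike P" "edge_vec P v w" "max_face P c = {x}"
  shows "c \<bullet> w \<noteq> 0"
proof
  assume "c \<bullet> w = 0"
  then have "edge_dir {x} w"
    using beltlikeD[OF assms(1)] edge_dirI[OF assms(2)] assms(3) by metis
  then obtain y s where y: "edge_vec {x} y (s *\<^sub>R w)" "s \<noteq> 0" "w \<noteq> 0"
    by (rule edge_dirE)
  then show False
    using edge_vec_mem[OF y(1)] by auto
qed

section \<open>Two edge directions and a 2-face containing both\<close>

lemma not_parallel_independent:
  fixes a :: "'a::euclidean_space"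
  assumes "a \<noteq> 0" "b \<notin> span {a}"
  shows "independent {a, b}" "dim (span {a, b}) = 2"
proof -
  have "independent {b, a}"
    using assms by (simp add: independent_insert)
  then show ind: "independent {a, b}"
    by (simp add: insert_commute)
  have "a \<noteq> b"
    using assms(2) span_base[of b "{b}"] by auto
  then show "dim (span {a, b}) = 2"
    using ind by (simp add: dim_eq_card_independent)
qed

lemma dirs_plane:
  assumes "aff_dim F = 2" "a \<in> dirs F" "b \<in> dirs F" "a \<noteq> 0" "b \<notin> span {a}"
  shows "dirs F = span {a, b}"
proof -
  have "F \<noteq> {}"
    using assms(1) by auto
  then have "dim (dirs F) = 2"
    using aff_dim_dirs[of F] assms(1) by simp
  moreover have "span {a, b} \<subseteq> dirs F"
    using assms subspace_dirs by (intro span_minimal) auto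
  ultimately show ?thesis
    using subspace_dim_equal[OF subspace_span subspace_dirs, of "{a, b}" F]
      not_parallel_independent(2)[OF assms(4,5)] by simp
qed

lemma span_pairE:
  fixes x :: "'a::euclidean_space"
  assumes "x \<in> span {a, b}"
  obtains X Y where "x = X *\<^sub>R a + Y *\<^sub>R b"
proof -
  obtain X where "x - X *\<^sub>R a \<in> span {b}"
    using assms span_breakdown_eq by blast
  then obtain Y where "x - X *\<^sub>R a = Y *\<^sub>R b"
    by (auto simp: span_singleton)
  then show ?thesis
    using that[of X Y] by (simp add: algebra_simps)
qed

text \<open>Any two edge directions meet in a 2-face: as long as the dimension exceeds 2, there is a
  functional orthogonal to both that cuts out a proper face.\<close>

lemma belt_faces_two_face:
  assumes "belt_faces P" "edge_dir P a" "edge_dir P b" "b \<notin> span {a}"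
  shows "\<exists>F. F face_of P \<and> aff_dim F = 2 \<and> edge_dir F a \<and> edge_dir F b"
  using assms
proof (induction "nat (aff_dim P)" arbitrary: P rule: less_induct)
  case less
  have poly: "polytope P"
    using less.prems(1) by (rule belt_faces_polytope)
  have a: "a \<noteq> 0"
    using less.prems(2) edge_dirE by metis
  have ab: "a \<in> dirs P" "b \<in> dirs P"
    using less.prems edge_dir_dirs by auto
  have ne: "P \<noteq> {}"
    using less.prems(2) edge_vec_mem unfolding edge_dir_def has_edge_in_def by blast
  define S0 where "S0 = {x \<in> dirs P. \<forall>y\<in>span {a, b}. orthogonal y x}"
  have "dim S0 + dim (span {a, b}) = dim (dirs P)"
    unfolding S0_def by (rule dim_subspace_orthogonal_to_vectors)
      (use span_minimal[of "{a, b}" "dirs P"] ab subspace_dirs in auto)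
  then have dims: "int (dim S0) + 2 = aff_dim P"
    using not_parallel_independent(2)[OF a less.prems(4)] aff_dim_dirs[OF ne] by simp
  show ?case
  proof (cases "dim S0 = 0")
    case True
    then have "aff_dim P = 2"
      using dims by linarith
    then show ?thesis
      using less.prems face_of_refl[OF polytope_imp_convex[OF poly]] by blast
  next
    case False
    then obtain c where c: "c \<in> S0" "c \<noteq> 0"
      by (metis dim_eq_0 singletonI subset_iff)
    then have c': "c \<in> dirs P" "c \<bullet> a = 0" "c \<bullet> b = 0"
      using span_base[of a "{a, b}"] span_base[of b "{a, b}"]
      by (auto simp: S0_def orthogonal_def inner_commute)
    let ?G = "max_face P c"
    have G: "?G face_of P"
      using poly max_face_face polytope_imp_convex by blast
    have belt: "beltlike P"
      using less.prems(1) by (rule belt_faces_beltlike)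
    have "aff_dim ?G < aff_dim P"
      using poly c' c(2) by (intro max_face_aff_dim_less)
    \<comment> \<open>As \<open>c\<close> is orthogonal to \<open>a\<close> and \<open>b\<close>,
      both directions persist in the smaller face.\<close>
    then have "\<exists>F. F face_of ?G \<and> aff_dim F = 2 \<and> edge_dir F a \<and> edge_dir F b"
      using dims less.prems c' by (intro less.hyps belt_faces_face[OF _ G] beltlikeD[OF belt]) auto
    then show ?thesis
      using G face_of_trans by blast
  qed
qed

lemma edge_as_max_face:
  assumes "polytope P" "edge_vec P v a"
  obtains d where "max_face P d = closed_segment v (v + a)" "d \<bullet> a = 0"
proof -
  have "closed_segment v (v + a) face_of P"
    using assms by (simp add: edge_vec_def)
  then obtain d where d: "closed_segment v (v + a) = max_face P d"
    using face_eq_max_face[OF assms(1)] by (metis ends_in_segment(1) empty_iff)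
  have "v \<in> max_face P d" "v + a \<in> max_face P d"
    by (simp_all flip: d)
  then have "d \<bullet> v = d \<bullet> (v + a)"
    by (rule max_face_inner_eq)
  then show ?thesis
    using that[of d] d by (simp add: inner_add_right)
qed

lemma segment_diff_span:
  assumes "x \<in> closed_segment v (v + a)" "y \<in> closed_segment v (v + a)"
  shows "y - x \<in> span {a}"
proof -
  obtain s t where "x = v + s *\<^sub>R a" "y = v + t *\<^sub>R a"
    using assms unfolding closed_segment_def by (auto simp: algebra_simps)
  then have "y - x = (t - s) *\<^sub>R a"
    by (simp add: algebra_simps)
  then show ?thesis
    by (simp add: span_base span_scale)
qed

text \<open>The segment exposed by \<open>d\<close> must contain an edge parallel to
  \<open>w\<close>, and a segment has only one direction. So a functional exposing an edge lies on
  no hyperplane belonging to another direction.\<close>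

lemma beltlike_edge_normal:
  assumes "beltlike P" "max_face P d = closed_segment v (v + a)" "edge_vec P x w" "d \<bullet> w = 0"
  shows "w \<in> span {a}"
proof -
  have "edge_dir (closed_segment v (v + a)) w"
    using beltlikeD[OF assms(1,4)] edge_dirI[OF assms(3)] assms(2) by metis
  then obtain y s where y: "edge_vec (closed_segment v (v + a)) y (s *\<^sub>R w)" "s \<noteq> 0"
    by (rule edge_dirE)
  have "y + s *\<^sub>R w - y \<in> span {a}"
    by (rule segment_diff_span) (use edge_vec_mem[OF y(1)] in auto)
  then have "(1/s) *\<^sub>R (s *\<^sub>R w) \<in> span {a}"
    unfolding add_diff_cancel_left' by (rule span_scale)
  then show ?thesis
    unfolding scaleR_scaleR using y(2) by simp
qed

text \<open>A functional exposing \<open>v\<close> decreases along both vectors, so they point the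
  same way. An edge is all of \<open>P\<close> on its supporting hyperplane, so neither vector
  exceeds the other.\<close>

lemma edge_vec_parallel_eq:
  assumes P: "polytope P" and a: "edge_vec P v a" and b: "edge_vec P v b" and "b \<in> span {a}"
  shows "b = a"
proof -
  obtain s where s: "b = s *\<^sub>R a"
    using assms(4) by (auto simp: span_singleton)
  obtain c where c: "max_face P c = {v}"
    using extreme_max_face P a edge_vec_extreme by blast
  have "c \<bullet> a < 0" "c \<bullet> b < 0"
    using max_face_edge_less[OF c] a b by auto
  then have "s > 0"
    by (simp add: s mult_less_0_iff)
  have le: "t \<le> 1" if a': "edge_vec P v a'" and ta': "edge_vec P v (t *\<^sub>R a')" for a' t
  proof -
    obtain d where d: "max_face P d = closed_segment v (v + a')" "d \<bullet> a' = 0"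
      using edge_as_max_face[OF P a'] .
    have "v \<in> max_face P d"
      by (simp add: d)
    then have "v + t *\<^sub>R a' \<in> closed_segment v (v + a')"
      using max_face_eq_hyperplane[of v P d] edge_vec_mem[OF ta'] d by (simp add: inner_add_right)
    then obtain r where "t *\<^sub>R a' = r *\<^sub>R a'" "0 \<le> r" "r \<le> 1"
      unfolding closed_segment_def by (auto simp: algebra_simps)
    then show ?thesis
      using edge_vec_ne[OF a'] by simp
  qed
  have "s \<le> 1"
    using le[OF a] b s by simp
  moreover have "a = (1/s) *\<^sub>R b"
    using s \<open>s > 0\<close> by simp
  then have "1/s \<le> 1"
    using le[OF b] a by metis
  ultimately have "s = 1"
    using \<open>s > 0\<close> by (simp add: field_simps)
  then show ?thesis
    by (simp add: s)
qed

text \<open>From \<open>c\<close> to \<open>d\<close> the functionals are orthogonal to no edge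
  until \<open>d\<close> is reached, so the optimal vertex remains \<open>f\<close>, and
  \<open>f\<close> is optimal for \<open>d\<close>. The face exposed by \<open>d\<close> is more
  than \<open>f\<close>, and all its edges are parallel to \<open>a\<close>.\<close>

lemma edge_at_limit_vertex:
  assumes F: "polytope F" "beltlike F" and f: "max_face F c = {f}"
    and gen: "\<And>t x w. 0 < t \<Longrightarrow> t < 1 \<Longrightarrow> edge_vec F x w \<Longrightarrow> ((1 - t) *\<^sub>R c + t *\<^sub>R d) \<bullet> w \<noteq> 0"
    and a: "edge_dir F a" "d \<bullet> a = 0"
    and d: "\<And>x w. edge_vec F x w \<Longrightarrow> d \<bullet> w = 0 \<Longrightarrow> w \<in> span {a}"
  shows "f \<in> max_face F d \<and> (\<exists>s. edge_vec F f (s *\<^sub>R a))"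
proof -
  have ne: "F \<noteq> {}"
    using f max_face_subset by blast
  have "\<exists>x. max_face F ((1 - t) *\<^sub>R c + t *\<^sub>R d) = {x}" if "0 < t" "t < 1" for t
    using no_edge_imp_singleton[OF F(1) ne] gen[OF that] by blast
  then have "\<exists>x. x \<in> max_face F c \<and> x \<in> max_face F d"
    by (rule max_face_segment_const[OF F(1) ne])
  then have fd: "f \<in> max_face F d"
    unfolding f by blast
  let ?E = "max_face F d"
  have E: "?E face_of F"
    using F(1) max_face_face polytope_imp_convex by blast
  have "edge_dir ?E a"
    using beltlikeD[OF F(2) a(2,1)] .
  then obtain y s where y: "edge_vec ?E y (s *\<^sub>R a)" "s \<noteq> 0" "a \<noteq> 0"
    by (rule edge_dirE)
  then have "?E \<noteq> {f}"
    using edge_vec_mem[OF y(1)] by auto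
  moreover have "f extreme_point_of ?E"
    using max_face_singleton_extreme[OF F(1) f] fd extreme_point_of_face[OF E] by blast
  ultimately obtain w where w: "edge_vec ?E f w"
    using polytope_edge_at_vertex[OF max_face_polytope[OF F(1)]] by blast
  then have wF: "edge_vec F f w"
    using E edge_vec_face by blast
  have "w \<in> span {a}"
    using d[OF wF] edge_vec_max_face[OF w] by blast
  then show ?thesis
    using wF fd by (auto simp: span_singleton)
qed

text \<open>The centre lies on the perpendicular bisector of every chord.\<close>

lemma sphere_chord:
  assumes "p \<in> sphere o' r" "p + w \<in> sphere o' r"
  shows "2 * ((p - o') \<bullet> w) = - (w \<bullet> w)"
proof -
  have "norm (p - o') = norm (p - o' + w)"
    using assms by (simp add: dist_norm norm_minus_commute algebra_simps)
  then have "(p - o') \<bullet> (p - o') = (p - o' + w) \<bullet> (p - o' + w)"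
    by (simp add: norm_eq)
  then show ?thesis
    by (simp add: inner_add_left inner_add_right inner_commute)
qed

text \<open>The 2-face through the directions \<open>a\<close> and \<open>b\<close> has a vertex \<open>f\<close> with edges in directions
  \<open>a, b\<close> and an opposite vertex \<open>g\<close> with edges in directions \<open>-a, -b\<close>, and it lies in the
  parallelogram spanned by the two. Both parallel edges have the same perpendicular bisector, which
  is impossible if the angle at \<open>f\<close> is acute.\<close>

lemma edges_obtuse:
  assumes bf: "belt_faces P"
    and ins: "\<And>F. F face_of P \<Longrightarrow> aff_dim F = 2 \<Longrightarrow> inscribed F"
    and a: "edge_vec P v a" and b: "edge_vec P v b" and "a \<noteq> b"
  shows "a \<bullet> b \<le> 0"
proof -
  have P: "polytope P" "beltlike P"
    using bf belt_faces_polytope belt_faces_beltlike by auto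
  have bn: "b \<notin> span {a}" "a \<notin> span {b}"
    using edge_vec_parallel_eq[OF P(1)] a b \<open>a \<noteq> b\<close> by blast+
  obtain F where F: "F face_of P" "aff_dim F = 2" "edge_dir F a" "edge_dir F b"
    using belt_faces_two_face[OF bf edge_dirI[OF a] edge_dirI[OF b] bn(1)] by blast
  have F': "polytope F" "beltlike F" "F \<noteq> {}"
    using F belt_faces_face[OF bf F(1)] belt_faces_polytope belt_faces_beltlike by auto
  \<comment> \<open>This \<open>c\<close> is orthogonal to no edge of \<open>P\<close>, so on
    \<open>F\<close> both \<open>c\<close> and \<open>- c\<close> expose vertices: the opposite
    vertices \<open>f\<close> and \<open>g\<close>.\<close>
  obtain c where c: "max_face P c = {v}"
    using extreme_max_face[OF P(1)] edge_vec_extreme[OF a] by blast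
  have cg: "c \<bullet> w \<noteq> 0" if "edge_vec P x w" for x w
    using beltlike_generic[OF P(2) that c] .
  obtain f where f: "max_face F c = {f}"
    using no_edge_imp_singleton[OF F'(1,3)] cg edge_vec_face[OF F(1)] by metis
  have "- c \<bullet> w \<noteq> 0" if "edge_vec F x w" for x w
    using cg edge_vec_face[OF F(1) that] by simp
  then obtain g where g: "max_face F (- c) = {g}"
    using no_edge_imp_singleton[OF F'(1,3)] by metis
  \<comment> \<open>Stated for \<open>a'\<close> and \<open>b'\<close> because it is applied with
    \<open>a\<close> and \<open>b\<close> in either order.\<close>
  have key: "\<exists>d. d \<bullet> a' = 0 \<and> f \<in> max_face F d \<and> g \<in> max_face F (- d) \<and> d \<bullet> b' < 0 \<and>
      (\<exists>s>0. edge_vec F f (s *\<^sub>R a')) \<and> (\<exists>s>0. edge_vec F g (- s *\<^sub>R a'))"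
    if a': "edge_vec P v a'" "edge_dir F a'" and b': "edge_vec P v b'" "b' \<notin> span {a'}" for a' b'
  proof -
    obtain d where d: "max_face P d = closed_segment v (v + a')" "d \<bullet> a' = 0"
      using edge_as_max_face[OF P(1) a'(1)] .
    have dn: "w \<in> span {a'}" if "edge_vec P x w" "d \<bullet> w = 0" for x w
      using beltlike_edge_normal[OF P(2) d(1) that] .
    have vd: "v \<in> max_face P d"
      by (simp add: d)
    \<comment> \<open>Before \<open>d\<close> is reached, \<open>v\<close> is the only optimal point
      of \<open>P\<close>, being optimal for \<open>d\<close> and strictly optimal for
      \<open>c\<close>. So these functionals are orthogonal to no edge of \<open>P\<close>, let
      alone of \<open>F\<close>.\<close>
    have gen: "((1 - t) *\<^sub>R c + t *\<^sub>R d) \<bullet> w \<noteq> 0" if t: "0 < t" "t < 1" and w: "edge_vec F x w" for t x w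
    proof -
      have "y = v" if y: "y \<in> max_face P ((1 - t) *\<^sub>R c + t *\<^sub>R d)" for y
      proof (rule ccontr)
        assume "y \<noteq> v"
        have yP: "y \<in> P" and "v \<in> P"
          using y vd max_face_subset by blast+
        have "(1 - t) * (c \<bullet> y) < (1 - t) * (c \<bullet> v)"
          using max_face_strict[OF c yP \<open>y \<noteq> v\<close>] t by simp
        moreover have "t * (d \<bullet> y) \<le> t * (d \<bullet> v)"
          using max_faceD[OF vd yP] t by simp
        ultimately show False
          using max_faceD[OF y \<open>v \<in> P\<close>] by (simp add: inner_add_left)
      qed
      moreover have "P \<noteq> {}"
        using vd max_face_subset by blast
      ultimately have "max_face P ((1 - t) *\<^sub>R c + t *\<^sub>R d) = {v}"
        using max_face_ne[OF P(1)] by blast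
      then show ?thesis
        using beltlike_generic[OF P(2) edge_vec_face[OF F(1) w]] by blast
    qed
    have 1: "f \<in> max_face F d \<and> (\<exists>s. edge_vec F f (s *\<^sub>R a'))"
    proof (rule edge_at_limit_vertex[OF F'(1,2) f gen a'(2) d(2)])
      show "\<And>x w. edge_vec F x w \<Longrightarrow> d \<bullet> w = 0 \<Longrightarrow> w \<in> span {a'}"
        using dn edge_vec_face[OF F(1)] by blast
    qed
    have gen': "((1 - t) *\<^sub>R (- c) + t *\<^sub>R (- d)) \<bullet> w \<noteq> 0" if "0 < t" "t < 1" "edge_vec F x w" for t x w
      using gen[OF that] by (simp add: inner_add_left inner_diff_left)
    have 2: "g \<in> max_face F (- d) \<and> (\<exists>s. edge_vec F g (s *\<^sub>R a'))"
    proof (rule edge_at_limit_vertex[OF F'(1,2) g gen' a'(2)])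
      show "- d \<bullet> a' = 0" "\<And>x w. edge_vec F x w \<Longrightarrow> - d \<bullet> w = 0 \<Longrightarrow> w \<in> span {a'}"
        using d(2) dn edge_vec_face[OF F(1)] by auto
    qed
    have ca: "c \<bullet> a' < 0"
      using max_face_edge_less[OF c a'(1)] .
    obtain s where s: "edge_vec F f (s *\<^sub>R a')"
      using 1 by blast
    have "s > 0"
      using max_face_edge_less[OF f s] ca by (simp add: mult_less_0_iff)
    obtain s' where s': "edge_vec F g (s' *\<^sub>R a')"
      using 2 by blast
    have "s' < 0"
      using max_face_edge_less[OF g s'] ca by (simp add: zero_less_mult_iff)
    have "d \<bullet> (v + b') \<le> d \<bullet> v"
      using max_faceD[OF vd] edge_vec_mem[OF b'(1)] by blast
    moreover have "d \<bullet> b' \<noteq> 0"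
      using dn[OF b'(1)] b'(2) by blast
    ultimately have "d \<bullet> b' < 0"
      by (simp add: inner_add_right)
    moreover have "edge_vec F g (- (- s') *\<^sub>R a')" "- s' > 0"
      using s' \<open>s' < 0\<close> by auto
    ultimately show ?thesis
      using 1 2 d(2) s \<open>s > 0\<close> by blast
  qed
  obtain d s s' where d: "d \<bullet> a = 0" "f \<in> max_face F d" "g \<in> max_face F (- d)" "d \<bullet> b < 0"
      and s: "s > 0" "edge_vec F f (s *\<^sub>R a)" and s': "s' > 0" "edge_vec F g (- s' *\<^sub>R a)"
    using key[OF a F(3) b bn(1)] by blast
  obtain e t where e: "e \<bullet> b = 0" "f \<in> max_face F e" "g \<in> max_face F (- e)" "e \<bullet> a < 0"
      and t: "t > 0" "edge_vec F f (t *\<^sub>R b)"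
    using key[OF b F(4) a bn(2)] by blast
  \<comment> \<open>\<open>d\<close> sees only the coefficient of \<open>b\<close> and
    \<open>e\<close> only that of \<open>a\<close>, so the supporting lines at \<open>f\<close>
    bound the coordinates separately.\<close>
  have box_f: "X \<ge> 0 \<and> Y \<ge> 0" if "x \<in> F" "x - f = X *\<^sub>R a + Y *\<^sub>R b" for x X Y
  proof -
    have "d \<bullet> (x - f) \<le> 0" "e \<bullet> (x - f) \<le> 0"
      using max_faceD[OF d(2) that(1)] max_faceD[OF e(2) that(1)] by (auto simp: inner_diff_right)
    then show ?thesis
      unfolding that(2) using d(1,4) e(1,4) by (auto simp: inner_add_right mult_le_0_iff)
  qed
  have box_g: "X \<le> 0 \<and> Y \<le> 0" if "x \<in> F" "x - g = X *\<^sub>R a + Y *\<^sub>R b" for x X Y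
  proof -
    have "d \<bullet> (x - g) \<ge> 0" "e \<bullet> (x - g) \<ge> 0"
      using max_faceD[OF d(3) that(1)] max_faceD[OF e(3) that(1)] by (auto simp: inner_diff_right)
    then show ?thesis
      unfolding that(2) using d(1,4) e(1,4) by (auto simp: inner_add_right zero_le_mult_iff)
  qed
  have fg: "f \<in> F" "g \<in> F"
    using f g max_face_subset by blast+
  have "g - f \<in> span {a, b}"
    using dirs_plane[OF F(2) edge_dir_dirs[OF F(3)] edge_dir_dirs[OF F(4)] edge_vec_ne[OF a] bn(1)]
      diff_in_dirs[OF fg(2,1)] by simp
  then obtain X Y where XY: "g - f = X *\<^sub>R a + Y *\<^sub>R b"
    by (rule span_pairE)
  have g_eq: "g = f + (X *\<^sub>R a + Y *\<^sub>R b)"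
    using XY by (simp add: algebra_simps)
  have "f + s *\<^sub>R a - g = (s - X) *\<^sub>R a + (- Y) *\<^sub>R b" "g + - s' *\<^sub>R a - f = (X - s') *\<^sub>R a + Y *\<^sub>R b"
      "f + t *\<^sub>R b - g = (- X) *\<^sub>R a + (t - Y) *\<^sub>R b"
    unfolding g_eq by (simp_all add: algebra_simps)
  then have "s - X \<le> 0" "X - s' \<ge> 0" "t - Y \<le> 0"
    using box_g box_f edge_vec_mem[OF s(2)] edge_vec_mem[OF s'(2)] edge_vec_mem[OF t(2)] by blast+
  then have bounds: "s \<le> X" "s' \<le> X" "t \<le> Y"
    by auto
  obtain o' r where sph: "{v. v extreme_point_of F} \<subseteq> sphere o' r"
    using ins[OF F(1,2)] by (auto simp: inscribed_def)
  have "2 * ((f - o') \<bullet> (s *\<^sub>R a)) = - ((s *\<^sub>R a) \<bullet> (s *\<^sub>R a))"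
    by (rule sphere_chord) (use sph edge_vec_extreme[OF s(2)] in blast)+
  then have "s * (2 * ((f - o') \<bullet> a)) = s * (- s * (a \<bullet> a))"
    by (simp add: algebra_simps)
  then have 1: "2 * ((f - o') \<bullet> a) = - s * (a \<bullet> a)"
    using s(1) by (metis mult_left_cancel order_less_irrefl)
  have "2 * ((g - o') \<bullet> (- s' *\<^sub>R a)) = - ((- s' *\<^sub>R a) \<bullet> (- s' *\<^sub>R a))"
    by (rule sphere_chord) (use sph edge_vec_extreme[OF s'(2)] in blast)+
  then have "s' * (2 * ((g - o') \<bullet> a)) = s' * (s' * (a \<bullet> a))"
    by (simp add: algebra_simps)
  then have 2: "2 * ((g - o') \<bullet> a) = s' * (a \<bullet> a)"
    using s'(1) by (metis mult_left_cancel order_less_irrefl)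
  \<comment> \<open>Subtracting the two bisector equations eliminates the centre. Since
    \<open>X\<close> is at least \<open>s\<close> and \<open>s'\<close>, and \<open>Y\<close> is
    positive, the remaining identity forces the sign of \<open>a \<bullet> b\<close>.\<close>
  have "2 * ((g - f) \<bullet> a) = (s + s') * (a \<bullet> a)"
    using 1 2 by (simp add: inner_diff_left algebra_simps)
  then have "2 * Y * (a \<bullet> b) = (s + s' - 2 * X) * (a \<bullet> a)"
    unfolding XY by (simp add: inner_add_left inner_commute algebra_simps)
  also have "\<dots> \<le> 0"
    using bounds by (intro mult_nonpos_nonneg) auto
  finally show ?thesis
    using bounds(3) t(1) by (simp add: mult_le_0_iff)
qed

text \<open>Vectors in an open half-space with pairwise nonpositive inner products are independent: the
  positive and the negative part of a linear relation are equal and have nonpositive inner product.\<close>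

lemma obtuse_independent:
  fixes A :: "'a::euclidean_space set"
  assumes A: "finite A" "\<And>a. a \<in> A \<Longrightarrow> c \<bullet> a < 0"
    and ob: "\<And>a b. a \<in> A \<Longrightarrow> b \<in> A \<Longrightarrow> a \<noteq> b \<Longrightarrow> a \<bullet> b \<le> 0"
  shows "independent A"
proof
  assume "dependent A"
  then obtain u v where u: "v \<in> A" "u v \<noteq> 0" "(\<Sum>a\<in>A. u a *\<^sub>R a) = 0"
    using dependent_finite[OF A(1)] by auto
  define p where "p = (\<Sum>a\<in>A. max (u a) 0 *\<^sub>R a)"
  define q where "q = (\<Sum>a\<in>A. max (- u a) 0 *\<^sub>R a)"
  have "p - q = (\<Sum>a\<in>A. u a *\<^sub>R a)"
    unfolding p_def q_def sum_subtractf[symmetric]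
    by (intro sum.cong) (auto simp: max_def simp flip: scaleR_diff_left)
  then have pq: "q = p"
    using u by simp
  have "p \<bullet> q = (\<Sum>a\<in>A. max (u a) 0 * (a \<bullet> q))"
    by (simp add: p_def inner_sum_left)
  also have "\<dots> \<le> 0"
  proof (rule sum_nonpos)
    fix a assume a: "a \<in> A"
    show "max (u a) 0 * (a \<bullet> q) \<le> 0"
    proof (cases "u a > 0")
      case True
      have "a \<bullet> q = (\<Sum>b\<in>A. max (- u b) 0 * (a \<bullet> b))"
        by (simp add: q_def inner_sum_right)
      also have "\<dots> \<le> 0"
      proof (rule sum_nonpos)
        fix b assume b: "b \<in> A"
        show "max (- u b) 0 * (a \<bullet> b) \<le> 0"
        proof (cases "a = b")
          case False
          then show ?thesis
            using ob[OF a b] by (intro mult_nonneg_nonpos) auto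
        qed (use True in \<open>simp add: max_def\<close>)
      qed
      finally show ?thesis
        by (intro mult_nonneg_nonpos) auto
    qed (simp add: max_def)
  qed
  finally have "p = 0"
    by (metis inner_eq_zero_iff inner_ge_zero order_antisym pq)
  \<comment> \<open>Paired with \<open>c\<close>, a vanishing combination with nonnegative
    coefficients becomes a sum of terms of one sign, so the coefficient of \<open>v\<close> is
    0.\<close>
  have zero: "x v = 0" if "(\<Sum>a\<in>A. x a *\<^sub>R a) = 0" "\<And>a. x a \<ge> 0" for x :: "'a \<Rightarrow> real"
  proof -
    have "(\<Sum>a\<in>A. - (x a * (c \<bullet> a))) = - (c \<bullet> (\<Sum>a\<in>A. x a *\<^sub>R a))"
      by (simp add: inner_sum_right sum_negf)
    also have "\<dots> = 0"
      using that by simp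
    finally have "- (x v * (c \<bullet> v)) = 0"
      using sum_nonneg_eq_0_iff[OF A(1), of "\<lambda>a. - (x a * (c \<bullet> a))"] A(2) that(2) u(1)
      by (simp add: mult_nonneg_nonpos less_imp_le)
    then show ?thesis
      using A(2)[OF u(1)] by simp
  qed
  have "max (u v) 0 = 0"
    by (rule zero) (use \<open>p = 0\<close> p_def in auto)
  moreover have "max (- u v) 0 = 0"
    by (rule zero[of "\<lambda>a. max (- u a) 0"]) (use \<open>p = 0\<close> q_def pq in auto)
  ultimately show False
    using u(2) by (simp add: max_def split: if_splits)
qed

text \<open>The vector representing a linear extension of \<open>\<phi>\<close>. It will supply both
  the centre of the sphere and the functional that cuts out a 2-face at a vertex.\<close>

lemma independent_interpolate:
  fixes A :: "'a::euclidean_space set"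
  assumes "independent A"
  obtains d where "\<And>a. a \<in> A \<Longrightarrow> d \<bullet> a = \<phi> a"
proof -
  obtain g :: "'a \<Rightarrow> real" where g: "linear g" "\<And>x. x \<in> A \<Longrightarrow> g x = \<phi> x"
    using linear_independent_extend[OF assms, of \<phi>] by blast
  have "adjoint g 1 \<bullet> a = \<phi> a" if "a \<in> A" for a
    using adjoint_works[OF g(1), of a 1] g(2)[OF that] by (simp add: inner_commute)
  then show ?thesis
    using that by blast
qed

section \<open>Edges at a vertex and the centre of the sphere\<close>

lemma finite_edges_at:
  assumes "polytope P"
  shows "finite {w. edge_vec P v w}"
proof (rule finite_subset)
  show "{w. edge_vec P v w} \<subseteq> (\<lambda>x. x - v) ` {x. x extreme_point_of P}"
    using edge_vec_extreme by (force intro: image_eqI[of _ _ "v + _"])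
qed (use polytope_finite_extreme[OF assms] in simp)

text \<open>Let \<open>z\<close> be the part of \<open>x - v\<close> orthogonal to all edges at
  \<open>v\<close>. Then \<open>v\<close> is a local, hence a global maximum of \<open>z\<close>, so
  \<open>z \<bullet> (x - v)\<close>, which equals \<open>z \<bullet> z\<close>, is
  nonpositive.\<close>

lemma dirs_eq_span_edges:
  assumes P: "polytope P" and v: "v extreme_point_of P"
  shows "dirs P = span {w. edge_vec P v w}"
proof
  have vP: "v \<in> P"
    using v by (simp add: extreme_point_of_def)
  show "span {w. edge_vec P v w} \<subseteq> dirs P"
    using edge_vec_dirs subspace_dirs by (intro span_minimal) auto
  show "dirs P \<subseteq> span {w. edge_vec P v w}"
    unfolding dirs_eq_span[OF vP]
  proof (rule span_minimal)
    show "(\<lambda>x. x - v) ` P \<subseteq> span {w. edge_vec P v w}"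
    proof clarify
      fix x assume x: "x \<in> P"
      obtain y z where yz: "y \<in> span {w. edge_vec P v w}"
          "\<And>w. w \<in> span {w. edge_vec P v w} \<Longrightarrow> orthogonal z w" "x - v = y + z"
        using orthogonal_subspace_decomp_exists by blast
      have "z \<bullet> w \<le> 0" if "edge_vec P v w" for w
        using yz(2)[of w] that span_base[of w "{w. edge_vec P v w}"] by (simp add: orthogonal_def)
      then have "z \<bullet> x \<le> z \<bullet> v"
        using local_max_imp_max[OF P v _ x] by blast
      then have "z \<bullet> (x - v) \<le> 0"
        by (simp add: inner_diff_right)
      then have "z \<bullet> z \<le> 0"
        using yz(2)[OF yz(1)] by (simp add: yz(3) inner_add_right orthogonal_def)
      then have "z = 0"
        using inner_ge_zero[of z] inner_eq_zero_iff[of z] by linarith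
      then show "x - v \<in> span {w. edge_vec P v w}"
        using yz by simp
    qed
  qed simp
qed

text \<open>Independence provides a functional that is 0 on \<open>a\<close> and \<open>b\<close>
  and -1 on the other edges at \<open>v\<close>. It is maximal at \<open>v\<close>, and the face it
  exposes has exactly the edges \<open>a\<close> and \<open>b\<close> there, which span its
  directions.\<close>

lemma simple_vertex_two_face:
  assumes P: "polytope P" and ind: "independent {w. edge_vec P v w}"
    and ab: "edge_vec P v a" "edge_vec P v b" "a \<noteq> b"
  shows "\<exists>F. F face_of P \<and> aff_dim F = 2 \<and> edge_vec F v a \<and> edge_vec F v b"
proof -
  obtain d where "\<And>w. w \<in> {w. edge_vec P v w} \<Longrightarrow> d \<bullet> w = (if w = a \<or> w = b then 0 else - 1)"
    using independent_interpolate[OF ind, where \<phi> = "\<lambda>w. if w = a \<or> w = b then 0 else - 1"] by metis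
  then have d: "edge_vec P v w \<Longrightarrow> d \<bullet> w = (if w = a \<or> w = b then 0 else - 1)" for w
    by blast
  define F where "F = max_face P d"
  have F: "F face_of P"
    using P by (simp add: F_def max_face_face polytope_imp_convex)
  have v: "v extreme_point_of P"
    using ab edge_vec_extreme by blast
  have "d \<bullet> x \<le> d \<bullet> v" if "x \<in> P" for x
    by (rule local_max_imp_max[OF P v _ that]) (simp add: d)
  then have vF: "v \<in> F"
    using v by (simp add: F_def max_face_def extreme_point_of_def)
  have in_F: "v + w \<in> F" if "edge_vec P v w" "d \<bullet> w = 0" for w
    using max_face_eq_hyperplane[OF vF[unfolded F_def]] that(2) edge_vec_mem[OF that(1)]
    by (simp add: F_def inner_add_right)
  have edges: "edge_vec F v a" "edge_vec F v b"
    using edge_vec_face_iff[OF F] ab vF in_F d by auto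
  have "{w. edge_vec F v w} = {a, b}"
  proof
    show "{w. edge_vec F v w} \<subseteq> {a, b}"
    proof
      fix w assume "w \<in> {w. edge_vec F v w}"
      then have w: "edge_vec F v w"
        by simp
      then have "d \<bullet> w = 0"
        unfolding F_def by (rule edge_vec_max_face)
      then show "w \<in> {a, b}"
        using d[OF edge_vec_face[OF F w]] by (auto split: if_splits)
    qed
  qed (use edges in auto)
  then have "dirs F = span {a, b}"
    using dirs_eq_span_edges[of F v] F P v vF face_of_polytope_polytope extreme_point_of_face by metis
  moreover have "independent {a, b}"
    by (rule independent_mono[OF ind]) (use ab in auto)
  ultimately have "dim (dirs F) = 2"
    using ab(3) by (simp add: dim_eq_card_independent)
  then show ?thesis
    using F edges aff_dim_dirs[of F] vF by (intro exI[of _ F]) auto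
qed

text \<open>Equidistance from the ends of an edge is a linear condition on \<open>o'\<close>, so a
  centre can be found by interpolation and two centres can be compared by subtraction.\<close>

lemma dist_edge_iff:
  "dist o' (v + a) = dist o' v \<longleftrightarrow> (o' - v) \<bullet> a = (a \<bullet> a) / 2"
proof -
  have "dist o' (v + a) = dist o' v \<longleftrightarrow> norm (o' - v - a) = norm (o' - v)"
    by (simp add: dist_norm algebra_simps)
  also have "\<dots> \<longleftrightarrow> (o' - v - a) \<bullet> (o' - v - a) = (o' - v) \<bullet> (o' - v)"
    by (rule norm_eq)
  also have "\<dots> \<longleftrightarrow> (o' - v) \<bullet> a = (a \<bullet> a) / 2"
    by (auto simp: inner_diff_left inner_diff_right inner_commute)
  finally show ?thesis .
qed

theorem belt_faces_inscribed:
  fixes P :: "'a::euclidean_space set"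
  assumes bf: "belt_faces P" and ne: "P \<noteq> {}"
    and ins: "\<And>F. F face_of P \<Longrightarrow> aff_dim F = 2 \<Longrightarrow> inscribed F"
  shows "inscribed P"
proof -
  have P: "polytope P"
    using bf by (rule belt_faces_polytope)
  obtain v0 where v0: "v0 extreme_point_of P"
    using polytope_extreme_ne[OF P ne] by blast
  have ind: "independent {w. edge_vec P v w}" if v: "v extreme_point_of P" for v
  proof -
    obtain c where c: "max_face P c = {v}"
      using extreme_max_face[OF P v] by blast
    show ?thesis
      using max_face_edge_less[OF c] edges_obtuse[OF bf ins]
      by (intro obtuse_independent[of _ c] finite_edges_at[OF P]) auto
  qed
  obtain d where "\<And>w. w \<in> {w. edge_vec P v0 w} \<Longrightarrow> d \<bullet> w = (w \<bullet> w) / 2"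
    using independent_interpolate[OF ind[OF v0], where \<phi> = "\<lambda>w. (w \<bullet> w) / 2"] by metis
  then have d: "edge_vec P v0 w \<Longrightarrow> d \<bullet> w = (w \<bullet> w) / 2" for w
    by blast
  define o' where "o' = v0 + d"
  \<comment> \<open>The invariant includes the neighbours, because the comparison with a 2-face at
    \<open>v\<close> uses all its edges there.\<close>
  define Q where "Q v \<longleftrightarrow> (\<forall>w. edge_vec P v w \<longrightarrow> dist o' (v + w) = dist o' v) \<and> dist o' v = dist o' v0"
    for v
  have Q: "Q v" if "v extreme_point_of P" for v
  proof (rule vertex_induct[OF P v0 _ _ that])
    show "Q v0"
      unfolding Q_def dist_edge_iff by (simp add: o'_def d)
    fix v a assume v: "v extreme_point_of P" "Q v" and a: "edge_vec P v a"
    have dva: "dist o' (v + a) = dist o' v"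
      using v a by (auto simp: Q_def)
    have "dist o' (v + a + b) = dist o' (v + a)" if b: "edge_vec P (v + a) b" for b
    proof (cases "b = - a")
      case True
      then show ?thesis
        using dva by simp
    next
      case False
      have ra: "edge_vec P (v + a) (- a)"
        using a by (rule edge_vec_rev)
      obtain F where F: "F face_of P" "aff_dim F = 2" "edge_vec F (v + a) (- a)" "edge_vec F (v + a) b"
        using simple_vertex_two_face[OF P ind ra b] edge_vec_extreme[OF a] False by blast
      obtain q r where sph: "{v. v extreme_point_of F} \<subseteq> sphere q r"
        using ins[OF F(1,2)] by (auto simp: inscribed_def)
      have qF: "dist q (x + w) = dist q x" if "edge_vec F x w" for x w
      proof -
        have "x \<in> sphere q r" "x + w \<in> sphere q r"
          using sph edge_vec_extreme[OF that] by blast+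
        then show ?thesis
          by simp
      qed
      have vF: "v extreme_point_of F"
        using edge_vec_extreme[OF F(3)] by simp
      \<comment> \<open>Both \<open>o'\<close> and the centre \<open>q\<close> of a sphere through
        the vertices of \<open>F\<close> lie on the bisectors of the edges of \<open>F\<close> at
        \<open>v\<close>. These edges span the directions of \<open>F\<close>, so
        \<open>o' - q\<close> is also orthogonal to \<open>b\<close>, and \<open>o'\<close> inherits
        the bisector of \<open>b\<close> from \<open>q\<close>.\<close>
      have "(o' - q) \<bullet> w = 0" if "edge_vec F v w" for w
      proof -
        have "dist o' (v + w) = dist o' v"
          using v(2) edge_vec_face[OF F(1) that] unfolding Q_def by blast
        with qF[OF that] show ?thesis
          unfolding dist_edge_iff inner_diff_left by linarith
      qed
      then have "span {w. edge_vec F v w} \<subseteq> {w. (o' - q) \<bullet> w = 0}"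
        by (intro span_minimal subspace_hyperplane) auto
      moreover have "b \<in> span {w. edge_vec F v w}"
        using dirs_eq_span_edges[OF _ vF] face_of_polytope_polytope[OF P F(1)] edge_vec_dirs[OF F(4)]
        by simp
      ultimately have "(o' - q) \<bullet> b = 0"
        by blast
      then show ?thesis
        using qF[OF F(4)] unfolding dist_edge_iff inner_diff_left by linarith
    qed
    then show "Q (v + a)"
      using dva v by (simp add: Q_def)
  qed
  \<comment> \<open>The radius must be positive. A single point gets a displaced centre; otherwise
    an edge at \<open>v0\<close> keeps \<open>o'\<close> away from \<open>v0\<close>.\<close>
  show ?thesis
  proof (cases "P = {v0}")
    case True
    obtain e :: 'a where "e \<in> Basis"
      using nonempty_Basis by blast
    then have "{v. v extreme_point_of P} \<subseteq> sphere (v0 + e) 1"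
      by (auto simp: True dist_norm)
    then show ?thesis
      unfolding inscribed_def using zero_less_one by blast
  next
    case False
    then obtain w where w: "edge_vec P v0 w"
      using polytope_edge_at_vertex[OF P v0] by blast
    then have "dist o' (v0 + w) = dist o' v0" "w \<noteq> 0"
      using Q[OF v0] edge_vec_ne[OF w] by (auto simp: Q_def)
    then have "dist o' v0 > 0"
      by (metis add_cancel_left_right dist_eq_0_iff zero_less_dist_iff)
    moreover have "{v. v extreme_point_of P} \<subseteq> sphere o' (dist o' v0)"
      using Q by (auto simp: Q_def)
    ultimately show ?thesis
      unfolding inscribed_def by blast
  qed
qed

section \<open>Polygons\<close>

lemma inner_diff_zero_iff:
  "(y - v) \<bullet> c \<le> 0 \<longleftrightarrow> c \<bullet> y \<le> c \<bullet> v"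
  "(y - v) \<bullet> c < 0 \<longleftrightarrow> c \<bullet> y < c \<bullet> v"
  "(y - v) \<bullet> c = 0 \<longleftrightarrow> c \<bullet> y = c \<bullet> v"
  by (simp_all add: inner_diff_left inner_commute[of y c] inner_commute[of v c])

text \<open>In the plane of \<open>Q\<close> the vectors orthogonal to \<open>w\<close> form a line.
  The projections of \<open>c\<close> and of a functional exposing the edge lie on it, so they are
  proportional, and the sign of the factor decides.\<close>

lemma polygon_edge_max_face:
  assumes Q: "polytope Q" "aff_dim Q = 2" and e: "edge_vec Q x w"
    and c: "c \<bullet> w = 0" "max_face Q c \<noteq> Q"
  shows "max_face Q c = closed_segment x (x + w) \<or> max_face Q (- c) = closed_segment x (x + w)"
proof -
  obtain d where d: "max_face Q d = closed_segment x (x + w)" "d \<bullet> w = 0"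
    using edge_as_max_face[OF Q(1) e] .
  obtain c' where c': "c' \<in> dirs Q" "\<And>y. y \<in> dirs Q \<Longrightarrow> c \<bullet> y = c' \<bullet> y" "max_face Q c = max_face Q c'"
    using max_face_project[of Q c] by metis
  obtain d' where d': "d' \<in> dirs Q" "\<And>y. y \<in> dirs Q \<Longrightarrow> d \<bullet> y = d' \<bullet> y" "max_face Q d = max_face Q d'"
    using max_face_project[of Q d] by metis
  have w: "w \<in> dirs Q" "w \<noteq> 0"
    using edge_vec_dirs[OF e] edge_vec_ne[OF e] by auto
  have "c' \<noteq> 0"
  proof
    assume "c' = 0"
    then show False
      using c(2) c'(3) by (simp add: max_face_def)
  qed
  have "d' \<noteq> 0"
  proof
    assume "d' = 0"
    then have "Q = closed_segment x (x + w)"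
      using d(1) d'(3) by (simp add: max_face_def)
    then have "aff_dim Q \<le> 1"
      by (metis collinear_aff_dim collinear_closed_segment)
    then show False
      using Q by simp
  qed
  have perp: "c' \<bullet> w = 0" "d' \<bullet> w = 0"
    using c'(2)[OF w(1)] d'(2)[OF w(1)] c(1) d(2) by auto
  have "d' \<notin> span {w}"
    using perp(2) \<open>d' \<noteq> 0\<close> w(2) by (auto simp: span_singleton)
  then have "c' \<in> span {w, d'}"
    using dirs_plane[OF Q(2) w(1) d'(1) w(2)] c'(1) by simp
  then obtain X Y where XY: "c' = X *\<^sub>R w + Y *\<^sub>R d'"
    by (rule span_pairE)
  have "X = 0"
    using perp w(2) by (simp add: XY inner_add_left)
  then have Y: "c' = Y *\<^sub>R d'" "Y \<noteq> 0"
    using XY \<open>c' \<noteq> 0\<close> by auto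
  have eq: "c \<bullet> (y - z) = Y * (d \<bullet> (y - z))" if "y \<in> Q" "z \<in> Q" for y z
    using c'(2) d'(2) diff_in_dirs[OF that] Y(1) by simp
  show ?thesis
  proof (cases "Y > 0")
    case True
    have "max_face Q c = max_face Q (Y *\<^sub>R d)"
      by (rule max_face_cong) (simp add: eq)
    then show ?thesis
      using True d(1) by (simp add: max_face_scale)
  next
    case False
    then have "- Y > 0"
      using Y(2) by simp
    have "max_face Q (- c) = max_face Q ((- Y) *\<^sub>R d)"
      by (rule max_face_cong) (simp add: eq)
    then show ?thesis
      using max_face_scale[OF \<open>- Y > 0\<close>, of Q d] d(1) by simp
  qed
qed

text \<open>If \<open>c\<close> is not constant on \<open>Q\<close> and exposes neither edge, then
  \<open>- c\<close> exposes both, and they coincide.\<close>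

lemma polygon_opposite_edges:
  assumes Q: "polytope Q" "aff_dim Q = 2"
    and e: "edge_vec Q x w" "edge_vec Q x' w'"
    and ne: "closed_segment x (x + w) \<noteq> closed_segment x' (x' + w')"
    and c: "c \<bullet> w = 0" "c \<bullet> w' = 0"
  shows "edge_vec (max_face Q c) x w \<or> edge_vec (max_face Q c) x' w'"
proof (cases "max_face Q c = Q")
  case False
  have "x \<in> max_face Q c \<and> x + w \<in> max_face Q c \<or> x' \<in> max_face Q c \<and> x' + w' \<in> max_face Q c"
    using polygon_edge_max_face[OF Q e(1) c(1) False] polygon_edge_max_face[OF Q e(2) c(2) False] ne
    by (metis ends_in_segment)
  moreover have "max_face Q c face_of Q"
    using Q(1) max_face_face polytope_imp_convex by blast
  ultimately show ?thesis
    using edge_vec_face_iff[of "max_face Q c" Q] e by blast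
qed (use e in simp)

lemma affine_hull_segment:
  fixes v w :: "'a::euclidean_space"
  shows "affine hull closed_segment v (v + w) = range (\<lambda>t. v + t *\<^sub>R w)"
proof -
  have "affine hull closed_segment v (v + w) = affine hull {v, v + w}"
    by (simp add: segment_convex_hull)
  also have "\<dots> = range (\<lambda>t. v + t *\<^sub>R w)"
    unfolding affine_hull_2_alt by simp
  finally show ?thesis .
qed

lemma affine_parallel_segments_span:
  fixes v w :: "'a::euclidean_space"
  assumes "affine_parallel (affine hull closed_segment v (v + w)) (affine hull closed_segment v' (v' + w'))"
  shows "w' \<in> span {w}"
proof -
  from assms obtain a where a: "range (\<lambda>t. v' + t *\<^sub>R w') = (\<lambda>x. a + x) ` range (\<lambda>t. v + t *\<^sub>R w)"
    unfolding affine_parallel_def affine_hull_segment by blast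
  have "v' + 0 *\<^sub>R w' \<in> range (\<lambda>t. v' + t *\<^sub>R w')" "v' + 1 *\<^sub>R w' \<in> range (\<lambda>t. v' + t *\<^sub>R w')"
    by (rule rangeI)+
  then have "v' \<in> (\<lambda>x. a + x) ` range (\<lambda>t. v + t *\<^sub>R w)" "v' + w' \<in> (\<lambda>x. a + x) ` range (\<lambda>t. v + t *\<^sub>R w)"
    unfolding a by simp_all
  then obtain s t where st: "v' = a + (v + s *\<^sub>R w)" "v' + w' = a + (v + t *\<^sub>R w)"
    by blast
  then have "w' = (a + (v + t *\<^sub>R w)) - (a + (v + s *\<^sub>R w))"
    by (metis add_diff_cancel_left')
  then have "w' = (t - s) *\<^sub>R w"
    by (simp add: algebra_simps)
  then show ?thesis
    by (simp add: span_base span_scale)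
qed

text \<open>Shifting the index by \<open>k\<close>, up or down, gives a second edge parallel to the
  given one, and one of the two lies on the face exposed by \<open>c\<close>.\<close>

lemma belt_polygon_imp_beltlike:
  assumes "belt_polygon Q"
  shows "beltlike Q"
  unfolding beltlike_def
proof (intro allI impI, elim conjE)
  fix u c assume cu: "c \<bullet> u = 0" and "edge_dir Q u"
  then obtain v s where vs: "edge_vec Q v (s *\<^sub>R u)" "s \<noteq> 0" "u \<noteq> 0"
    by (metis edge_dirE)
  obtain k :: nat and E where Q: "polytope Q" "aff_dim Q = 2"
    and E: "bij_betw E {..<2 * k} {e. e edge_of Q}"
    and par: "\<And>i. i < k \<Longrightarrow> affine_parallel (affine hull E i) (affine hull E (i + k))"
    using assms unfolding belt_polygon_def by blast
  obtain i where i: "i < 2 * k" "E i = closed_segment v (v + s *\<^sub>R u)"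
  proof -
    have "closed_segment v (v + s *\<^sub>R u) \<in> E ` {..<2 * k}"
      using bij_betw_imp_surj_on[OF E] edge_vec_imp_edge_of[OF vs(1)] by simp
    then show ?thesis
      using that by auto
  qed
  obtain j where j: "j < 2 * k" "j \<noteq> i" "affine_parallel (affine hull E i) (affine hull E j)"
  proof (cases "i < k")
    case True
    then show ?thesis
      using that[of "i + k"] par[of i] by simp
  next
    case False
    then have "i - k < k" "i - k + k = i" "i - k \<noteq> i"
      using i(1) by auto
    moreover from this have "affine_parallel (affine hull E i) (affine hull E (i - k))"
      using par[of "i - k"] affine_parallel_commute by metis
    ultimately show ?thesis
      using that[of "i - k"] by simp
  qed
  have "E j edge_of Q"
    using bij_betw_imp_surj_on[OF E] j(1) by blast
  then obtain v' w' where v': "edge_vec Q v' w'" "E j = closed_segment v' (v' + w')"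
    using edge_of_imp_edge_vec[OF Q(1)] by blast
  have "E i \<noteq> E j"
    using bij_betw_imp_inj_on[OF E] i(1) j(1,2) by (auto simp: inj_on_def)
  have "w' \<in> span {s *\<^sub>R u}"
    using affine_parallel_segments_span j(3) unfolding i(2) v'(2) by blast
  then obtain r where r: "w' = (r * s) *\<^sub>R u"
    by (auto simp: span_singleton)
  have "edge_vec (max_face Q c) v (s *\<^sub>R u) \<or> edge_vec (max_face Q c) v' w'"
    by (rule polygon_opposite_edges[OF Q vs(1) v'(1)])
      (use \<open>E i \<noteq> E j\<close> i(2) v'(2) cu r in auto)
  then show "edge_dir (max_face Q c) u"
    unfolding edge_dir_def has_edge_in_def r by blast
qed

lemma centrally_symmetric_has_edge:
  assumes Q: "polytope Q" "aff_dim Q = 2" and cs: "centrally_symmetric Q"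
    and c: "c \<bullet> u = 0" "has_edge_in Q {u}"
  shows "has_edge_in (max_face Q c) {u}"
proof -
  obtain v where v: "edge_vec Q v u"
    using c(2) by (auto simp: has_edge_in_def)
  obtain m where m: "(\<lambda>x. 2 *\<^sub>R m - x) ` Q = Q"
    using cs by (auto simp: centrally_symmetric_def)
  \<comment> \<open>The reflection exchanges the ends, so the image edge, started at the image of
    \<open>v + u\<close>, has the vector \<open>u\<close> again.\<close>
  define v' where "v' = 2 *\<^sub>R m - (v + u)"
  have img: "(\<lambda>x. 2 *\<^sub>R m - x) ` S = (+) (2 *\<^sub>R m) ` (uminus ` S)" for S
    by (auto simp: image_image)
  have "closed_segment v (v + u) face_of Q"
    using v by (simp add: edge_vec_def)
  then have "(\<lambda>x. 2 *\<^sub>R m - x) ` closed_segment v (v + u) face_of (\<lambda>x. 2 *\<^sub>R m - x) ` Q"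
    unfolding img face_of_translation_eq by (simp add: face_of_linear_image linear_uminus)
  moreover have "(\<lambda>x. 2 *\<^sub>R m - x) ` closed_segment v (v + u)
      = closed_segment (2 *\<^sub>R m + - v) (2 *\<^sub>R m + - (v + u))"
    unfolding img
    by (simp only: closed_segment_linear_image[OF linear_uminus, symmetric] closed_segment_translation[symmetric])
  moreover have "2 *\<^sub>R m + - (v + u) = v'" "2 *\<^sub>R m + - v = v' + u"
    by (simp_all add: v'_def)
  ultimately have v': "edge_vec Q v' u"
    using edge_vec_ne[OF v] by (simp only: m edge_vec_def closed_segment_commute not_False_eq_True simp_thms)
  have "closed_segment v (v + u) \<noteq> closed_segment v' (v' + u)"
  proof
    \<comment> \<open>If the edge were its own image, the symmetry would turn the upper bound of
      \<open>d\<close> on \<open>Q\<close> into a lower bound, and \<open>Q\<close> would be a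
      segment.\<close>
    assume eq: "closed_segment v (v + u) = closed_segment v' (v' + u)"
    obtain d where d: "max_face Q d = closed_segment v (v + u)" "d \<bullet> u = 0"
      using edge_as_max_face[OF Q(1) v] .
    have "v \<in> max_face Q d" "v' \<in> max_face Q d"
      using d(1) eq by auto
    then have vv: "v \<in> max_face Q d" "d \<bullet> v' = d \<bullet> v"
      using max_face_inner_eq by auto
    have "d \<bullet> x = d \<bullet> v" if "x \<in> Q" for x
    proof (rule antisym)
      show "d \<bullet> x \<le> d \<bullet> v"
        using max_faceD[OF vv(1) that] .
      have "d \<bullet> (2 *\<^sub>R m - x) \<le> d \<bullet> v"
        using max_faceD[OF vv(1)] m that by blast
      then show "d \<bullet> v \<le> d \<bullet> x"
        using vv(2) d(2) by (simp add: v'_def inner_diff_right inner_add_right)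
    qed
    then have "max_face Q d = Q"
      by (intro max_face_const) simp
    then have "aff_dim Q \<le> 1"
      using d(1) by (metis collinear_aff_dim collinear_closed_segment)
    then show False
      using Q(2) by simp
  qed
  then show ?thesis
    using polygon_opposite_edges[OF Q v v' _ c(1) c(1)] by (auto simp: has_edge_in_def)
qed

lemma centrally_symmetric_imp_beltlike:
  assumes "polytope Q" "aff_dim Q = 2" "centrally_symmetric Q"
  shows "beltlike Q"
  unfolding beltlike_def
proof (intro allI impI, elim conjE)
  fix u c assume cu: "c \<bullet> u = 0" and "edge_dir Q u"
  then obtain v s where vs: "edge_vec Q v (s *\<^sub>R u)"
    by (metis edge_dirE)
  then have "has_edge_in (max_face Q c) {s *\<^sub>R u}"
    using centrally_symmetric_has_edge[OF assms, of c "s *\<^sub>R u"] cu by (auto simp: has_edge_in_def)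
  then show "edge_dir (max_face Q c) u"
    by (auto simp: edge_dir_def has_edge_in_def)
qed

section \<open>Normal fans\<close>

lemma finite_edge_vecs:
  assumes "polytope P"
  shows "finite {w. \<exists>v. edge_vec P v w}"
proof -
  have "{w. \<exists>v. edge_vec P v w} = (\<Union>v\<in>{v. v extreme_point_of P}. {w. edge_vec P v w})"
    using edge_vec_extreme by blast
  then show ?thesis
    using polytope_finite_extreme[OF assms] finite_edges_at[OF assms] by simp
qed

lemma normal_cone_iff:
  assumes "F \<subseteq> P"
  shows "c \<in> normal_cone P F \<longleftrightarrow> F \<subseteq> max_face P c"
  using assms by (auto simp: normal_cone_def max_face_def)

lemma convex_normal_cone: "convex (normal_cone P F)"
proof -
  have "normal_cone P F = (\<Inter>x\<in>F. \<Inter>y\<in>P. {c. (y - x) \<bullet> c \<le> 0})"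
    by (auto simp: normal_cone_def inner_diff_zero_iff)
  then show ?thesis
    by (auto intro!: convex_INT convex_halfspace_le)
qed

text \<open>Take \<open>x\<close> in the relative interior of \<open>F\<close>. A functional maximal
  at \<open>v\<close> is maximal on all of \<open>F\<close> exactly if it agrees at \<open>x\<close>
  and \<open>v\<close>, since a face containing \<open>x\<close> contains \<open>F\<close>. This
  cuts the cone by a supporting hyperplane with normal \<open>x - v\<close>.\<close>

lemma normal_cone_face:
  assumes P: "polytope P" and F: "F face_of P" "v \<in> F"
  shows "normal_cone P F face_of normal_cone P {v}"
proof -
  have FP: "F \<subseteq> P" "v \<in> P"
    using F face_of_imp_subset by blast+
  obtain x where x: "x \<in> rel_interior F"
    using F rel_interior_eq_empty[OF face_of_imp_convex[OF F(1)]] by blast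
  then have xF: "x \<in> F"
    using rel_interior_subset by blast
  have "normal_cone P F = normal_cone P {v} \<inter> {c. (x - v) \<bullet> c = 0}"
  proof (intro equalityI subsetI)
    fix c assume c: "c \<in> normal_cone P F"
    then have "F \<subseteq> max_face P c"
      using normal_cone_iff FP by blast
    moreover from this have "c \<bullet> x = c \<bullet> v"
      using xF F(2) max_face_inner_eq by blast
    ultimately show "c \<in> normal_cone P {v} \<inter> {c. (x - v) \<bullet> c = 0}"
      using FP F(2) by (auto simp: normal_cone_iff inner_diff_zero_iff)
  next
    fix c assume "c \<in> normal_cone P {v} \<inter> {c. (x - v) \<bullet> c = 0}"
    then have c: "v \<in> max_face P c" "c \<bullet> x = c \<bullet> v"
      using FP by (auto simp: normal_cone_iff inner_diff_zero_iff)
    then have "x \<in> max_face P c"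
      using max_face_eq_hyperplane[OF c(1)] xF FP by auto
    then have "F \<subseteq> max_face P c"
      using subset_of_face_of[OF max_face_face FP(1)] x P polytope_imp_convex by blast
    then show "c \<in> normal_cone P F"
      using normal_cone_iff FP by blast
  qed
  moreover have "normal_cone P {v} \<inter> {c. (x - v) \<bullet> c = 0} face_of normal_cone P {v}"
  proof (rule face_of_Int_supporting_hyperplane_le[OF convex_normal_cone])
    fix c assume "c \<in> normal_cone P {v}"
    then show "(x - v) \<bullet> c \<le> 0"
      using xF FP by (auto simp: normal_cone_def inner_diff_zero_iff)
  qed
  ultimately show ?thesis
    by simp
qed

text \<open>Functionals near \<open>c\<close> expose only parts of \<open>max_face P c\<close>;
  those in the affine hull of the cone are constant on this face and so expose all of it.\<close>

lemma rel_interior_normal_cone: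
  assumes P: "polytope P" "P \<noteq> {}"
  shows "c \<in> rel_interior (normal_cone P (max_face P c))"
proof -
  let ?G = "max_face P c"
  obtain e where e: "e > 0" "\<And>d. dist d c < e \<Longrightarrow> max_face P d \<subseteq> ?G"
    using max_face_usc[OF P(1)] by blast
  define L where "L = {d. \<forall>x\<in>?G. \<forall>y\<in>?G. d \<bullet> (x - y) = 0}"
  have "subspace L"
    by (auto simp: L_def subspace_def inner_add_left)
  moreover have "normal_cone P ?G \<subseteq> L"
  proof
    fix d assume "d \<in> normal_cone P ?G"
    then have "?G \<subseteq> max_face P d"
      using normal_cone_iff[OF max_face_subset] by blast
    then show "d \<in> L"
      using max_face_inner_eq[of _ P d] by (auto simp: L_def inner_diff_right)
  qed
  ultimately have aff: "affine hull (normal_cone P ?G) \<subseteq> L"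
    by (intro hull_minimal subspace_imp_affine)
  have "ball c e \<inter> affine hull (normal_cone P ?G) \<subseteq> normal_cone P ?G"
  proof
    fix d assume d: "d \<in> ball c e \<inter> affine hull (normal_cone P ?G)"
    obtain y where y: "y \<in> max_face P d"
      using max_face_ne[OF P] by blast
    have "max_face P d \<subseteq> ?G"
      using d e(2) by (simp add: dist_commute)
    then have yG: "y \<in> ?G"
      using y by blast
    have "x \<in> max_face P d" if "x \<in> ?G" for x
    proof -
      have "d \<bullet> x = d \<bullet> y"
        using d aff that yG by (auto simp: L_def inner_diff_right)
      then show ?thesis
        using max_face_eq_hyperplane[OF y] that max_face_subset by blast
    qed
    then show "d \<in> normal_cone P ?G"
      using normal_cone_iff[OF max_face_subset] by blast
  qed
  moreover have "c \<in> normal_cone P ?G"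
    by (simp add: normal_cone_iff max_face_subset)
  ultimately show ?thesis
    using e(1) by (auto simp: mem_rel_interior_ball)
qed

lemma open_normal_cone_interior:
  assumes P: "polytope P" "P \<noteq> {}"
  shows "open {c. max_face P c = {v}}"
  unfolding open_dist
proof
  fix c assume c: "c \<in> {c. max_face P c = {v}}"
  obtain e where "e > 0" and e: "\<And>d. dist d c < e \<Longrightarrow> max_face P d \<subseteq> max_face P c"
    using max_face_usc[OF P(1)] by blast
  have "max_face P d = {v}" if "dist d c < e" for d
    using e[OF that] max_face_ne[OF P, of d] c by auto
  then show "\<exists>e>0. \<forall>d. dist d c < e \<longrightarrow> d \<in> {c. max_face P c = {v}}"
    using \<open>e > 0\<close> by blast
qed

lemma max_face_singleton_iff:
  assumes "v \<in> P"
  shows "max_face P c = {v} \<longleftrightarrow> (\<forall>y\<in>P - {v}. c \<bullet> y < c \<bullet> v)"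
proof
  assume "max_face P c = {v}"
  then show "\<forall>y\<in>P - {v}. c \<bullet> y < c \<bullet> v"
    using max_face_strict by blast
next
  assume r: "\<forall>y\<in>P - {v}. c \<bullet> y < c \<bullet> v"
  then have "v \<in> max_face P c"
    using assms unfolding max_face_def by (auto intro: less_imp_le)
  moreover have "y = v" if "y \<in> max_face P c" for y
    using r max_face_subset[of P c] that max_faceD[OF that assms] by (auto simp: not_less[symmetric])
  ultimately show "max_face P c = {v}"
    by blast
qed

lemma convex_open_normal_cone: "v \<in> P \<Longrightarrow> convex {c. max_face P c = {v}}"
proof -
  assume v: "v \<in> P"
  have "{c. max_face P c = {v}} = (\<Inter>y\<in>P - {v}. {c. (y - v) \<bullet> c < 0})"
    by (auto simp: max_face_singleton_iff[OF v] inner_diff_zero_iff)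
  then show ?thesis
    by (auto intro!: convex_INT convex_halfspace_lt)
qed

text \<open>Adding a small positive multiple of a functional exposing \<open>v\<close> makes
  \<open>v\<close> strictly optimal.\<close>

lemma closure_open_normal_cone:
  assumes P: "polytope P" and v: "v extreme_point_of P"
  shows "closure {c. max_face P c = {v}} = normal_cone P {v}"
proof
  have vP: "v \<in> P"
    using v by (simp add: extreme_point_of_def)
  have "closed (normal_cone P {v})"
  proof -
    have "normal_cone P {v} = (\<Inter>y\<in>P. {c. (y - v) \<bullet> c \<le> 0})"
      by (auto simp: normal_cone_def inner_diff_zero_iff)
    then show ?thesis
      by (auto intro!: closed_halfspace_le)
  qed
  moreover have "{c. max_face P c = {v}} \<subseteq> normal_cone P {v}"
    using vP by (auto simp: normal_cone_iff)
  ultimately show "closure {c. max_face P c = {v}} \<subseteq> normal_cone P {v}"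
    by (rule closure_minimal[rotated])
  obtain c0 where c0: "max_face P c0 = {v}"
    using extreme_max_face[OF P v] by blast
  show "normal_cone P {v} \<subseteq> closure {c. max_face P c = {v}}"
  proof
    fix c assume c: "c \<in> normal_cone P {v}"
    show "c \<in> closure {c. max_face P c = {v}}"
      unfolding closure_approachable
    proof (intro allI impI)
      fix e :: real assume e: "e > 0"
      define t where "t = e / (norm c0 + 1)"
      have t: "t > 0"
        using e by (simp add: t_def add_nonneg_pos)
      have "t * norm c0 < t * (norm c0 + 1)"
        using t by simp
      also have "\<dots> = e"
      proof -
        have "norm c0 + 1 \<noteq> 0"
          using norm_ge_zero[of c0] by linarith
        then show ?thesis
          by (simp add: t_def)
      qed
      finally have "dist (c + t *\<^sub>R c0) c < e"
        using t by (simp add: dist_norm)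
      moreover have "(c + t *\<^sub>R c0) \<bullet> y < (c + t *\<^sub>R c0) \<bullet> v" if "y \<in> P - {v}" for y
      proof -
        have "c \<bullet> y \<le> c \<bullet> v"
          using c that by (auto simp: normal_cone_def)
        moreover have "t * (c0 \<bullet> y) < t * (c0 \<bullet> v)"
          using max_face_strict[OF c0] that t by simp
        ultimately show ?thesis
          by (simp add: inner_add_left)
      qed
      then have "max_face P (c + t *\<^sub>R c0) = {v}"
        by (simp add: max_face_singleton_iff[OF vP])
      ultimately show "\<exists>y\<in>{c. max_face P c = {v}}. dist y c < e"
        by blast
    qed
  qed
qed

text \<open>The complement of the hyperplanes orthogonal to the edges consists of the functionals
  exposing a vertex, and its connected components are told apart by that vertex.\<close>

theorem beltlike_imp_belt_polytope:
  assumes P: "polytope P" "P \<noteq> {}" and belt: "beltlike P"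
  shows "belt_polytope P"
proof -
  define H where "H = (\<lambda>w. {x. w \<bullet> x = 0}) ` {w. \<exists>v. edge_vec P v w}"
  have fin: "finite H"
    using finite_edge_vecs[OF P(1)] by (simp add: H_def)
  have lin: "\<forall>h\<in>H. linear_hyperplane h"
    using edge_vec_ne by (force simp: H_def linear_hyperplane_def)
  define S where "S = UNIV - \<Union>H"
  have S: "c \<in> S \<longleftrightarrow> (\<exists>v. max_face P c = {v})" for c
  proof
    assume "c \<in> S"
    then have "c \<bullet> w \<noteq> 0" if "edge_vec P v w" for v w
      using that by (auto simp: S_def H_def inner_commute)
    then show "\<exists>v. max_face P c = {v}"
      using no_edge_imp_singleton[OF P] by blast
  next
    assume "\<exists>v. max_face P c = {v}"
    then show "c \<in> S"
      using beltlike_generic[OF belt] by (force simp: S_def H_def inner_commute)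
  qed
  have sub: "C \<subseteq> {c. max_face P c = {v}}" if "connected C" "C \<subseteq> S" "c \<in> C" "max_face P c = {v}" for C c v
    using max_face_const_on_connected[OF P that(1,3,4)] that(2) S by blast
  have comp: "{c. max_face P c = {v}} \<in> components S" if v: "v extreme_point_of P" for v
  proof -
    obtain c where c: "max_face P c = {v}"
      using extreme_max_face[OF P(1) v] by blast
    have "connected {c. max_face P c = {v}}"
      using v convex_open_normal_cone convex_connected by (auto simp: extreme_point_of_def)
    moreover have "{c. max_face P c = {v}} \<subseteq> S"
      using S by blast
    moreover have "D = {c. max_face P c = {v}}"
      if "{c. max_face P c = {v}} \<subseteq> D" "D \<subseteq> S" "connected D" for D
      using sub[OF that(3,2), of c v] that(1) c by blast
    ultimately show ?thesis
      unfolding in_components_maximal using c by blast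
  qed
  have comp': "\<exists>v. v extreme_point_of P \<and> C = {c. max_face P c = {v}}" if C: "C \<in> components S" for C
  proof -
    obtain c where c: "c \<in> C" "c \<in> S"
      using C in_components_nonempty in_components_subset by fastforce
    then obtain v where v: "max_face P c = {v}"
      using S by blast
    then have v': "v extreme_point_of P"
      using max_face_singleton_extreme P(1) by blast
    have "C \<inter> {c. max_face P c = {v}} \<noteq> {}"
      using c v by blast
    then have "C = {c. max_face P c = {v}}"
      using components_nonoverlap[OF C comp[OF v']] by blast
    then show ?thesis
      using v' by blast
  qed
  have "normal_fan P = arrangement_fan H"
  proof (intro equalityI subsetI)
    fix N assume "N \<in> normal_fan P"
    then obtain F where F: "F face_of P" "F \<noteq> {}" "N = normal_cone P F"
      by (auto simp: normal_fan_def)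
    obtain v where v: "v extreme_point_of F"
      using polytope_extreme_ne[OF face_of_polytope_polytope[OF P(1) F(1)] F(2)] by blast
    then have v': "v extreme_point_of P" "v \<in> F"
      using extreme_point_of_face[OF F(1)] by auto
    have "N face_of closure {c. max_face P c = {v}}"
      unfolding closure_open_normal_cone[OF P(1) v'(1)] F(3) by (rule normal_cone_face[OF P(1) F(1) v'(2)])
    moreover have "0 \<in> N"
      by (simp add: F(3) normal_cone_def)
    ultimately show "N \<in> arrangement_fan H"
      unfolding arrangement_fan_def using comp[OF v'(1)] unfolding S_def by blast
  next
    fix N assume "N \<in> arrangement_fan H"
    then obtain C where C: "N \<noteq> {}" "C \<in> components S" "N face_of closure C"
      unfolding arrangement_fan_def S_def by blast
    then obtain v where v: "v extreme_point_of P" "C = {c. max_face P c = {v}}"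
      using comp' by blast
    have N: "N face_of normal_cone P {v}"
      using C(3) unfolding v(2) closure_open_normal_cone[OF P(1) v(1)] .
    obtain c where c: "c \<in> rel_interior N"
      using C(1) rel_interior_eq_empty[OF face_of_imp_convex[OF N]] by blast
    then have "c \<in> normal_cone P {v}"
      using rel_interior_subset face_of_imp_subset[OF N] by blast
    then have vG: "v \<in> max_face P c"
      using v(1) by (simp add: normal_cone_iff extreme_point_of_def)
    have G: "max_face P c face_of P"
      using P(1) max_face_face polytope_imp_convex by blast
    \<comment> \<open>Both are faces of the cone at \<open>v\<close> with \<open>c\<close> in their
      relative interiors, so they are equal.\<close>
    have "N = normal_cone P (max_face P c)"
      using face_of_eq[OF N normal_cone_face[OF P(1) G vG]] c rel_interior_normal_cone[OF P, of c] by blast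
    then show "N \<in> normal_fan P"
      using G vG by (auto simp: normal_fan_def)
  qed
  then show ?thesis
    unfolding belt_polytope_def using P(1) fin lin by blast
qed

text \<open>Induction over the normals in \<open>A\<close>: along a vector \<open>z\<close> not
  orthogonal to the new one, each normal forbids at most one nonzero parameter, so arbitrarily small
  admissible ones remain.\<close>

lemma generic_near:
  fixes T :: "'a::euclidean_space set"
  assumes T: "subspace T" "d \<in> T" and A: "finite A"
    and nz: "\<And>a. a \<in> A \<Longrightarrow> \<exists>z\<in>T. a \<bullet> z \<noteq> 0" and e: "e > 0"
  shows "\<exists>c\<in>T. dist c d < e \<and> (\<forall>a\<in>A. a \<bullet> c \<noteq> 0)"
  using A nz e
proof (induction A arbitrary: e rule: finite_induct)
  case empty
  then show ?case
    using T by (intro bexI[of _ d]) auto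
next
  case (insert b A)
  then obtain c where c: "c \<in> T" "dist c d < e / 2" "\<forall>a\<in>A. a \<bullet> c \<noteq> 0"
    using insert.IH[of "e / 2"] by auto
  obtain z where z: "z \<in> T" "b \<bullet> z \<noteq> 0"
    using insert.prems(1) by blast
  have "finite (\<Union>a\<in>insert b A. {s. s \<noteq> 0 \<and> a \<bullet> (c + s *\<^sub>R z) = 0})"
  proof (intro finite_UN_I)
    fix a assume a: "a \<in> insert b A"
    have "{s. s \<noteq> 0 \<and> a \<bullet> (c + s *\<^sub>R z) = 0} \<subseteq> {- (a \<bullet> c) / (a \<bullet> z)}"
    proof
      fix s assume "s \<in> {s. s \<noteq> 0 \<and> a \<bullet> (c + s *\<^sub>R z) = 0}"
      then have s: "a \<bullet> c + s * (a \<bullet> z) = 0"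
        by (simp add: inner_add_right)
      then have "a \<bullet> z \<noteq> 0"
        using a c(3) z(2) by auto
      then show "s \<in> {- (a \<bullet> c) / (a \<bullet> z)}"
        using s by (simp add: field_simps)
    qed
    then show "finite {s. s \<noteq> 0 \<and> a \<bullet> (c + s *\<^sub>R z) = 0}"
      using finite_subset by blast
  qed (use insert.hyps in simp)
  moreover have zne: "norm z > 0"
    using z by auto
  then have "infinite {0<..<e / (2 * norm z)}"
    using insert.prems(2) by (intro infinite_Ioo) simp
  ultimately obtain s where s: "s \<in> {0<..<e / (2 * norm z)}"
      "s \<notin> (\<Union>a\<in>insert b A. {s. s \<noteq> 0 \<and> a \<bullet> (c + s *\<^sub>R z) = 0})"
    by (meson finite_subset subsetI)
  have "dist (c + s *\<^sub>R z) d \<le> dist (c + s *\<^sub>R z) c + dist c d"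
    by (rule dist_triangle)
  also have "dist (c + s *\<^sub>R z) c = s * norm z"
    using s(1) by (simp add: dist_norm)
  also have "\<dots> < e / 2"
    using s(1) zne by (simp add: field_simps)
  finally have "dist (c + s *\<^sub>R z) d < e"
    using c(2) by simp
  moreover have "c + s *\<^sub>R z \<in> T"
    using T(1) c(1) z(1) by (simp add: subspace_add subspace_scale)
  ultimately show ?case
    using s by auto
qed

text \<open>Otherwise \<open>a\<close> would be orthogonal to its own component orthogonal to
  \<open>w\<close>, which would then vanish, making \<open>a\<close> a multiple of
  \<open>w\<close>.\<close>

lemma hyperplane_perp_ex:
  fixes a w :: "'a::euclidean_space"
  assumes "a \<noteq> 0" "w \<noteq> 0" "{x. a \<bullet> x = 0} \<noteq> {x. w \<bullet> x = 0}"
  shows "\<exists>z. w \<bullet> z = 0 \<and> a \<bullet> z \<noteq> 0"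
proof (rule ccontr)
  assume "\<not> ?thesis"
  then have *: "w \<bullet> z = 0 \<Longrightarrow> a \<bullet> z = 0" for z
    by blast
  define t where "t = (w \<bullet> a) / (w \<bullet> w)"
  have "w \<bullet> (a - t *\<^sub>R w) = 0"
    using assms(2) by (simp add: t_def inner_diff_right)
  then have "a \<bullet> (a - t *\<^sub>R w) = 0" "w \<bullet> (a - t *\<^sub>R w) = 0"
    using * by blast+
  then have "(a - t *\<^sub>R w) \<bullet> (a - t *\<^sub>R w) = 0"
    by (simp only: inner_diff_left inner_scaleR_left)
  then have "a = t *\<^sub>R w"
    by simp
  then show False
    using assms by auto
qed

text \<open>On a component, the linear form of each hyperplane takes values in an interval without
  0, so it does not vanish on segments between points of the component.\<close>

lemma arrangement_component:
  fixes H :: "'a::euclidean_space set set"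
  assumes "finite H" "\<And>h. h \<in> H \<Longrightarrow> linear_hyperplane h" and C: "C \<in> components (UNIV - \<Union>H)"
  shows "open C" "convex C"
proof -
  have closed: "closed h" if "h \<in> H" for h
    using assms(2)[OF that] closed_hyperplane by (auto simp: linear_hyperplane_def)
  then have "open (UNIV - \<Union>H)"
    using assms(1) by (intro open_Diff closed_Union) auto
  then show "open C"
    using C open_components by blast
  show "convex C"
    unfolding convex_contains_segment
  proof (intro ballI)
    fix x y assume xy: "x \<in> C" "y \<in> C"
    have CS: "C \<subseteq> UNIV - \<Union>H" "connected C"
      using C in_components_subset in_components_connected by blast+
    have "closed_segment x y \<subseteq> UNIV - \<Union>H"
    proof (intro subsetI DiffI UNIV_I notI)
      fix z assume z': "z \<in> closed_segment x y" "z \<in> \<Union>H"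
      then obtain h where z: "z \<in> closed_segment x y" "h \<in> H" "z \<in> h"
        by blast
      obtain a where a: "h = {x. a \<bullet> x = 0}"
        using assms(2)[OF z(2)] by (auto simp: linear_hyperplane_def)
      have ne: "a \<bullet> p \<noteq> 0" if "p \<in> C" for p
        using CS(1) that z(2) a by blast
      have "connected ((\<lambda>p. a \<bullet> p) ` C)"
        by (intro connected_continuous_image CS continuous_intros)
      then have "is_interval ((\<lambda>p. a \<bullet> p) ` C)"
        by (simp add: is_interval_connected_1)
      moreover have "0 \<notin> (\<lambda>p. a \<bullet> p) ` C"
        using ne by auto
      ultimately have "closed_segment (a \<bullet> x) (a \<bullet> y) \<subseteq> - {0}"
        using closed_segment_subset[OF imageI[OF xy(1)] imageI[OF xy(2)] is_interval_convex] by blast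
      moreover have "a \<bullet> z \<in> closed_segment (a \<bullet> x) (a \<bullet> y)"
      proof -
        obtain u where "0 \<le> u" "u \<le> 1" "z = (1 - u) *\<^sub>R x + u *\<^sub>R y"
          using z(1) by (auto simp: closed_segment_def)
        then show ?thesis
          by (auto simp: closed_segment_def inner_add_right)
      qed
      ultimately show False
        using z(3) a by auto
    qed
    moreover obtain p where p: "p \<in> UNIV - \<Union>H" "C = connected_component_set (UNIV - \<Union>H) p"
      using C by (auto simp: components_def)
    moreover have "connected_component_set (UNIV - \<Union>H) x = C"
      using p xy(1) connected_component_eq by metis
    ultimately show "closed_segment x y \<subseteq> C"
      using connected_component_maximal[of x "closed_segment x y" "UNIV - \<Union>H"] by simp
  qed
qed

text \<open>Recovers from the fan which functionals expose a vertex. One direction uses that an open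
  convex set is the interior of its closure, the other that \<open>c\<close> can be moved within the
  open set \<open>C\<close> in every direction.\<close>

lemma fan_singleton_iff:
  fixes P :: "'a::euclidean_space set"
  assumes P: "polytope P" "P \<noteq> {}" and H: "finite H" "\<And>h. h \<in> H \<Longrightarrow> linear_hyperplane h"
    and fan: "normal_fan P = arrangement_fan H"
  shows "(\<exists>v. max_face P c = {v}) \<longleftrightarrow> c \<notin> \<Union>H"
proof
  assume "\<exists>v. max_face P c = {v}"
  then obtain v where v: "max_face P c = {v}"
    by blast
  have v': "v extreme_point_of P" "v \<in> P"
    using max_face_singleton_extreme[OF P(1) v] by (auto simp: extreme_point_of_def)
  have "normal_cone P {v} \<in> normal_fan P"
    using v'(1) by (auto simp: normal_fan_def face_of_singleton intro!: exI[of _ "{v}"])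
  then obtain C where C: "C \<in> components (UNIV - \<Union>H)" "normal_cone P {v} face_of closure C"
    unfolding fan arrangement_fan_def by blast
  have oc: "open C" "convex C"
    using arrangement_component[OF H C(1)] by auto
  have "{c. max_face P c = {v}} \<subseteq> closure C"
    using face_of_imp_subset[OF C(2)] v' by (auto simp: normal_cone_iff)
  then have "{c. max_face P c = {v}} \<subseteq> interior (closure C)"
    using open_normal_cone_interior[OF P] by (intro interior_maximal)
  also have "\<dots> = C"
    using oc convex_interior_closure interior_open by blast
  finally show "c \<notin> \<Union>H"
    using v in_components_subset[OF C(1)] by blast
next
  assume c: "c \<notin> \<Union>H"
  define C where "C = connected_component_set (UNIV - \<Union>H) c"
  have C: "C \<in> components (UNIV - \<Union>H)" "c \<in> C"
    using c by (auto simp: C_def components_def connected_component_refl)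
  have oc: "open C" "convex C"
    using arrangement_component[OF H C(1)] by auto
  then have "closure C \<in> arrangement_fan H"
    unfolding arrangement_fan_def using C face_of_refl[of "closure C"] by (auto simp: convex_closure closure_eq_empty)
  then obtain F where F: "F face_of P" "F \<noteq> {}" "closure C = normal_cone P F"
    unfolding fan[symmetric] normal_fan_def by blast
  have FP: "F \<subseteq> P"
    using F face_of_imp_subset by blast
  have CF: "F \<subseteq> max_face P d" if "d \<in> C" for d
    using that F(3) closure_subset normal_cone_iff[OF FP] by blast
  have push: "\<exists>s>0. c + s *\<^sub>R x \<in> C" for x
  proof -
    obtain e where e: "e > 0" "ball c e \<subseteq> C"
      using oc(1) C(2) open_contains_ball by blast
    define s where "s = e / (2 * (norm x + 1))"
    have pos: "norm x + 1 > 0"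
      by (simp add: add_nonneg_pos)
    then have s: "s > 0"
      using e by (simp add: s_def)
    have "s * norm x < s * (norm x + 1)"
      using s by simp
    also have "\<dots> = e / 2"
      using pos by (simp add: s_def field_simps)
    finally have "c + s *\<^sub>R x \<in> ball c e"
      using e s by (simp add: dist_norm)
    then show ?thesis
      using s e by blast
  qed
  obtain v where v: "v \<in> F"
    using F by blast
  have "y = v" if y: "y \<in> max_face P c" for y
  proof -
    \<comment> \<open>Pushing \<open>c\<close> along \<open>y - v\<close> favours \<open>y\<close>,
      yet \<open>v\<close> stays optimal throughout \<open>C\<close>; hence
      \<open>y = v\<close>.\<close>
    obtain s where s: "s > 0" "c + s *\<^sub>R (y - v) \<in> C"
      using push by blast
    have yP: "y \<in> P"
      using y max_face_subset by blast
    have "v \<in> max_face P (c + s *\<^sub>R (y - v))"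
      using CF[OF s(2)] v by blast
    then have "(c + s *\<^sub>R (y - v)) \<bullet> y \<le> (c + s *\<^sub>R (y - v)) \<bullet> v"
      using max_faceD yP by blast
    moreover have "c \<bullet> y = c \<bullet> v"
      using y CF[OF C(2)] v max_face_inner_eq by blast
    ultimately have "s * ((y - v) \<bullet> (y - v)) \<le> 0"
      by (simp add: inner_add_left inner_diff_right algebra_simps)
    then have "(y - v) \<bullet> (y - v) \<le> 0"
      using s(1) by (simp add: mult_le_0_iff)
    then have "y - v = 0"
      by (metis inner_eq_zero_iff inner_ge_zero order_antisym)
    then show ?thesis
      by simp
  qed
  moreover have "v \<in> max_face P c"
    using CF[OF C(2)] v by blast
  ultimately show "\<exists>v. max_face P c = {v}"
    by blast
qed

text \<open>Near a normal of an edge \<open>w\<close>, all of \<open>w\<^sup>\<bottom>\<close> is non-generic, so \<open>w\<^sup>\<bottom>\<close> is covered near that point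
  by the finitely many hyperplanes of the arrangement and hence is one of them.\<close>

lemma belt_polytope_edge_perp:
  fixes P :: "'a::euclidean_space set"
  assumes belt: "belt_polytope P" and e: "edge_vec P v w" and c: "c \<bullet> w = 0"
  shows "max_face P c \<noteq> {x}"
proof -
  obtain H where P: "polytope P" and H: "finite H" "\<And>h. h \<in> H \<Longrightarrow> linear_hyperplane h"
    and fan: "normal_fan P = arrangement_fan H"
    using belt by (auto simp: belt_polytope_def)
  have ne: "P \<noteq> {}"
    using edge_vec_mem[OF e] by blast
  note iff = fan_singleton_iff[OF P ne H fan]
  obtain d where d: "max_face P d = closed_segment v (v + w)" "d \<bullet> w = 0"
    using edge_as_max_face[OF P e] .
  obtain r where r: "r > 0" "\<And>d'. dist d' d < r \<Longrightarrow> max_face P d' \<subseteq> max_face P d"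
    using max_face_usc[OF P] by blast
  have w: "w \<noteq> 0"
    using e by (rule edge_vec_ne)
  have "{x. w \<bullet> x = 0} \<in> H"
  proof (rule ccontr)
    assume notin: "{x. w \<bullet> x = 0} \<notin> H"
    obtain n where n: "\<And>h. h \<in> H \<Longrightarrow> n h \<noteq> 0 \<and> h = {x. n h \<bullet> x = 0}"
      using H(2) unfolding linear_hyperplane_def by metis
    have "\<exists>z\<in>{x. w \<bullet> x = 0}. a \<bullet> z \<noteq> 0" if a: "a \<in> n ` H" for a
    proof -
      obtain h where h: "h \<in> H" "a = n h"
        using a by blast
      then have "{x. a \<bullet> x = 0} \<in> H" "a \<noteq> 0"
        using n[OF h(1)] by auto
      then have "\<exists>z. w \<bullet> z = 0 \<and> a \<bullet> z \<noteq> 0"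
        using notin w by (intro hyperplane_perp_ex) metis+
      then show ?thesis
        by blast
    qed
    \<comment> \<open>\<open>c'\<close> is orthogonal to \<open>w\<close> but avoids the
      arrangement, and it is so close to \<open>d\<close> that it exposes only points of the
      edge.\<close>
    then obtain c' where c': "w \<bullet> c' = 0" "dist c' d < r" "\<forall>a\<in>n ` H. a \<bullet> c' \<noteq> 0"
      using generic_near[OF subspace_hyperplane, of d w "n ` H" r] d(2) H(1) r(1)
      by (auto simp: inner_commute)
    have "c' \<notin> \<Union>H"
      using c'(3) n by blast
    then obtain y where y: "max_face P c' = {y}"
      using iff by blast
    then have "y \<in> closed_segment v (v + w)"
      using r(2)[OF c'(2)] d(1) by auto
    then obtain s where s: "y = v + s *\<^sub>R w"
      by (auto simp: closed_segment_def algebra_simps)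
    have "y \<in> max_face P c'"
      using y by blast
    moreover have "c' \<bullet> (v + w) = c' \<bullet> y" "c' \<bullet> v = c' \<bullet> y"
      using c'(1) by (auto simp: s inner_add_right inner_commute)
    ultimately have "v \<in> max_face P c'" "v + w \<in> max_face P c'"
      using edge_vec_mem[OF e] by (auto simp: max_face_eq_hyperplane)
    then show False
      using y w by auto
  qed
  moreover have "c \<in> {x. w \<bullet> x = 0}"
    using c by (simp add: inner_commute)
  ultimately show ?thesis
    using iff[of c] by blast
qed

text \<open>A small multiple of \<open>n\<close> added to a functional exposing \<open>F\<close>
  exposes in \<open>P\<close> what \<open>n\<close> exposes in \<open>F\<close>, and both summands
  are orthogonal to \<open>w\<close>.\<close>

lemma belt_polytope_face_edge_perp:
  fixes P :: "'a::euclidean_space set"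
  assumes belt: "belt_polytope P" and F: "F face_of P" and e: "edge_vec F v w" and n: "n \<bullet> w = 0"
  shows "max_face F n \<noteq> {x}"
proof -
  have P: "polytope P" "P \<noteq> {}"
    using belt edge_vec_mem[OF edge_vec_face[OF F e]] by (auto simp: belt_polytope_def)
  have "F \<noteq> {}"
    using edge_vec_mem[OF e] by blast
  then obtain c0 where c0: "F = max_face P c0"
    using face_eq_max_face[OF P(1) F] by blast
  obtain e0 where e0: "e0 > 0" "\<And>s. 0 < s \<Longrightarrow> s < e0 \<Longrightarrow> max_face P (c0 + s *\<^sub>R n) = max_face F n"
    using max_face_perturb[OF P, of c0 n] c0 by blast
  have "max_face P (c0 + (e0/2) *\<^sub>R n) = max_face F n"
    using e0 by simp
  moreover have "(c0 + (e0/2) *\<^sub>R n) \<bullet> w = 0"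
    using edge_vec_max_face[of P c0 v w] e c0 n by (simp add: inner_add_left)
  ultimately show ?thesis
    using belt_polytope_edge_perp[OF belt edge_vec_face[OF F e]] by metis
qed

lemma affine_parallel_segments:
  fixes w :: "'a::euclidean_space"
  assumes "s \<noteq> 0"
  shows "affine_parallel (affine hull closed_segment v (v + w)) (affine hull closed_segment v' (v' + s *\<^sub>R w))"
proof -
  have "range (\<lambda>t. v' + t *\<^sub>R (s *\<^sub>R w)) = (\<lambda>x. (v' - v) + x) ` range (\<lambda>t. v + t *\<^sub>R w)"
  proof (intro equalityI subsetI)
    fix x assume "x \<in> range (\<lambda>t. v' + t *\<^sub>R (s *\<^sub>R w))"
    then obtain t where t: "x = v' + t *\<^sub>R (s *\<^sub>R w)"
      by blast
    show "x \<in> (\<lambda>x. (v' - v) + x) ` range (\<lambda>t. v + t *\<^sub>R w)"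
      by (rule image_eqI[OF _ rangeI[of _ "t * s"]]) (simp add: t)
  next
    fix x assume "x \<in> (\<lambda>x. (v' - v) + x) ` range (\<lambda>t. v + t *\<^sub>R w)"
    then obtain t where t: "x = (v' - v) + (v + t *\<^sub>R w)"
      by blast
    show "x \<in> range (\<lambda>t. v' + t *\<^sub>R (s *\<^sub>R w))"
      by (rule range_eqI[of _ _ "t / s"]) (use assms t in simp)
  qed
  then show ?thesis
    unfolding affine_parallel_def affine_hull_segment by blast
qed

section \<open>The cyclic order of the edges of a polygon\<close>

text \<open>The outer normals of the edges are the vectors \<open>\<plusminus>(e\<^sub>1 + t e\<^sub>2)\<close> for finitely many slopes \<open>t\<close>,
  where \<open>e\<^sub>2\<close> is orthogonal to no edge. Listing them by increasing \<open>t\<close>, first with sign \<open>+\<close> and then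
  with sign \<open>-\<close>, is the cyclic order. Consecutive edges share a vertex because no normal lies
  between theirs; the two changes of sign pass through \<open>\<plusminus>e\<^sub>2\<close>.\<close>

lemma opposite_edges_imp_belt_polygon:
  fixes Q :: "'a::euclidean_space set"
  assumes Q: "polytope Q" "aff_dim Q = 2"
    and perp: "\<And>v w c x. edge_vec Q v w \<Longrightarrow> c \<bullet> w = 0 \<Longrightarrow> max_face Q c \<noteq> {x}"
  shows "belt_polygon Q"
proof -
  have ne: "Q \<noteq> {}"
    using Q(2) by auto
  have "Q \<noteq> {x}" for x
    using Q(2) by auto
  then obtain v0 w0 where w0: "edge_vec Q v0 w0"
    using polytope_has_edge[OF Q(1) ne] by blast
  define W where "W = {w. \<exists>v. edge_vec Q v w}"
  have W: "finite W" "W \<subseteq> dirs Q" "0 \<notin> W"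
    using finite_edge_vecs[OF Q(1)] edge_vec_dirs edge_vec_ne unfolding W_def by blast+
  have "\<exists>z\<in>dirs Q. a \<bullet> z \<noteq> 0" if "a \<in> W" for a
  proof -
    have "a \<bullet> a \<noteq> 0"
      using that W(3) by auto
    then show ?thesis
      using that W(2) by blast
  qed
  then have "\<exists>c\<in>dirs Q. dist c 0 < 1 \<and> (\<forall>a\<in>W. a \<bullet> c \<noteq> 0)"
    by (intro generic_near subspace_dirs subspace_0 W(1)) auto
  then obtain e2 where e2: "e2 \<in> dirs Q" "\<And>w. w \<in> W \<Longrightarrow> w \<bullet> e2 \<noteq> 0"
    by blast
  have e2W: "e2 \<bullet> w \<noteq> 0" if "edge_vec Q v w" for v w
    using e2(2)[of w] that by (auto simp: W_def inner_commute)
  have e2ne: "e2 \<noteq> 0"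
    using e2W[OF w0] by auto
  have "dim (dirs Q) = 2"
    using aff_dim_dirs[OF ne] Q(2) by simp
  then have "\<not> dirs Q \<subseteq> span {e2}"
    using dim_subset[of "dirs Q" "span {e2}"] e2ne by (auto simp: dim_singleton)
  then obtain e1 where e1: "e1 \<in> dirs Q" "e1 \<notin> span {e2}"
    by blast
  \<comment> \<open>As \<open>t\<close> runs over the reals, the direction of \<open>c t\<close>
    sweeps the open half-circle from \<open>- e2\<close> to \<open>e2\<close>.\<close>
  define c where "c t = e1 + t *\<^sub>R e2" for t
  have c_dirs: "c t \<in> dirs Q" for t
    unfolding c_def by (intro subspace_add[OF subspace_dirs] subspace_scale[OF subspace_dirs] e1 e2)
  have c_ne: "c t \<noteq> 0" for t
  proof
    assume "c t = 0"
    then have "e1 = (- t) *\<^sub>R e2"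
      by (simp add: c_def eq_neg_iff_add_eq_0)
    then show False
      using e1(2) by (simp add: span_base span_scale span_neg)
  qed
  have c_inner: "c t \<bullet> w = e1 \<bullet> w + t * (e2 \<bullet> w)" for t w
    by (simp add: c_def inner_add_left)
  define T where "T = (\<lambda>w. - (e1 \<bullet> w) / (e2 \<bullet> w)) ` W"
  have finT: "finite T"
    using W(1) by (simp add: T_def)
  have slope: "t = - (e1 \<bullet> w) / (e2 \<bullet> w) \<longleftrightarrow> c t \<bullet> w = 0" if "edge_vec Q v w" for t v w
    using e2W[OF that] by (simp add: c_inner field_simps add_eq_0_iff)
  have slopeT: "t \<in> T" if "edge_vec Q v w" "c t \<bullet> w = 0" for t v w
    using slope[OF that(1), of t] that by (auto simp: T_def W_def)
  define M where "M r t = max_face Q (r *\<^sub>R c t)" for r t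
  have M_face: "M r t face_of Q" for r t
    unfolding M_def using Q(1) max_face_face polytope_imp_convex by blast
  have M_sing: "\<exists>x. M r t = {x}" if "r \<noteq> 0" "t \<notin> T" for r t
    unfolding M_def using slopeT that by (intro no_edge_imp_singleton[OF Q(1) ne]) auto
  \<comment> \<open>Here \<open>perp\<close> enters: both signs of \<open>r\<close> give an edge,
    not only the sign belonging to the edge from which \<open>t\<close> comes.\<close>
  have M_edge: "M r t edge_of Q" if r: "r \<noteq> 0" and t: "t \<in> T" for r t
  proof -
    obtain v w where vw: "edge_vec Q v w" "t = - (e1 \<bullet> w) / (e2 \<bullet> w)"
      using t by (auto simp: T_def W_def)
    then have "(r *\<^sub>R c t) \<bullet> w = 0"
      using slope by simp
    then have "M r t \<noteq> {x}" for x
      unfolding M_def using perp[OF vw(1)] by blast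
    moreover have "M r t \<noteq> {}"
      unfolding M_def using max_face_ne[OF Q(1) ne] .
    moreover have "aff_dim (M r t) < 2"
      using max_face_aff_dim_less[OF Q(1), of "r *\<^sub>R c t"] c_dirs c_ne r Q(2)
      by (simp add: M_def subspace_scale[OF subspace_dirs])
    ultimately have "aff_dim (M r t) = 1"
      using aff_dim_negative_iff[of "M r t"] aff_dim_eq_0[of "M r t"] by (smt (verit))
    then show ?thesis
      using M_face by (simp add: edge_of_def)
  qed
  have M_vec: "\<exists>v w. edge_vec Q v w \<and> M r t = closed_segment v (v + w) \<and> c t \<bullet> w = 0"
    if r: "r \<noteq> 0" and t: "t \<in> T" for r t
  proof -
    obtain v w where vw: "edge_vec Q v w" "M r t = closed_segment v (v + w)"
      using edge_of_imp_edge_vec[OF Q(1) M_edge[OF r t]] by blast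
    have "edge_vec (M r t) v w"
      using edge_vec_face_iff[OF M_face, of r t v w] vw(1) ends_in_segment unfolding vw(2) by blast
    then have "(r *\<^sub>R c t) \<bullet> w = 0"
      unfolding M_def by (rule edge_vec_max_face)
    then show ?thesis
      using vw r by auto
  qed
  have M_inj_t: "t = t'" if eq: "M r t = M r' t'" and rt: "r \<noteq> 0" "r' \<noteq> 0" "t \<in> T" "t' \<in> T" for r r' t t'
  proof -
    obtain v w where vw: "edge_vec Q v w" "M r t = closed_segment v (v + w)" "c t \<bullet> w = 0"
      using M_vec[OF rt(1,3)] by blast
    have "edge_vec (M r t) v w"
      using edge_vec_face_iff[OF M_face, of r t v w] vw(1) ends_in_segment unfolding vw(2) by blast
    then have "edge_vec (M r' t') v w"
      by (simp only: eq)
    then have "(r' *\<^sub>R c t') \<bullet> w = 0"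
      unfolding M_def by (rule edge_vec_max_face)
    then show ?thesis
      using slope[OF vw(1)] vw(3) rt(2) by (metis inner_scaleR_left mult_eq_0_iff)
  qed
  have M_pm: "M 1 t \<noteq> M (- 1) t" for t
  proof
    assume eq: "M 1 t = M (- 1) t"
    obtain x where "x \<in> M 1 t"
      unfolding M_def using max_face_ne[OF Q(1) ne] by blast
    then have "x \<in> max_face Q (c t)" "x \<in> max_face Q (- c t)"
      using eq by (simp_all add: M_def)
    then have "c t \<bullet> y = c t \<bullet> x" if "y \<in> Q" for y
      using max_faceD[of x Q "c t"] max_faceD[of x Q "- c t"] that by fastforce
    then have "c t \<bullet> (y - z) = 0" if "y \<in> Q" "z \<in> Q" for y z
      using that by (simp add: inner_diff_right)
    then show False
      using const_on_dirs_zero[OF c_dirs] c_ne by blast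
  qed
  have edges: "\<exists>t\<in>T. e = M 1 t \<or> e = M (- 1) t" if e: "e edge_of Q" for e
  proof -
    obtain v w where vw: "edge_vec Q v w" "e = closed_segment v (v + w)"
      using edge_of_imp_edge_vec[OF Q(1) e] by blast
    define t where "t = - (e1 \<bullet> w) / (e2 \<bullet> w)"
    have t: "c t \<bullet> w = 0" "t \<in> T"
      using slope[OF vw(1)] slopeT[OF vw(1)] t_def by auto
    have "max_face Q (c t) \<noteq> Q"
      using max_face_aff_dim_less[OF Q(1) c_dirs c_ne, of t] by auto
    from polygon_edge_max_face[OF Q vw(1) t(1) this] show ?thesis
      using t(2) vw(2) by (auto simp: M_def)
  qed
  have M_par: "affine_parallel (affine hull M 1 t) (affine hull M (- 1) t)" if t: "t \<in> T" for t
  proof -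
    obtain v w where vw: "edge_vec Q v w" "M 1 t = closed_segment v (v + w)" "c t \<bullet> w = 0"
      using M_vec[OF _ t, of 1] by auto
    obtain v' w' where v'w': "edge_vec Q v' w'" "M (- 1) t = closed_segment v' (v' + w')" "c t \<bullet> w' = 0"
      using M_vec[OF _ t, of "- 1"] by auto
    have "c t \<notin> span {w}"
    proof
      assume "c t \<in> span {w}"
      then obtain s where s: "c t = s *\<^sub>R w"
        by (auto simp: span_singleton)
      have "c t \<bullet> c t = s * (c t \<bullet> w)"
        by (subst (2) s) simp
      then show False
        using vw(3) c_ne[of t] by simp
    qed
    then have "w' \<in> span {w, c t}"
      using dirs_plane[OF Q(2) edge_vec_dirs[OF vw(1)] c_dirs edge_vec_ne[OF vw(1)]] edge_vec_dirs[OF v'w'(1)]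
      by simp
    then obtain X Y where XY: "w' = X *\<^sub>R w + Y *\<^sub>R c t"
      by (rule span_pairE)
    have "Y * (c t \<bullet> c t) = 0"
      using v'w'(3) vw(3) by (simp add: XY inner_add_right)
    then have "Y = 0"
      using c_ne[of t] by simp
    then have w': "w' = X *\<^sub>R w" "X \<noteq> 0"
      using XY edge_vec_ne[OF v'w'(1)] by auto
    show ?thesis
      unfolding vw(2) v'w'(2) w'(1) by (rule affine_parallel_segments[OF w'(2)])
  qed
  have adj: "M r t \<inter> M r t' \<noteq> {}" if r: "r \<noteq> 0" and tt: "t < t'" "\<And>s. t < s \<Longrightarrow> s < t' \<Longrightarrow> s \<notin> T" for r t t'
  proof -
    have "\<exists>x. max_face Q ((1 - s) *\<^sub>R (r *\<^sub>R c t) + s *\<^sub>R (r *\<^sub>R c t')) = {x}" if s: "0 < s" "s < 1" for s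
    proof -
      have "(1 - s) *\<^sub>R (r *\<^sub>R c t) + s *\<^sub>R (r *\<^sub>R c t') = r *\<^sub>R c (t + s * (t' - t))"
        by (simp add: c_def algebra_simps)
      moreover have "t + s * (t' - t) < t + 1 * (t' - t)"
        using s tt(1) by (intro add_strict_left_mono mult_strict_right_mono) auto
      then have "t + s * (t' - t) \<notin> T"
        using s tt(1) tt(2)[of "t + s * (t' - t)"] by simp
      ultimately show ?thesis
        using M_sing[OF r] by (simp add: M_def)
    qed
    then show ?thesis
      using max_face_segment_const[OF Q(1) ne, of "r *\<^sub>R c t" "r *\<^sub>R c t'"] unfolding M_def by blast
  qed
  \<comment> \<open>Divided by \<open>(1 - s) * r\<close>, the functional at parameter
    \<open>s\<close> between the two ends is \<open>c (t + s / (1 - s) * (q / r))\<close>, whose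
    slope starts at \<open>t\<close> and, for nonzero \<open>q\<close>, tends to infinity with the
    sign of \<open>q / r\<close>.\<close>
  have end_gen: "M r t \<inter> max_face Q (q *\<^sub>R e2) \<noteq> {}"
    if r: "r \<noteq> 0" and tt: "\<And>s. s > 0 \<Longrightarrow> t + s * (q / r) \<notin> T" for r t q
  proof -
    have "\<exists>x. max_face Q ((1 - s) *\<^sub>R (r *\<^sub>R c t) + s *\<^sub>R (q *\<^sub>R e2)) = {x}" if s: "0 < s" "s < 1" for s
    proof -
      have "((1 - s) * r) *\<^sub>R c (t + s / (1 - s) * (q / r))
          = ((1 - s) * r) *\<^sub>R (e1 + t *\<^sub>R e2) + (((1 - s) * r) * (s / (1 - s) * (q / r))) *\<^sub>R e2"
        by (simp add: c_def scaleR_add_right scaleR_add_left algebra_simps)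
      also have "((1 - s) * r) * (s / (1 - s) * (q / r)) = s * q"
        using s r by simp
      finally have "(1 - s) *\<^sub>R (r *\<^sub>R c t) + s *\<^sub>R (q *\<^sub>R e2) = ((1 - s) * r) *\<^sub>R c (t + s / (1 - s) * (q / r))"
        by (simp add: c_def)
      moreover have "t + s / (1 - s) * (q / r) \<notin> T"
        using s by (intro tt) simp
      moreover have "(1 - s) * r \<noteq> 0"
        using s r by simp
      ultimately show ?thesis
        using M_sing[of "(1 - s) * r"] unfolding M_def by metis
    qed
    then show ?thesis
      using max_face_segment_const[OF Q(1) ne, of "r *\<^sub>R c t" "q *\<^sub>R e2"] unfolding M_def by blast
  qed
  have e2_sing: "\<exists>x. max_face Q (q *\<^sub>R e2) = {x}" if "q \<noteq> 0" for q
    using e2W that by (intro no_edge_imp_singleton[OF Q(1) ne]) auto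
  \<comment> \<open>For \<open>r e2\<close> the exposed face is a vertex, and this vertex lies on
    the last edge of one half-circle and the first of the other.\<close>
  have turn: "M r t \<inter> M (- r) t' \<noteq> {}"
    if r: "r = 1 \<or> r = - 1" and t: "\<And>s. s > t \<Longrightarrow> s \<notin> T" and t': "\<And>s. s < t' \<Longrightarrow> s \<notin> T" for r t t'
  proof -
    obtain x where x: "max_face Q (r *\<^sub>R e2) = {x}"
      using e2_sing[of r] r by auto
    have "M r t \<inter> max_face Q (r *\<^sub>R e2) \<noteq> {}"
      using r t by (intro end_gen) auto
    moreover have "M (- r) t' \<inter> max_face Q (r *\<^sub>R e2) \<noteq> {}"
      using r t' by (intro end_gen) auto
    ultimately show ?thesis
      unfolding x by blast
  qed
  define k where "k = card T"
  define ts where "ts = sorted_list_of_set T"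
  have ts: "sorted_wrt (<) ts" "set ts = T" "length ts = k"
    using finT by (simp_all add: ts_def k_def)
  have ts_T: "ts ! i \<in> T" if "i < k" for i
    using that ts nth_mem by metis
  have ts_less: "ts ! i < ts ! j" if "i < j" "j < k" for i j
    using sorted_wrt_nth_less[OF ts(1)] that ts(3) by simp
  have ts_ex: "\<exists>i<k. t = ts ! i" if "t \<in> T" for t
    using that ts by (metis in_set_conv_nth)
  have ts_inj: "i = j" if "ts ! i = ts ! j" "i < k" "j < k" for i j
    using ts_less[of i j] ts_less[of j i] that by (metis less_irrefl nat_neq_iff)
  have ts_gap: "s \<notin> T" if "ts ! i < s" "s < ts ! Suc i" "Suc i < k" for i s
  proof
    assume "s \<in> T"
    then obtain j where j: "j < k" "s = ts ! j"
      using ts_ex by blast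
    show False
    proof (cases "j \<le> i")
      case True
      then have "ts ! j \<le> ts ! i"
        using ts_less[of j i] that(3) by (cases "j = i") auto
      then show False
        using that(1) j(2) by simp
    next
      case False
      then have "ts ! Suc i \<le> ts ! j"
        using ts_less[of "Suc i" j] j(1) by (cases "j = Suc i") auto
      then show False
        using that(2) j(2) by simp
    qed
  qed
  have ts_last: "s \<notin> T" if "s > ts ! (k - 1)" for s
  proof
    assume "s \<in> T"
    then obtain j where j: "j < k" "s = ts ! j"
      using ts_ex by blast
    then have "j = k - 1 \<or> j < k - 1 \<and> k - 1 < k"
      by linarith
    then have "ts ! j \<le> ts ! (k - 1)"
      using ts_less[of j "k - 1"] by (metis less_imp_le order_refl)
    then show False
      using that j by simp
  qed
  have ts_first: "s \<notin> T" if "s < ts ! 0" for s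
  proof
    assume "s \<in> T"
    then obtain j where j: "j < k" "s = ts ! j"
      using ts_ex by blast
    then have "ts ! 0 \<le> ts ! j"
      using ts_less[of 0 j] by (cases "j = 0") auto
    then show False
      using that j by simp
  qed
  define E where "E i = (if i < k then M 1 (ts ! i) else M (- 1) (ts ! (i - k)))" for i
  have "bij_betw E {..<2 * k} {e. e edge_of Q}"
    unfolding bij_betw_def
  proof
    show "inj_on E {..<2 * k}"
    proof (rule inj_onI)
      fix i j assume ij: "i \<in> {..<2 * k}" "j \<in> {..<2 * k}" "E i = E j"
      define i' where "i' = (if i < k then i else i - k)"
      define j' where "j' = (if j < k then j else j - k)"
      have ij': "i' < k" "j' < k"
        using ij(1,2) by (auto simp: i'_def j'_def)
      have "E i = M (if i < k then 1 else - 1) (ts ! i')" "E j = M (if j < k then 1 else - 1) (ts ! j')"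
        by (auto simp: E_def i'_def j'_def)
      then have eq: "M (if i < k then 1 else - 1) (ts ! i') = M (if j < k then 1 else - 1) (ts ! j')"
        using ij(3) by simp
      have "ts ! i' = ts ! j'"
        by (rule M_inj_t[OF eq]) (use ts_T ij' in auto)
      then have "i' = j'"
        using ts_inj ij' by blast
      moreover have "i < k \<longleftrightarrow> j < k"
        using eq M_pm[of "ts ! i'"] unfolding \<open>i' = j'\<close> by (auto split: if_splits)
      ultimately show "i = j"
        by (auto simp: i'_def j'_def split: if_splits)
    qed
    show "E ` {..<2 * k} = {e. e edge_of Q}"
    proof (intro equalityI subsetI)
      fix e assume "e \<in> E ` {..<2 * k}"
      then obtain i where i: "i < 2 * k" "e = E i"
        by blast
      then show "e \<in> {e. e edge_of Q}"
        using M_edge[of 1 "ts ! i"] M_edge[of "- 1" "ts ! (i - k)"] ts_T[of i] ts_T[of "i - k"]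
        by (auto simp: E_def)
    next
      fix e assume "e \<in> {e. e edge_of Q}"
      then obtain t where t: "t \<in> T" "e = M 1 t \<or> e = M (- 1) t"
        using edges by blast
      obtain i where i: "i < k" "t = ts ! i"
        using ts_ex[OF t(1)] by blast
      have "M 1 t = E i" "M (- 1) t = E (i + k)"
        using i by (auto simp: E_def)
      then show "e \<in> E ` {..<2 * k}"
        using t(2) i(1) by auto
    qed
  qed
  moreover have "E i \<inter> E (Suc i mod (2 * k)) \<noteq> {}" if i: "i < 2 * k" for i
  proof -
    consider "Suc i < k" | "Suc i = k" | "k \<le> i" "Suc i < 2 * k" | "k \<le> i" "Suc i = 2 * k"
      using i by linarith
    then show ?thesis
    proof cases
      case 1
      then have "M 1 (ts ! i) \<inter> M 1 (ts ! Suc i) \<noteq> {}"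
        using ts_gap ts_less[of i "Suc i"] by (intro adj) auto
      then show ?thesis
        using 1 by (simp add: E_def)
    next
      case 2
      then have "M 1 (ts ! (k - 1)) \<inter> M (- 1) (ts ! 0) \<noteq> {}"
        using ts_last ts_first by (intro turn) auto
      moreover have "k - 1 = i"
        using 2 by simp
      ultimately show ?thesis
        using 2 by (simp add: E_def)
    next
      case 3
      then have "M (- 1) (ts ! (i - k)) \<inter> M (- 1) (ts ! Suc (i - k)) \<noteq> {}"
        using ts_gap ts_less[of "i - k" "Suc (i - k)"] by (intro adj) auto
      then show ?thesis
        using 3 by (simp add: E_def Suc_diff_le)
    next
      \<comment> \<open>Now \<open>Suc i mod (2 * k)\<close> is 0, and the list closes up through
        \<open>- e2\<close>.\<close>
      case 4
      then have "M (- 1) (ts ! (k - 1)) \<inter> M (- (- 1)) (ts ! 0) \<noteq> {}"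
        using ts_last ts_first by (intro turn) auto
      moreover have "i - k = k - 1" "k > 0"
        using 4 by simp_all
      ultimately show ?thesis
        using 4 by (simp add: E_def)
    qed
  qed
  moreover have "affine_parallel (affine hull E i) (affine hull E (i + k))" if "i < k" for i
    using M_par[OF ts_T[OF that]] that by (simp add: E_def)
  ultimately show ?thesis
    unfolding belt_polygon_def using Q by blast
qed

section \<open>Zonotopes\<close>

lemma zonotope_mem_iff:
  fixes z :: "nat \<Rightarrow> 'a::euclidean_space"
  shows "x \<in> (+) t ` (\<Sum>i<n. closed_segment (- z i) (z i)) \<longleftrightarrow>
    (\<exists>l. (\<forall>i<n. \<bar>l i\<bar> \<le> 1) \<and> x = t + (\<Sum>i<n. l i *\<^sub>R z i))"
proof -
  have sym_seg: "(1 - h) *\<^sub>R (- w) + h *\<^sub>R w = (2 * h - 1) *\<^sub>R w" for h and w :: 'a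
    by (simp add: algebra_simps flip: scaleR_add_left)
  have seg: "y \<in> closed_segment (- w) w \<longleftrightarrow> (\<exists>l. \<bar>l\<bar> \<le> 1 \<and> y = l *\<^sub>R w)" for y w :: 'a
  proof
    assume "y \<in> closed_segment (- w) w"
    then obtain u where u: "0 \<le> u" "u \<le> 1" "y = (1 - u) *\<^sub>R (- w) + u *\<^sub>R w"
      by (auto simp: closed_segment_def)
    then have "y = (2 * u - 1) *\<^sub>R w"
      by (simp only: sym_seg)
    then show "\<exists>l. \<bar>l\<bar> \<le> 1 \<and> y = l *\<^sub>R w"
      using u by (intro exI[of _ "2 * u - 1"]) auto
  next
    assume "\<exists>l. \<bar>l\<bar> \<le> 1 \<and> y = l *\<^sub>R w"
    then obtain l where l: "\<bar>l\<bar> \<le> 1" "y = l *\<^sub>R w"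
      by blast
    have "(1 - (l + 1) / 2) *\<^sub>R (- w) + ((l + 1) / 2) *\<^sub>R w = (2 * ((l + 1) / 2) - 1) *\<^sub>R w"
      by (rule sym_seg)
    also have "2 * ((l + 1) / 2) - 1 = l"
      by (simp add: field_simps)
    finally show "y \<in> closed_segment (- w) w"
      using l unfolding closed_segment_def by (auto intro!: exI[of _ "(l + 1) / 2"])
  qed
  have "x \<in> (+) t ` (\<Sum>i<n. closed_segment (- z i) (z i)) \<longleftrightarrow>
      (\<exists>s. (\<forall>i<n. s i \<in> closed_segment (- z i) (z i)) \<and> x = t + (\<Sum>i<n. s i))"
    by (auto simp: set_sum_alt)
  also have "\<dots> \<longleftrightarrow> (\<exists>l. (\<forall>i<n. \<bar>l i\<bar> \<le> 1) \<and> x = t + (\<Sum>i<n. l i *\<^sub>R z i))"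
  proof
    assume "\<exists>s. (\<forall>i<n. s i \<in> closed_segment (- z i) (z i)) \<and> x = t + (\<Sum>i<n. s i)"
    then obtain s where s: "\<forall>i<n. s i \<in> closed_segment (- z i) (z i)" "x = t + (\<Sum>i<n. s i)"
      by blast
    then have "\<forall>i<n. \<exists>l. \<bar>l\<bar> \<le> 1 \<and> s i = l *\<^sub>R z i"
      by (simp only: seg)
    then obtain l where l: "\<And>i. i < n \<Longrightarrow> \<bar>l i\<bar> \<le> 1 \<and> s i = l i *\<^sub>R z i"
      by metis
    then have "(\<Sum>i<n. s i) = (\<Sum>i<n. l i *\<^sub>R z i)"
      by (intro sum.cong) auto
    then show "\<exists>l. (\<forall>i<n. \<bar>l i\<bar> \<le> 1) \<and> x = t + (\<Sum>i<n. l i *\<^sub>R z i)"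
      using s(2) l by (intro exI[of _ l]) simp
  next
    assume "\<exists>l. (\<forall>i<n. \<bar>l i\<bar> \<le> 1) \<and> x = t + (\<Sum>i<n. l i *\<^sub>R z i)"
    then obtain l where "\<forall>i<n. \<bar>l i\<bar> \<le> 1" "x = t + (\<Sum>i<n. l i *\<^sub>R z i)"
      by blast
    then show "\<exists>s. (\<forall>i<n. s i \<in> closed_segment (- z i) (z i)) \<and> x = t + (\<Sum>i<n. s i)"
      unfolding seg by (intro exI[of _ "\<lambda>i. l i *\<^sub>R z i"]) blast
  qed
  finally show ?thesis .
qed

text \<open>On the face exposed by \<open>c\<close>, the coefficient of \<open>z i\<close> equals
  the sign of \<open>c \<bullet> z i\<close> if this is nonzero and is free in [-1, 1] otherwise.
  Reflecting every coefficient in that sign preserves these conditions.\<close>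

lemma zonotope_face_centrally_symmetric:
  fixes P :: "'a::euclidean_space set"
  assumes P: "polytope P" and zon: "zonotope P" and F: "F face_of P" "F \<noteq> {}"
  shows "centrally_symmetric F"
proof -
  obtain t n and z :: "nat \<Rightarrow> 'a" where Pz: "P = (+) t ` (\<Sum>i<n. closed_segment (- z i) (z i))"
    using zon by (auto simp: zonotope_def)
  note mem = zonotope_mem_iff[of _ t z n, folded Pz]
  obtain c where c: "F = max_face P c"
    using face_eq_max_face[OF P F] by blast
  define h where "h = c \<bullet> t + (\<Sum>i<n. \<bar>c \<bullet> z i\<bar>)"
  have val: "c \<bullet> (t + (\<Sum>i<n. l i *\<^sub>R z i)) = c \<bullet> t + (\<Sum>i<n. l i * (c \<bullet> z i))" for l
    by (simp add: inner_add_right inner_sum_right)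
  have term_le: "l * (c \<bullet> z i) \<le> \<bar>c \<bullet> z i\<bar>" if "\<bar>l\<bar> \<le> 1" for l i
  proof -
    have "l * (c \<bullet> z i) \<le> \<bar>l\<bar> * \<bar>c \<bullet> z i\<bar>"
      by (metis abs_ge_self abs_mult)
    also have "\<dots> \<le> 1 * \<bar>c \<bullet> z i\<bar>"
      using that by (intro mult_right_mono) auto
    finally show ?thesis
      by simp
  qed
  have le: "c \<bullet> x \<le> h" if "x \<in> P" for x
  proof -
    obtain l where l: "\<forall>i<n. \<bar>l i\<bar> \<le> 1" "x = t + (\<Sum>i<n. l i *\<^sub>R z i)"
      using \<open>x \<in> P\<close> mem by blast
    then show ?thesis
      unfolding l(2) val h_def using term_le by (intro add_left_mono sum_mono) auto
  qed
  have top: "t + (\<Sum>i<n. sgn (c \<bullet> z i) *\<^sub>R z i) \<in> P"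
    unfolding mem by (intro exI[of _ "\<lambda>i. sgn (c \<bullet> z i)"]) (auto simp: sgn_if)
  have top_val: "c \<bullet> (t + (\<Sum>i<n. sgn (c \<bullet> z i) *\<^sub>R z i)) = h"
    unfolding val h_def by (simp add: abs_sgn mult.commute)
  have Fh: "x \<in> F \<longleftrightarrow> x \<in> P \<and> c \<bullet> x = h" for x
  proof
    assume "x \<in> F"
    then show "x \<in> P \<and> c \<bullet> x = h"
      using max_faceD[of x P c, OF _ top] le max_face_subset top_val unfolding c by (metis order_antisym subsetD)
  next
    assume "x \<in> P \<and> c \<bullet> x = h"
    then show "x \<in> F"
      using le by (auto simp: c max_face_def)
  qed
  \<comment> \<open>Since \<open>sgn 0 = 0\<close>, the free coefficients sit in the middle of their
    range.\<close>
  define m where "m = t + (\<Sum>i<n. sgn (c \<bullet> z i) *\<^sub>R z i)"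
  have refl: "2 *\<^sub>R m - x \<in> F" if x: "x \<in> F" for x
  proof -
    obtain l where l: "\<And>i. i < n \<Longrightarrow> \<bar>l i\<bar> \<le> 1" "x = t + (\<Sum>i<n. l i *\<^sub>R z i)"
      using x Fh mem by blast
    have "(\<Sum>i<n. \<bar>c \<bullet> z i\<bar> - l i * (c \<bullet> z i)) = 0"
      using x unfolding Fh h_def l(2) val by (simp add: sum_subtractf)
    then have tight: "l i * (c \<bullet> z i) = \<bar>c \<bullet> z i\<bar>" if "i < n" for i
      using sum_nonneg_eq_0_iff[of "{..<n}" "\<lambda>i. \<bar>c \<bullet> z i\<bar> - l i * (c \<bullet> z i)"] term_le l(1) that by simp
    have bound: "\<bar>2 * sgn (c \<bullet> z i) - l i\<bar> \<le> 1" if "i < n" for i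
    proof (cases "c \<bullet> z i = 0")
      case False
      have "l i * (c \<bullet> z i) = sgn (c \<bullet> z i) * (c \<bullet> z i)"
        using tight[OF that] by (simp add: abs_sgn mult.commute)
      with False have "l i = sgn (c \<bullet> z i)"
        by (metis mult_right_cancel)
      then show ?thesis
        using l(1)[OF that] by simp
    qed (use l(1)[OF that] in simp)
    have eq: "2 *\<^sub>R m - x = t + (\<Sum>i<n. (2 * sgn (c \<bullet> z i) - l i) *\<^sub>R z i)"
      by (simp add: m_def l(2) scaleR_diff_left sum_subtractf scaleR_add_right scaleR_sum_right scaleR_2)
    have "2 *\<^sub>R m - x \<in> P"
      unfolding mem using eq bound by (intro exI[of _ "\<lambda>i. 2 * sgn (c \<bullet> z i) - l i"]) blast
    moreover have "c \<bullet> (2 *\<^sub>R m - x) = h"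
      using x top_val by (simp add: Fh inner_diff_right m_def)
    ultimately show ?thesis
      by (simp add: Fh)
  qed
  have "(\<lambda>x. 2 *\<^sub>R m - x) ` F = F"
  proof
    show "F \<subseteq> (\<lambda>x. 2 *\<^sub>R m - x) ` F"
    proof
      fix x assume "x \<in> F"
      then show "x \<in> (\<lambda>x. 2 *\<^sub>R m - x) ` F"
        using refl by (intro image_eqI[of _ _ "2 *\<^sub>R m - x"]) auto
    qed
  qed (use refl in blast)
  then show ?thesis
    unfolding centrally_symmetric_def by blast
qed

section \<open>Vertices as signed sums of edge vectors\<close>

lemma segment_sgn_const:
  fixes c d w :: "'a::euclidean_space"
  assumes "\<And>s. 0 \<le> s \<Longrightarrow> s \<le> 1 \<Longrightarrow> ((1 - s) *\<^sub>R c + s *\<^sub>R d) \<bullet> w \<noteq> 0"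
  shows "sgn (c \<bullet> w) = sgn (d \<bullet> w)"
proof (rule ccontr)
  assume neq: "sgn (c \<bullet> w) \<noteq> sgn (d \<bullet> w)"
  have nz: "c \<bullet> w \<noteq> 0" "d \<bullet> w \<noteq> 0"
    using assms[of 0] assms[of 1] by auto
  define s where "s = (c \<bullet> w) / (c \<bullet> w - d \<bullet> w)"
  have opp: "c \<bullet> w > 0 \<and> d \<bullet> w < 0 \<or> c \<bullet> w < 0 \<and> d \<bullet> w > 0"
    using neq nz by (auto simp: sgn_if split: if_splits)
  then have s: "0 \<le> s" "s \<le> 1"
    by (auto simp: s_def field_simps)
  have "((1 - s) *\<^sub>R c + s *\<^sub>R d) \<bullet> w = c \<bullet> w - s * (c \<bullet> w - d \<bullet> w)"
    by (simp add: inner_add_left algebra_simps)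
  also have "\<dots> = 0"
    using opp by (auto simp: s_def)
  finally show False
    using assms s by blast
qed

lemma max_face_segment_vertex:
  assumes "max_face P c = {v}" "v \<in> max_face P d" "0 \<le> s" "s < 1"
  shows "max_face P ((1 - s) *\<^sub>R c + s *\<^sub>R d) = {v}"
proof -
  have vP: "v \<in> P"
    using assms(2) max_face_subset by blast
  show ?thesis
    unfolding max_face_singleton_iff[OF vP]
  proof
    fix y assume y: "y \<in> P - {v}"
    have "(1 - s) * (c \<bullet> y) < (1 - s) * (c \<bullet> v)"
      using max_face_strict[OF assms(1)] y assms(4) by simp
    moreover have "s * (d \<bullet> y) \<le> s * (d \<bullet> v)"
      using max_faceD[OF assms(2)] y assms(3) by (simp add: mult_left_mono)
    ultimately show "((1 - s) *\<^sub>R c + s *\<^sub>R d) \<bullet> y < ((1 - s) *\<^sub>R c + s *\<^sub>R d) \<bullet> v"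
      by (simp add: inner_add_left)
  qed
qed

text \<open>The vertex exposed by a generic \<open>c\<close> is a constant plus half the sum of the edge vectors
  (one for each pair \<open>\<plusminus>w\<close>) with the signs of \<open>c \<bullet> w\<close>: crossing an edge changes exactly one sign.\<close>

theorem centrally_symmetric_faces_imp_zonotope:
  fixes P :: "'a::euclidean_space set"
  assumes P: "polytope P" "P \<noteq> {}"
    and cs: "\<And>F. F face_of P \<Longrightarrow> aff_dim F = 2 \<Longrightarrow> centrally_symmetric F"
  shows "zonotope P"
proof -
  have face_poly: "polytope F" if "F face_of P" for F
    using that P(1) face_of_polytope_polytope by blast
  then have belt: "beltlike P"
    using cs centrally_symmetric_imp_beltlike P(1)
    by (intro belt_faces_beltlike) (auto simp: belt_faces_def)
  have exact: "has_edge_in (max_face P c) {u}" if "c \<bullet> u = 0" "has_edge_in P {u}" for c u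
  proof (rule has_edge_in_max_face[OF P(1)])
    show "{u} \<subseteq> range (\<lambda>s. s *\<^sub>R u)"
      by (auto intro: range_eqI[of _ _ 1])
    show "has_edge_in (max_face F c) {u}"
      if F: "F face_of P" "aff_dim F = 2" "c \<bullet> u = 0" "has_edge_in F {u}" for F c
      using centrally_symmetric_has_edge[OF face_poly[OF F(1)] F(2) cs[OF F(1,2)] F(3,4)] .
  qed (use that in auto)
  define W where "W = {w. \<exists>v. edge_vec P v w}"
  have finW: "finite W"
    unfolding W_def by (rule finite_edge_vecs[OF P(1)])
  have Wneg: "- w \<in> W" if "w \<in> W" for w
    using that edge_vec_rev by (auto simp: W_def)
  \<comment> \<open>An edge with vector \<open>w\<close> lies inside the edge with vector
    \<open>w'\<close>, so \<open>w\<close> is not longer; exchanging the roles gives equal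
    length.\<close>
  have len: "\<exists>r. \<bar>r\<bar> \<le> 1 \<and> w = r *\<^sub>R w'" if w: "w \<in> W" and w': "w' \<in> W" and par: "w = s *\<^sub>R w'" for w w' s
  proof -
    obtain v where v: "edge_vec P v w"
      using w by (auto simp: W_def)
    obtain v' where v': "edge_vec P v' w'"
      using w' by (auto simp: W_def)
    obtain d where d: "max_face P d = closed_segment v' (v' + w')" "d \<bullet> w' = 0"
      using edge_as_max_face[OF P(1) v'] .
    have "has_edge_in P {w}"
      using v by (auto simp: has_edge_in_def)
    then have "has_edge_in (closed_segment v' (v' + w')) {w}"
      using exact[of d w] d par by simp
    then obtain y where y: "edge_vec (closed_segment v' (v' + w')) y w"
      by (auto simp: has_edge_in_def)
    obtain a b where ab: "0 \<le> a" "a \<le> 1" "0 \<le> b" "b \<le> 1" "y = v' + a *\<^sub>R w'" "y + w = v' + b *\<^sub>R w'"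
      using edge_vec_mem[OF y] unfolding closed_segment_def by (auto simp: algebra_simps)
    then have "w = (v' + b *\<^sub>R w') - (v' + a *\<^sub>R w')"
      by (metis add_diff_cancel_left')
    then have "w = (b - a) *\<^sub>R w'"
      by (simp add: algebra_simps)
    then show ?thesis
      using ab by (intro exI[of _ "b - a"]) auto
  qed
  have W_par: "w = w' \<or> w = - w'" if w: "w \<in> W" "w' \<in> W" and sp: "w \<in> span {w'}" for w w'
  proof -
    have ne: "w \<noteq> 0" "w' \<noteq> 0"
      using w edge_vec_ne unfolding W_def by blast+
    obtain s where s: "w = s *\<^sub>R w'"
      using sp by (auto simp: span_singleton)
    then have s': "w' = (1 / s) *\<^sub>R w"
      using ne by auto
    obtain r where r: "\<bar>r\<bar> \<le> 1" "w = r *\<^sub>R w'"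
      using len[OF w s] by blast
    obtain q where q: "\<bar>q\<bar> \<le> 1" "w' = q *\<^sub>R w"
      using len[OF w(2,1) s'] by blast
    have "w = (r * q) *\<^sub>R w"
      using r(2) q(2) by (metis scaleR_scaleR)
    then have "r * q = 1"
      using ne(1) by (metis scaleR_cancel_right scaleR_one)
    then have "\<bar>r\<bar> * \<bar>q\<bar> = 1"
      by (simp flip: abs_mult)
    moreover have "\<bar>r\<bar> * \<bar>q\<bar> \<le> \<bar>r\<bar> * 1"
      using q(1) by (intro mult_left_mono) auto
    ultimately have "\<bar>r\<bar> = 1"
      using r(1) by linarith
    then show ?thesis
      using r(2) by (auto simp: abs_if split: if_splits)
  qed
  obtain v0 where v0: "v0 extreme_point_of P"
    using polytope_extreme_ne[OF P] by blast
  obtain c0 where c0: "max_face P c0 = {v0}"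
    using extreme_max_face[OF P(1) v0] by blast
  \<comment> \<open>One of each pair \<open>w\<close>, \<open>- w\<close>, since \<open>c0\<close>
    exposes a vertex and so vanishes on neither.\<close>
  define A where "A = {w \<in> W. c0 \<bullet> w > 0}"
  have A: "finite A" "A \<subseteq> W"
    using finW by (auto simp: A_def)
  have gen: "c \<bullet> w \<noteq> 0" if "max_face P c = {v}" "w \<in> W" for c v w
    using beltlike_generic[OF belt] that by (auto simp: W_def)
  define S where "S c = (\<Sum>w\<in>A. (sgn (c \<bullet> w) / 2) *\<^sub>R w)" for c
  \<comment> \<open>All functionals from \<open>c\<close> up to, but excluding, \<open>d\<close>
    expose \<open>v\<close> and so are orthogonal to no edge.\<close>
  have sgn_eq: "sgn (c \<bullet> w) = sgn (d \<bullet> w)"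
    if c: "max_face P c = {v}" "v \<in> max_face P d" and w: "w \<in> W" "d \<bullet> w \<noteq> 0" for c d v w
  proof (rule segment_sgn_const)
    fix s :: real assume "0 \<le> s" "s \<le> 1"
    show "((1 - s) *\<^sub>R c + s *\<^sub>R d) \<bullet> w \<noteq> 0"
    proof (cases "s = 1")
      case False
      then have "max_face P ((1 - s) *\<^sub>R c + s *\<^sub>R d) = {v}"
        using max_face_segment_vertex[OF c] \<open>0 \<le> s\<close> \<open>s \<le> 1\<close> by simp
      then show ?thesis
        using gen w(1) by blast
    qed (use w(2) in simp)
  qed
  define t where "t = v0 - S c0"
  define G where "G v \<longleftrightarrow> (\<forall>c. max_face P c = {v} \<longrightarrow> v = t + S c)" for v
  have vertex: "G v" if "v extreme_point_of P" for v
  proof (rule vertex_induct[OF P(1) v0 _ _ that])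
    have "S c = S c0" if c: "max_face P c = {v0}" for c
      unfolding S_def using sgn_eq[OF c, of c0] c0 gen[OF c0] A(2)
      by (intro sum.cong) (auto simp: subset_iff)
    then show "G v0"
      by (simp add: G_def t_def)
    fix v a assume v: "v extreme_point_of P" "G v" and a: "edge_vec P v a"
    show "G (v + a)"
      unfolding G_def
    proof (intro allI impI)
      fix c' assume c': "max_face P c' = {v + a}"
      obtain c where c: "max_face P c = {v}"
        using extreme_max_face[OF P(1) v(1)] by blast
      obtain d where d: "max_face P d = closed_segment v (v + a)" "d \<bullet> a = 0"
        using edge_as_max_face[OF P(1) a] .
      have ends: "v \<in> max_face P d" "v + a \<in> max_face P d"
        using d(1) by auto
      have aW: "a \<in> W" "- a \<in> W"
        using a Wneg by (auto simp: W_def)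
      have ca: "c \<bullet> a < 0" "c' \<bullet> a > 0"
        using max_face_edge_less[OF c a] max_face_edge_less[OF c' edge_vec_rev[OF a]] by auto
      define b where "b = (if c0 \<bullet> a > 0 then a else - a)"
      have b: "b \<in> A"
        using aW gen[OF c0 aW(1)] by (auto simp: b_def A_def)
      \<comment> \<open>From \<open>c\<close> through \<open>d\<close> to \<open>c'\<close> only the
        sign at \<open>b\<close> can change, as \<open>d\<close> is orthogonal to no edge except
        those parallel to \<open>a\<close>.\<close>
      have other: "sgn (c' \<bullet> w) = sgn (c \<bullet> w)" if w: "w \<in> A - {b}" for w
      proof -
        have wW: "w \<in> W" "c0 \<bullet> w > 0"
          using w by (auto simp: A_def)
        have "d \<bullet> w \<noteq> 0"
        proof
          assume dw: "d \<bullet> w = 0"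
          obtain x where "edge_vec P x w"
            using wW(1) by (auto simp: W_def)
          then have "w \<in> span {a}"
            using beltlike_edge_normal[OF belt d(1) _ dw] by blast
          then have "w = a \<or> w = - a"
            using W_par wW(1) aW(1) by blast
          then show False
            using w wW(2) by (auto simp: b_def)
        qed
        then show ?thesis
          using sgn_eq[OF c ends(1) wW(1)] sgn_eq[OF c' ends(2) wW(1)] by simp
      qed
      have "S c' = (sgn (c' \<bullet> b) / 2) *\<^sub>R b + (\<Sum>w\<in>A - {b}. (sgn (c' \<bullet> w) / 2) *\<^sub>R w)"
        unfolding S_def by (rule sum.remove[OF A(1) b])
      also have "(\<Sum>w\<in>A - {b}. (sgn (c' \<bullet> w) / 2) *\<^sub>R w) = (\<Sum>w\<in>A - {b}. (sgn (c \<bullet> w) / 2) *\<^sub>R w)"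
        using other by (intro sum.cong) auto
      \<comment> \<open>Half of \<open>b\<close> with the new sign is a full step along
        \<open>a\<close> plus half of \<open>b\<close> with the old sign.\<close>
      also have "(sgn (c' \<bullet> b) / 2) *\<^sub>R b = sgn (c' \<bullet> b) *\<^sub>R b + (- sgn (c' \<bullet> b) / 2) *\<^sub>R b"
      proof -
        have "sgn (c' \<bullet> b) / 2 = sgn (c' \<bullet> b) + - sgn (c' \<bullet> b) / 2"
          by simp
        then show ?thesis
          by (metis scaleR_add_left)
      qed
      also have "sgn (c' \<bullet> b) *\<^sub>R b = a"
        using ca by (simp add: b_def)
      also have "- sgn (c' \<bullet> b) = sgn (c \<bullet> b)"
        using ca by (simp add: b_def)
      also have "a + (sgn (c \<bullet> b) / 2) *\<^sub>R b + (\<Sum>w\<in>A - {b}. (sgn (c \<bullet> w) / 2) *\<^sub>R w) = a + S c"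
        unfolding S_def by (simp add: sum.remove[OF A(1) b])
      finally show "v + a = t + S c'"
        using v(2) c by (simp add: G_def)
    qed
  qed
  obtain g where g: "bij_betw g {..<card A} A"
    using ex_bij_betw_nat_finite[OF A(1)] by (auto simp: atLeast0LessThan)
  define n where "n = card A"
  \<comment> \<open>Half of an edge vector, since the segment from \<open>- z i\<close> to
    \<open>z i\<close> has twice the length of \<open>z i\<close>.\<close>
  define z where "z i = (1 / 2) *\<^sub>R g i" for i
  define Z where "Z = (+) t ` (\<Sum>i<n. closed_segment (- z i) (z i))"
  note memZ = zonotope_mem_iff[of _ t z n, folded Z_def]
  have reindex: "(\<Sum>w\<in>A. f w) = (\<Sum>i<n. f (g i))" for f :: "'a \<Rightarrow> 'b::comm_monoid_add"
    unfolding n_def by (rule sum.reindex_bij_betw[OF g, symmetric])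
  have "P \<subseteq> Z"
  proof -
    have "{v. v extreme_point_of P} \<subseteq> Z"
    proof
      fix v assume "v \<in> {v. v extreme_point_of P}"
      then have v: "v extreme_point_of P"
        by simp
      obtain c where c: "max_face P c = {v}"
        using extreme_max_face[OF P(1) v] by blast
      have "v = t + S c"
        using vertex[OF v] c by (simp add: G_def)
      also have "S c = (\<Sum>i<n. sgn (c \<bullet> g i) *\<^sub>R z i)"
        by (simp add: S_def reindex z_def)
      finally show "v \<in> Z"
        unfolding memZ by (intro exI[of _ "\<lambda>i. sgn (c \<bullet> g i)"]) (auto simp: sgn_if)
    qed
    moreover have "convex Z"
      unfolding Z_def by (intro convex_translation convex_set_sum convex_closed_segment)
    ultimately show ?thesis
      using polytope_eq_hull_extreme[OF P(1)] hull_minimal by metis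
  qed
  \<comment> \<open>A point of \<open>Z\<close> outside \<open>P\<close> is separated from
    \<open>P\<close> by a functional, which may be perturbed to expose a vertex \<open>v\<close> of
    \<open>P\<close>. For such a functional the sign formula makes \<open>v\<close> maximal on
    \<open>Z\<close>.\<close>
  moreover have "Z \<subseteq> P"
  proof (rule ccontr)
    assume "\<not> Z \<subseteq> P"
    then obtain x where x: "x \<in> Z" "x \<notin> P"
      by blast
    obtain a b where ab: "a \<bullet> x < b" "\<And>y. y \<in> P \<Longrightarrow> a \<bullet> y > b"
      using separating_hyperplane_closed_point[of P x] x(2) P(1) polytope_imp_convex polytope_imp_closed
      by blast
    define U where "U = (\<Inter>v\<in>{v. v extreme_point_of P}. {c. c \<bullet> v < c \<bullet> x})"
    have "open U"
      unfolding U_def using polytope_finite_extreme[OF P(1)]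
      by (intro open_INT ballI open_Collect_less continuous_intros)
    moreover have "- a \<in> U"
      using ab by (fastforce simp: U_def extreme_point_of_def)
    ultimately obtain e where e: "e > 0" "ball (- a) e \<subseteq> U"
      using open_contains_ball by blast
    have "\<exists>c\<in>UNIV. dist c (- a) < e \<and> (\<forall>w\<in>W. w \<bullet> c \<noteq> 0)"
    proof (rule generic_near[OF subspace_UNIV UNIV_I finW _ e(1)])
      show "\<exists>z\<in>UNIV. w \<bullet> z \<noteq> 0" if "w \<in> W" for w
        using that edge_vec_ne by (intro bexI[of _ w]) (auto simp: W_def)
    qed
    then obtain c where "dist c (- a) < e" and cW: "\<forall>w\<in>W. w \<bullet> c \<noteq> 0"
      by blast
    then have "c \<in> ball (- a) e"
      by (simp add: dist_commute)
    then have c: "c \<in> U" "\<And>w. w \<in> W \<Longrightarrow> c \<bullet> w \<noteq> 0"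
      using e(2) cW inner_commute[of c] by auto
    then obtain v where v: "max_face P c = {v}"
      using no_edge_imp_singleton[OF P, of c] by (auto simp: W_def)
    then have v': "v extreme_point_of P"
      using max_face_singleton_extreme P(1) by blast
    obtain l where l: "\<forall>i<n. \<bar>l i\<bar> \<le> 1" "x = t + (\<Sum>i<n. l i *\<^sub>R z i)"
      using x(1) memZ by blast
    have "c \<bullet> x = c \<bullet> t + (\<Sum>i<n. l i * (c \<bullet> z i))"
      by (simp add: l(2) inner_add_right inner_sum_right)
    also have "(\<Sum>i<n. l i * (c \<bullet> z i)) \<le> (\<Sum>i<n. sgn (c \<bullet> g i) * (c \<bullet> z i))"
    proof (rule sum_mono)
      fix i assume "i \<in> {..<n}"
      then have "l i * (c \<bullet> z i) \<le> 1 * \<bar>c \<bullet> z i\<bar>"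
        using l(1) by (metis abs_ge_self abs_ge_zero abs_mult lessThan_iff mult_right_mono order_trans)
      also have "\<dots> = sgn (c \<bullet> g i) * (c \<bullet> z i)"
        by (simp add: z_def sgn_if)
      finally show "l i * (c \<bullet> z i) \<le> sgn (c \<bullet> g i) * (c \<bullet> z i)" .
    qed
    also have "c \<bullet> t + (\<Sum>i<n. sgn (c \<bullet> g i) * (c \<bullet> z i)) = c \<bullet> (t + S c)"
      by (simp add: S_def reindex z_def inner_add_right inner_sum_right)
    also have "t + S c = v"
      using vertex[OF v'] v by (simp add: G_def)
    finally have "c \<bullet> x \<le> c \<bullet> v"
      by simp
    moreover have "c \<bullet> v < c \<bullet> x"
      using c(1) v' by (simp add: U_def)
    ultimately show False
      by simp
  qed
  ultimately have "P = Z"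
    by blast
  then show ?thesis
    unfolding zonotope_def Z_def by blast
qed

section \<open>Faces of inscribed polytopes and the two equivalences\<close>

lemma inscribed_face:
  assumes "inscribed P" "F face_of P"
  shows "inscribed F"
  using assms extreme_point_of_face[OF assms(2)] unfolding inscribed_def by (metis (mono_tags, lifting) mem_Collect_eq subset_iff)

theorem theorem5p4:
  fixes P :: "'a::euclidean_space set"
  assumes "polytope P" and "P \<noteq> {}"
  shows "(inscribed P \<and> belt_polytope P \<longleftrightarrow>
           (\<forall>F. F face_of P \<and> aff_dim F = 2 \<longrightarrow> inscribed F \<and> belt_polygon F)) \<and>
         (inscribed P \<and> zonotope P \<longleftrightarrow>
           (\<forall>F. F face_of P \<and> aff_dim F = 2 \<longrightarrow> inscribed F \<and> centrally_symmetric F))"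
proof (intro conjI iffI allI impI; (elim conjE)?)
  fix F assume "inscribed P" and belt: "belt_polytope P" and F: "F face_of P" "aff_dim F = 2"
  then show "inscribed F"
    using inscribed_face by blast
  show "belt_polygon F"
    using belt_polytope_face_edge_perp[OF belt F(1)] face_of_polytope_polytope[OF assms(1) F(1)] F(2)
    by (intro opposite_edges_imp_belt_polygon)
next
  assume faces: "\<forall>F. F face_of P \<and> aff_dim F = 2 \<longrightarrow> inscribed F \<and> belt_polygon F"
  then have "belt_faces P"
    using assms(1) belt_polygon_imp_beltlike by (auto simp: belt_faces_def)
  then show "inscribed P" "belt_polytope P"
    using belt_faces_inscribed belt_faces_beltlike beltlike_imp_belt_polytope faces assms by blast+
next
  fix F assume "inscribed P" and zon: "zonotope P" and F: "F face_of P" "aff_dim F = 2"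
  then show "inscribed F"
    using inscribed_face by blast
  show "centrally_symmetric F"
    using zonotope_face_centrally_symmetric[OF assms(1) zon F(1)] F(2) by fastforce
next
  assume faces: "\<forall>F. F face_of P \<and> aff_dim F = 2 \<longrightarrow> inscribed F \<and> centrally_symmetric F"
  then have "belt_faces P"
    using assms(1) centrally_symmetric_imp_beltlike face_of_polytope_polytope by (auto simp: belt_faces_def)
  then show "inscribed P"
    using belt_faces_inscribed faces assms(2) by blast
  show "zonotope P"
    using centrally_symmetric_faces_imp_zonotope faces assms by blast
qed

end
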